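(* Let $(X_t)_{t\in\mathbb{R}^N_+}$ be an $N$-parameter Lévy process with values in $\mathbb{R}$ and multidimensional Lévy exponent $\Psi=(\psi_1,\dots,\psi_N)$, where each $\psi_j$ is twice differentiable in a neighborhood of $\xi=0$ with $\psi_j''(0)\ne0$. Put $\mu=(\mu_1,\dots,\mu_N)$ with $\mu_j=\mathbb{E}X_{e_j}$. Let $\alpha\in(0,1)$, and for each $k=1,\dots,N$ let $L_k(t_k)=\inf\{x>0:H_k(x)>t_k\}$ be the inverse of an $\alpha$-stable subordinator $H_k$, where $L_1,\dots,L_N$ are mutually independent and independent of $X$. Write $L_t=(L_1(t_1),\dots,L_N(t_N))$ for $t=(t_1,\dots,t_N)\in\mathbb{R}^N_+$. Then, for $s\preceq t$ and $|t|\to\infty$, the autocorrelation $$\rho(X_{L_s},X_{L_t})=\frac{Cov(X_{L_s},X_{L_t})}{\sqrt{Var\,X_{L_s}}\sqrt{Var\,X_{L_t}}}$$ satisfies $$\rho(X_{L_s},X_{L_t})\sim\begin{cases}\dfrac{1}{|t^{\alpha}|^{1/2}} & \text{if }\mu=0,\\[2mm] \dfrac{1}{|t^{2\alpha}|^{1/2}} & \text{if }\mu\neq0.\end{cases}$$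
   Context: $\mathbb{R}^N_+=[0,\infty)^N$ with the partial order $a\preceq b$ iff $a_j\le b_j$ for all $j$; $\{e_1,\dots,e_N\}$ is the canonical basis of $\mathbb{R}^N$; $|\cdot|$ is the Euclidean norm; $t^\beta:=(t_1^\beta,\dots,t_N^\beta)$. The point $s$ is fixed, and $\sim$ means "behaves like", i.e. the ratio of the two sides is bounded above and below by positive constants not depending on $t$. An $N$-parameter Lévy process $(X_t)_{t\in\mathbb{R}^N_+}$ is a random field such that: (1) $X_0=0$ a.s.; (2) for any $0=t^{(0)}\preceq t^{(1)}\preceq\dots\preceq t^{(k)}$ the increments $X_{t^{(j)}}-X_{t^{(j-1)}}$ are independent; (3) $X_{t+\tau}-X_t\overset{d}{=}X_\tau$ for all $t,\tau$; (4) its paths are a.s. cadlag (right continuous along $\preceq$-decreasing sequences, with limits along $\preceq$-increasing sequences); (5) it is continuous in probability. The exponents $\psi_j$ are defined by $\mathbb{E}e^{i\xi X_{t_je_j}}=e^{t_j\psi_j(\xi)}$, $t_j\ge0$, $\xi\in\mathbb{R}$. An $\alpha$-stable subordinator $H$ is a nondecreasing Lévy process on $[0,\infty)$ with $\mathbb{E}e^{-\lambda H(t)}=e^{-ct\lambda^\alpha}$, $\lambda\ge0$, for some constant $c>0$.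
   Formalization: If μ≠0 has zero components, the rate is stated only for t with |t| ≤ K|(t_j)_{μ_j≠0}|, any K (it fails otherwise, e.g. μ=(1,0), t=(s_1,n)); for μ=0 and for all μ_j≠0 it is stated in full. Also s≠0 is assumed, since at s=0 the autocorrelation is 0/0. *)

theory Defs
  imports "HOL-Probability.Probability"
begin

text \<open>
  The order on \<^typ>\<open>real ^ 'n\<close> is the library's componentwise order, so \<open>{0..}\<close> is the closed
  positive orthant.  The parameter type is kept generic: \<^typ>\<open>real ^ 'n\<close> gives \<open>N\<close>-parameter
  processes, \<^typ>\<open>real\<close> gives classical Levy processes on the half-line.
\<close>

text \<open>Values of \<open>u\<close> outside \<open>{0..}\<close> are irrelevant: both kinds of sequences stay in the orthant.\<close>

definition cadlag_path :: "('a::ordered_euclidean_space \<Rightarrow> real) \<Rightarrow> bool" where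
  "cadlag_path x \<longleftrightarrow>
     (\<forall>u t. (\<forall>n. 0 \<le> u n) \<and> decseq u \<and> u \<longlonglongrightarrow> t \<longrightarrow> (\<lambda>n::nat. x (u n)) \<longlonglongrightarrow> x t) \<and>
     (\<forall>u t. (\<forall>n. 0 \<le> u n) \<and> incseq u \<and> u \<longlonglongrightarrow> t \<longrightarrow> convergent (\<lambda>n::nat. x (u n)))"

definition levy_process ::
  "'w measure \<Rightarrow> ('a::ordered_euclidean_space \<Rightarrow> 'w \<Rightarrow> real) \<Rightarrow> bool" where
  "levy_process M X \<longleftrightarrow>
     (\<forall>t\<ge>0. X t \<in> borel_measurable M) \<and>
     (AE \<omega> in M. X 0 \<omega> = 0) \<and>
     (\<forall>(t :: nat \<Rightarrow> 'a) k. t 0 = 0 \<and> (\<forall>j<k. t j \<le> t (Suc j)) \<longrightarrow>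
        prob_space.indep_vars M (\<lambda>_. borel) (\<lambda>j \<omega>. X (t (Suc j)) \<omega> - X (t j) \<omega>) {..<k}) \<and>
     (\<forall>t\<ge>0. \<forall>\<tau>\<ge>0. distr M borel (\<lambda>\<omega>. X (t + \<tau>) \<omega> - X t \<omega>) = distr M borel (X \<tau>)) \<and>
     (AE \<omega> in M. cadlag_path (\<lambda>t. X t \<omega>)) \<and>
     (\<forall>t\<ge>0. \<forall>\<epsilon>>0.
        ((\<lambda>u. measure M {\<omega> \<in> space M. \<bar>X u \<omega> - X t \<omega>\<bar> > \<epsilon>}) \<longlongrightarrow> 0) (at t within {0..}))"

text \<open>As the identity is required for all \<open>u \<ge> 0\<close>, it determines each \<open>\<psi> j\<close> uniquely.\<close>

definition levy_exponent ::
  "'w measure \<Rightarrow> (real ^ 'n \<Rightarrow> 'w \<Rightarrow> real) \<Rightarrow> ('n \<Rightarrow> real \<Rightarrow> complex) \<Rightarrow> bool" where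
  "levy_exponent M X \<psi> \<longleftrightarrow>
     (\<forall>j. \<forall>u\<ge>0. \<forall>\<xi>. char (distr M borel (X (u *\<^sub>R axis j 1))) \<xi> = exp (of_real u * \<psi> j \<xi>))"

definition deriv2 :: "(real \<Rightarrow> complex) \<Rightarrow> real \<Rightarrow> complex" where
  "deriv2 f x = vector_derivative (\<lambda>y. vector_derivative f (at y)) (at x)"

definition twice_differentiable_near :: "(real \<Rightarrow> complex) \<Rightarrow> real \<Rightarrow> bool" where
  "twice_differentiable_near f x \<longleftrightarrow>
     (\<exists>U. open U \<and> x \<in> U \<and> f differentiable_on U \<and>
          (\<lambda>y. vector_derivative f (at y)) differentiable_on U)"

definition stable_subordinator :: "'w measure \<Rightarrow> real \<Rightarrow> (real \<Rightarrow> 'w \<Rightarrow> real) \<Rightarrow> bool" where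
  "stable_subordinator M \<alpha> H \<longleftrightarrow>
     levy_process M H \<and>
     (AE \<omega> in M. mono_on {0..} (\<lambda>x. H x \<omega>)) \<and>
     (\<exists>c>0. \<forall>t\<ge>0. \<forall>r\<ge>0.
        prob_space.expectation M (\<lambda>\<omega>. exp (- r * H t \<omega>)) = exp (- c * t * r powr \<alpha>))"

definition inverse_process :: "(real \<Rightarrow> 'w \<Rightarrow> real) \<Rightarrow> real \<Rightarrow> 'w \<Rightarrow> real" where
  "inverse_process H t \<omega> = Inf {x. x > 0 \<and> H x \<omega> > t}"

definition time_change ::
  "(real ^ 'n \<Rightarrow> 'w \<Rightarrow> real) \<Rightarrow> ('n \<Rightarrow> real \<Rightarrow> 'w \<Rightarrow> real) \<Rightarrow> real ^ 'n \<Rightarrow> 'w \<Rightarrow> real" where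
  "time_change X L t \<omega> = X (\<chi> k. L k (t $ k) \<omega>) \<omega>"

text \<open>The sigma-algebra generated by the variables \<open>Y t\<close>, \<open>t \<in> T\<close>.\<close>

definition process_sigma :: "'w measure \<Rightarrow> 'i set \<Rightarrow> ('i \<Rightarrow> 'w \<Rightarrow> real) \<Rightarrow> 'w set set" where
  "process_sigma M T Y = sigma_sets (space M) {Y t -` B \<inter> space M | t B. t \<in> T \<and> B \<in> sets borel}"

text \<open>
  Joint independence of the \<open>N + 1\<close> processes \<open>X\<close> (index \<^const>\<open>None\<close>) and \<open>L k\<close>
  (index \<^term>\<open>Some k\<close>), i.e. the \<open>L k\<close> are mutually independent and independent of \<open>X\<close>.

  Path regularity holds only almost surely, so the inverse processes and the time-changed process
  are in general measurable only up to null sets.  This predicate and \<open>correlation\<close> below are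
  therefore meant to be used with \<open>completion M\<close>, which leaves independence and expectations
  of \<open>M\<close>-measurable variables unchanged.
\<close>

definition independent_processes ::
  "'w measure \<Rightarrow> (real ^ 'n \<Rightarrow> 'w \<Rightarrow> real) \<Rightarrow> ('n \<Rightarrow> real \<Rightarrow> 'w \<Rightarrow> real) \<Rightarrow> bool" where
  "independent_processes M X L \<longleftrightarrow>
     prob_space.indep_sets M
       (case_option (process_sigma M {0..} X) (\<lambda>k. process_sigma M {0..} (L k))) UNIV"

definition covariance :: "'w measure \<Rightarrow> ('w \<Rightarrow> real) \<Rightarrow> ('w \<Rightarrow> real) \<Rightarrow> real" where
  "covariance M Y Z =
     prob_space.expectation M
       (\<lambda>\<omega>. (Y \<omega> - prob_space.expectation M Y) * (Z \<omega> - prob_space.expectation M Z))"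

definition correlation :: "'w measure \<Rightarrow> ('w \<Rightarrow> real) \<Rightarrow> ('w \<Rightarrow> real) \<Rightarrow> real" where
  "correlation M Y Z =
     covariance M Y Z / (sqrt (prob_space.variance M Y) * sqrt (prob_space.variance M Z))"

definition vec_powr :: "real ^ 'n \<Rightarrow> real \<Rightarrow> real ^ 'n" where
  "vec_powr t \<beta> = (\<chi> j. (t $ j) powr \<beta>)"

text \<open>
  \<open>f(t) \<sim> g(t)\<close> as \<open>|t| \<rightarrow> \<infinity>\<close> within \<open>D\<close>.  This is stricter than membership in
  the library's \<open>\<Theta>\<close>, which only compares absolute values.
\<close>

definition behaves_like_on ::
  "'a::real_normed_vector set \<Rightarrow> ('a \<Rightarrow> real) \<Rightarrow> ('a \<Rightarrow> real) \<Rightarrow> bool" where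
  "behaves_like_on D f g \<longleftrightarrow>
     (\<exists>c>0. \<exists>C>0. \<forall>\<^sub>F t in inf at_infinity (principal D). c \<le> f t / g t \<and> f t / g t \<le> C)"

text \<open>
  The times \<open>t \<ge> s\<close> whose norm is controlled by the coordinates in the directions with
  \<open>\<mu> $ j \<noteq> 0\<close>.  If \<open>\<mu>\<close> has no zero component, this is all of \<open>{s..}\<close> as soon as \<open>K \<ge> 1\<close>.
  If \<open>\<mu>\<close> is nonzero but has zero components, the restriction is needed: when \<open>t\<close> goes to
  infinity along a direction \<open>j\<close> with \<open>\<mu> $ j = 0\<close>, the variance of the time-changed process
  grows only like \<open>(t $ j) powr \<alpha>\<close>, and the rate for \<open>\<mu> \<noteq> 0\<close> fails.
\<close>

definition drift_dominated :: "real ^ 'n \<Rightarrow> real ^ 'n \<Rightarrow> real \<Rightarrow> (real ^ 'n) set" where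
  "drift_dominated \<mu> s K = {t. s \<le> t \<and> norm t \<le> K * norm (\<chi> j. if \<mu> $ j = 0 then 0 else t $ j)}"

end

theory Submission
  imports Defs "HOL-Real_Asymp.Real_Asymp"
begin

text \<open>
  Conditioning on the clocks, with \<open>\<sigma>\<close> the variances of \<open>X\<close> along the axes,
  \<open>Cov (X L\<^sub>s) (X L\<^sub>t) = \<Sum> \<sigma>\<^sub>k E L\<^sub>k(s\<^sub>k) + \<Sum> \<mu>\<^sub>k^2 Cov (L\<^sub>k(s\<^sub>k)) (L\<^sub>k(t\<^sub>k))\<close> for \<open>s \<le> t\<close>.
  Writing the mixed moment of a clock as a double integral of \<open>P (H x \<le> s, H y \<le> t)\<close> and using the
  independent increments of \<open>H\<close> gives \<open>0 \<le> Cov (L s) (L t) \<le> E (L s)^2\<close>, so the numerator of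
  the correlation stays between two positive constants.  Bounds on the tails of \<open>H x\<close> from its Laplace
  transform give \<open>E (L t)\<close> of order \<open>t powr \<alpha>\<close> and \<open>Var (L t)\<close> of order \<open>t powr (2 * \<alpha>)\<close>, which
  determines the growth of the denominator.
\<close>

section \<open>Square integrable functions\<close>

text \<open>Two obstacles shape the proof. The first is conditioning: \<open>X\<close> need not be
  jointly measurable in time and outcome, and its paths are regular only almost surely. Random times
  are therefore rounded up to dyadic points, where the field splits over countably many values and
  independence applies; right continuity and Fatou then carry first and second moments to the actual
  times in L2. The second is that only characteristic functions and Laplace transforms are given.
  Second moments of \<open>X\<close> come from a quadratic bound on one minus the real part of the
  characteristic function, and the condition on the second derivative of \<psi> makes every
  component of \<sigma> positive. Each clock is treated by comparing \<open>x < L t\<close> and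
  \<open>x \<le> L t\<close> with \<open>H x \<le> t\<close>, up to boundaries which layer cake
  integrals do not see. The lower bound on the clock variance needs mass of \<open>L t\<close> on
  both sides of a gap proportional to \<open>t powr \<alpha>\<close>, here from
  \<open>t powr \<alpha> / (8 * c)\<close> to \<open>t powr \<alpha> / (4 * c)\<close>; the lower
  side is the delicate one.\<close>

definition square_integrable :: "'w measure \<Rightarrow> ('w \<Rightarrow> real) \<Rightarrow> bool" where
  "square_integrable M f \<longleftrightarrow> f \<in> borel_measurable M \<and> integrable M (\<lambda>w. (f w)\<^sup>2)"

lemma square_integrable_measurable [measurable_dest]:
  "square_integrable M f \<Longrightarrow> f \<in> borel_measurable M"
  by (simp add: square_integrable_def)

lemma square_integrable_mult:
  assumes f: "square_integrable M f" and g: "square_integrable M g"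
  shows "integrable M (\<lambda>w. f w * g w)"
proof (rule Bochner_Integration.integrable_bound)
  show "integrable M (\<lambda>w. (f w)\<^sup>2 + (g w)\<^sup>2)"
    using f g by (simp add: square_integrable_def)
  show "(\<lambda>w. f w * g w) \<in> borel_measurable M"
    using f g by measurable
  have "\<bar>a * b\<bar> \<le> \<bar>a\<^sup>2 + b\<^sup>2\<bar>" for a b :: real
  proof -
    have "0 \<le> (\<bar>a\<bar> - \<bar>b\<bar>)\<^sup>2" by simp
    then have "2 * (\<bar>a\<bar> * \<bar>b\<bar>) \<le> a\<^sup>2 + b\<^sup>2"
      by (simp add: power2_diff)
    moreover have "0 \<le> \<bar>a\<bar> * \<bar>b\<bar>" by simp
    ultimately have "\<bar>a\<bar> * \<bar>b\<bar> \<le> a\<^sup>2 + b\<^sup>2" by linarith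
    then show ?thesis by (simp add: abs_mult)
  qed
  then show "AE w in M. norm (f w * g w) \<le> norm ((f w)\<^sup>2 + (g w)\<^sup>2)"
    by simp
qed

lemma square_integrable_cmult:
  "square_integrable M f \<Longrightarrow> square_integrable M (\<lambda>w. c * f w)"
  by (auto simp: square_integrable_def power_mult_distrib)

lemma square_integrable_add:
  assumes f: "square_integrable M f" and g: "square_integrable M g"
  shows "square_integrable M (\<lambda>w. f w + g w)"
proof -
  have "integrable M (\<lambda>w. (f w)\<^sup>2 + (g w)\<^sup>2 + 2 * (f w * g w))"
    using f g square_integrable_mult[OF f g] by (auto simp: square_integrable_def)
  moreover have "(\<lambda>w. f w + g w) \<in> borel_measurable M"
    using f g by measurable
  ultimately show ?thesis
    by (simp add: square_integrable_def power2_sum algebra_simps)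
qed

lemma square_integrable_diff:
  assumes "square_integrable M f" "square_integrable M g"
  shows "square_integrable M (\<lambda>w. f w - g w)"
  using square_integrable_add[OF assms(1) square_integrable_cmult[OF assms(2), of "-1"]] by simp

lemma square_integrable_sum:
  assumes "\<And>i. i \<in> I \<Longrightarrow> square_integrable M (f i)"
  shows "square_integrable M (\<lambda>w. \<Sum>i\<in>I. f i w)"
  using assms
proof (induction I rule: infinite_finite_induct)
  case (insert x F)
  then show ?case by (auto intro: square_integrable_add)
qed (auto simp: square_integrable_def)

lemma (in prob_space) square_integrable_const: "square_integrable M (\<lambda>_. c)"
  by (simp add: square_integrable_def)

lemma (in prob_space) square_integrable_integrable:
  "square_integrable M f \<Longrightarrow> integrable M f"
  using square_integrable_mult[of M f "\<lambda>_. 1"] square_integrable_const by simp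

lemma square_integrable_cong_AE:
  assumes f: "square_integrable M f" and g: "g \<in> borel_measurable M" and ae: "AE w in M. f w = g w"
  shows "square_integrable M g"
proof -
  have "integrable M (\<lambda>w. (g w)\<^sup>2) \<longleftrightarrow> integrable M (\<lambda>w. (f w)\<^sup>2)"
    using f g ae by (intro integrable_cong_AE) (auto simp: square_integrable_def)
  then show ?thesis using f g by (simp add: square_integrable_def)
qed

lemma quadratic_nonneg_imp_discriminant:
  fixes A B C :: real
  assumes nn: "\<And>x. 0 \<le> A + 2 * x * B + x\<^sup>2 * C" and C: "0 \<le> C"
  shows "B\<^sup>2 \<le> A * C"
proof (cases "C = 0")
  case True
  have "B = 0"
  proof (rule ccontr)
    assume "B \<noteq> 0"
    \<comment> \<open>For \<open>C = 0\<close> the form is affine in \<open>x\<close>; this witness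
      gives it the value -1.\<close>
    with nn[of "- (A + 1) / (2 * B)"] True show False by (simp add: field_simps)
  qed
  then show ?thesis using True by simp
next
  case False
  with C have "C > 0" by simp
  \<comment> \<open>The vertex of the parabola, where the form equals
    \<open>A - B^2 / C\<close>.\<close>
  with nn[of "- B / C"] show ?thesis
    by (simp add: field_simps power2_eq_square)
qed

lemma integral_Cauchy_Schwarz:
  assumes f: "square_integrable M f" and g: "square_integrable M g"
  shows "\<bar>\<integral>w. f w * g w \<partial>M\<bar> \<le> sqrt (LINT w|M. (f w)\<^sup>2) * sqrt (LINT w|M. (g w)\<^sup>2)"
proof -
  have if2: "integrable M (\<lambda>w. (f w)\<^sup>2)" and ig2: "integrable M (\<lambda>w. (g w)\<^sup>2)"
    using f g by (auto simp: square_integrable_def)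
  have "(LINT w|M. f w * g w)\<^sup>2 \<le> (LINT w|M. (f w)\<^sup>2) * (LINT w|M. (g w)\<^sup>2)"
  proof (rule quadratic_nonneg_imp_discriminant)
    fix x :: real
    have "0 \<le> (LINT w|M. (f w + x * g w)\<^sup>2)" by simp
    also have "\<dots> = (LINT w|M. (f w)\<^sup>2 + 2 * x * (f w * g w) + x\<^sup>2 * (g w)\<^sup>2)"
      by (intro Bochner_Integration.integral_cong) (auto simp: power2_eq_square algebra_simps)
    also have "\<dots> = (LINT w|M. (f w)\<^sup>2) + 2 * x * (LINT w|M. f w * g w) + x\<^sup>2 * (LINT w|M. (g w)\<^sup>2)"
      using if2 ig2 square_integrable_mult[OF f g] by simp
    finally show "0 \<le> (LINT w|M. (f w)\<^sup>2) + 2 * x * (LINT w|M. f w * g w) + x\<^sup>2 * (LINT w|M. (g w)\<^sup>2)" .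
  qed simp
  then show ?thesis
    by (metis real_sqrt_abs real_sqrt_le_iff real_sqrt_mult)
qed

text \<open>Insert \<open>F\<close> and \<open>G\<close>: the error splits into
  \<open>(f n - F) * (g n - G)\<close>, \<open>F * (g n - G)\<close> and
  \<open>(f n - F) * G\<close>, each small by Cauchy-Schwarz. It later carries moments from rounded
  random times to the actual ones; with \<open>g n = G = 1\<close> it yields convergence of
  means.\<close>

lemma L2_tendsto_integral_mult:
  fixes f g :: "nat \<Rightarrow> 'w \<Rightarrow> real"
  assumes f: "\<And>n. square_integrable M (f n)" and F: "square_integrable M F"
    and g: "\<And>n. square_integrable M (g n)" and G: "square_integrable M G"
    and fF: "(\<lambda>n. \<integral>w. (f n w - F w)\<^sup>2 \<partial>M) \<longlonglongrightarrow> 0"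
    and gG: "(\<lambda>n. \<integral>w. (g n w - G w)\<^sup>2 \<partial>M) \<longlonglongrightarrow> 0"
  shows "(\<lambda>n. \<integral>w. f n w * g n w \<partial>M) \<longlonglongrightarrow> (LINT w|M. F w * G w)"
proof -
  define a where "a n = sqrt (LINT w|M. (f n w - F w)\<^sup>2)" for n
  define b where "b n = sqrt (LINT w|M. (g n w - G w)\<^sup>2)" for n
  define A where "A = sqrt (LINT w|M. (F w)\<^sup>2)"
  define B where "B = sqrt (LINT w|M. (G w)\<^sup>2)"
  have lim: "a \<longlonglongrightarrow> 0" "b \<longlonglongrightarrow> 0"
    using tendsto_real_sqrt[OF fF] tendsto_real_sqrt[OF gG] unfolding a_def b_def by simp_all
  have bound: "norm ((LINT w|M. f n w * g n w) - (LINT w|M. F w * G w)) \<le> a n * b n + A * b n + a n * B" for n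
  proof -
    have df: "square_integrable M (\<lambda>w. f n w - F w)" and dg: "square_integrable M (\<lambda>w. g n w - G w)"
      using f g F G by (auto intro: square_integrable_diff)
    have "(LINT w|M. f n w * g n w) - (LINT w|M. F w * G w) = (LINT w|M. f n w * g n w - F w * G w)"
      using square_integrable_mult[OF f g] square_integrable_mult[OF F G] by simp
    also have "\<dots> = (LINT w|M. (f n w - F w) * (g n w - G w) + F w * (g n w - G w) + (f n w - F w) * G w)"
      by (intro Bochner_Integration.integral_cong) (auto simp: algebra_simps)
    also have "\<dots> = (LINT w|M. (f n w - F w) * (g n w - G w)) + (LINT w|M. F w * (g n w - G w))
         + (LINT w|M. (f n w - F w) * G w)"
      using square_integrable_mult[OF df dg] square_integrable_mult[OF F dg] square_integrable_mult[OF df G]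
      by simp
    finally show ?thesis
      using integral_Cauchy_Schwarz[OF df dg] integral_Cauchy_Schwarz[OF F dg] integral_Cauchy_Schwarz[OF df G]
      unfolding a_def b_def A_def B_def by simp
  qed
  have "(\<lambda>n. a n * b n + A * b n + a n * B) \<longlonglongrightarrow> 0"
    using lim by (auto intro!: tendsto_eq_intros)
  then have "(\<lambda>n. (LINT w|M. f n w * g n w) - (LINT w|M. F w * G w)) \<longlonglongrightarrow> 0"
    by (rule Lim_null_comparison[rotated]) (use bound in \<open>auto intro!: always_eventually\<close>)
  then show ?thesis
    using LIM_zero_iff by blast
qed

section \<open>Moments from the characteristic function\<close>

text \<open>Fatou for \<open>2 * (1 - cos (h * x)) / h^2\<close>, which tends to \<open>x^2\<close>
  as \<open>h\<close> decreases to 0 and integrates to \<open>2 * (1 - Re (char M h)) / h^2\<close>,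
  hence to at most \<open>2 * C\<close>. The finiteness of all second moments of the field
  originates here.\<close>

lemma (in real_distribution) square_integrable_of_char_bound:
  assumes d: "0 < d" and bnd: "\<And>h. 0 < h \<Longrightarrow> h < d \<Longrightarrow> 1 - Re (char M h) \<le> C * h\<^sup>2"
  shows "integrable M (\<lambda>x. x\<^sup>2)"
proof -
  \<comment> \<open>The shift by 2 keeps \<open>h n\<close> strictly below \<open>d\<close> already
    at \<open>n = 0\<close>.\<close>
  define h where "h n = d / (real n + 2)" for n
  have h: "0 < h n" "h n < d" for n
    using d by (auto simp: h_def field_simps add_pos_nonneg)
  have h0: "filterlim h (at_right 0) sequentially"
    unfolding h_def using d by real_asymp
  have cosint: "integrable M (\<lambda>x. cos (t * x))" for t
    by (intro integrable_const_bound[of _ 1]) auto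
  have Re_char: "Re (char M t) = (\<integral>x. cos (t * x) \<partial>M)" for t
  proof -
    have "integrable M (\<lambda>x. iexp (t * x))"
      by (intro integrable_const_bound) auto
    then have "Re (char M t) = (\<integral>x. Re (iexp (t * x)) \<partial>M)"
      unfolding char_def by (rule integral_Re[symmetric])
    then show ?thesis by (simp add: Re_exp)
  qed
  have lim: "(\<lambda>n. 2 * (1 - cos (h n * x)) / (h n)\<^sup>2) \<longlonglongrightarrow> x\<^sup>2" for x :: real
  proof -
    have "((\<lambda>y. 2 * (1 - cos (y * x)) / y\<^sup>2) \<longlongrightarrow> x\<^sup>2) (at_right 0)"
    proof (cases "x = 0")
      case False
      then have "x < 0 \<or> x > 0" by auto
      then show ?thesis
      proof
        assume "x < 0" then show ?thesis
          unfolding power2_eq_square[of x] by real_asymp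
      next
        assume "x > 0" then show ?thesis
          unfolding power2_eq_square[of x] by real_asymp
      qed
    qed simp
    then show ?thesis
      using h0 by (rule filterlim_compose)
  qed
  have fin: "(\<integral>\<^sup>+x. ennreal (2 * (1 - cos (h n * x)) / (h n)\<^sup>2) \<partial>M) \<le> ennreal (2 * C)" for n
  proof -
    have "(\<integral>\<^sup>+x. ennreal (2 * (1 - cos (h n * x)) / (h n)\<^sup>2) \<partial>M) = ennreal (\<integral>x. 2 * (1 - cos (h n * x)) / (h n)\<^sup>2 \<partial>M)"
      using cosint by (intro nn_integral_eq_integral) auto
    also have "(\<integral>x. 2 * (1 - cos (h n * x)) / (h n)\<^sup>2 \<partial>M) = 2 * (1 - Re (char M (h n))) / (h n)\<^sup>2"
      using cosint prob_space unfolding Re_char by simp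
    also have "\<dots> \<le> 2 * C"
      using bnd[OF h[of n]] h(1)[of n] by (simp add: divide_le_eq)
    finally show ?thesis by (simp add: ennreal_leI)
  qed
  have "(\<integral>\<^sup>+x. ennreal (x\<^sup>2) \<partial>M) = (\<integral>\<^sup>+x. liminf (\<lambda>n. ennreal (2 * (1 - cos (h n * x)) / (h n)\<^sup>2)) \<partial>M)"
    using lim by (intro nn_integral_cong lim_imp_Liminf[symmetric] tendsto_ennrealI) auto
  also have "\<dots> \<le> liminf (\<lambda>n. \<integral>\<^sup>+x. ennreal (2 * (1 - cos (h n * x)) / (h n)\<^sup>2) \<partial>M)"
    by (intro nn_integral_liminf) simp
  also have "\<dots> \<le> ennreal (2 * C)"
    using fin by (intro Liminf_le) (auto simp: always_eventually)
  finally have "(\<integral>\<^sup>+x. ennreal (x\<^sup>2) \<partial>M) < \<infinity>"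
    using le_less_trans by fastforce
  then show ?thesis
    by (intro integrableI_nonneg) auto
qed

text \<open>With a finite second moment the first-order remainder of \<open>char M\<close> at 0 is
  at most \<open>t^2\<close> times that moment, hence o(t). This links the mean to the derivative of
  the exponent.\<close>

lemma (in real_distribution) char_has_vector_derivative_at_0:
  assumes sq: "integrable M (\<lambda>x. x\<^sup>2)"
  shows "(char M has_vector_derivative \<i> * of_real (\<integral>x. x \<partial>M)) (at 0)"
proof -
  have sqi: "square_integrable M (\<lambda>x. x)"
    using sq by (simp add: square_integrable_def)
  have i1: "integrable M (\<lambda>x. x)"
    by (rule square_integrable_integrable[OF sqi])
  let ?m = "\<integral>x. x \<partial>M" and ?S = "\<integral>x. x\<^sup>2 \<partial>M"
  have bound: "cmod (char M t - (1 + \<i> * of_real t * of_real ?m)) \<le> \<bar>t\<bar>\<^sup>2 * ?S" for t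
  proof -
    have m: "k \<le> 1 \<Longrightarrow> integrable M (\<lambda>x. x ^ k)" for k
      using i1 by (cases k) auto
    have "cmod (char M t - (1 + \<i> * of_real t * of_real ?m)) \<le>
      \<bar>t\<bar> / 2 * expectation (\<lambda>x. min (4 * \<bar>x\<bar>) (\<bar>t\<bar> * \<bar>x\<bar>^2))"
      using char_approx2[of 1 t] m prob_space by (simp add: numeral_2_eq_2)
    also have "\<dots> \<le> \<bar>t\<bar> / 2 * (\<bar>t\<bar> * ?S)"
    proof (intro mult_left_mono)
      have "expectation (\<lambda>x. min (4 * \<bar>x\<bar>) (\<bar>t\<bar> * \<bar>x\<bar>^2)) \<le> expectation (\<lambda>x. \<bar>t\<bar> * x\<^sup>2)"
        using i1 sq by (intro integral_mono integrable_min) auto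
      then show "expectation (\<lambda>x. min (4 * \<bar>x\<bar>) (\<bar>t\<bar> * \<bar>x\<bar>^2)) \<le> \<bar>t\<bar> * ?S"
        by simp
    qed simp
    also have "\<dots> = \<bar>t\<bar>\<^sup>2 * ?S / 2"
      by (simp add: power2_eq_square del: abs_mult_self_eq)
    also have "\<dots> \<le> \<bar>t\<bar>\<^sup>2 * ?S"
      by simp
    finally show ?thesis .
  qed
  show ?thesis
    unfolding has_vector_derivative_def has_derivative_at
  proof (intro conjI)
    show "bounded_linear (\<lambda>x. x *\<^sub>R (\<i> * complex_of_real ?m))"
      by (rule bounded_linear_scaleR_left)
    have "(\<lambda>h. \<bar>h\<bar> * ?S) \<midarrow>0\<rightarrow> 0"
      by (auto intro!: tendsto_eq_intros)
    then show "(\<lambda>h. norm (char M (0 + h) - char M 0 - h *\<^sub>R (\<i> * complex_of_real ?m)) / norm h) \<midarrow>0\<rightarrow> 0"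
    proof (rule Lim_null_comparison[rotated])
      have "norm (norm (char M (0 + h) - char M 0 - h *\<^sub>R (\<i> * complex_of_real ?m)) / norm h) \<le> \<bar>h\<bar> * ?S"
        if "h \<noteq> 0" for h
        using bound[of h] that by (simp add: char_zero scaleR_conv_of_real algebra_simps divide_le_eq power2_eq_square diff_diff_eq)
      then show "\<forall>\<^sub>F h in at 0. norm (norm (char M (0 + h) - char M 0 - h *\<^sub>R (\<i> * complex_of_real ?m)) / norm h) \<le> \<bar>h\<bar> * ?S"
        by (auto simp: eventually_at_filter)
    qed
  qed
qed

section \<open>Increments of Levy processes\<close>

lemma (in prob_space) indep_vars_imp_indep_var:
  assumes ind: "indep_vars (\<lambda>_. N) F I" and ij: "i \<in> I" "j \<in> I" "i \<noteq> j"
  shows "indep_var N (F i) N (F j)"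
proof -
  have "indep_var (PiM {i} (\<lambda>_. N)) (\<lambda>w. restrict (\<lambda>i. F i w) {i}) (PiM {j} (\<lambda>_. N)) (\<lambda>w. restrict (\<lambda>i. F i w) {j})"
    using ij by (intro indep_var_restrict[OF ind]) auto
  then have "indep_var N ((\<lambda>f. f i) \<circ> (\<lambda>w. restrict (\<lambda>i. F i w) {i})) N ((\<lambda>f. f j) \<circ> (\<lambda>w. restrict (\<lambda>i. F i w) {j}))"
    by (rule indep_var_compose) auto
  then show ?thesis by (simp add: comp_def)
qed

text \<open>Independence is a property of the joint law, which changes on null sets do not affect.
  It is called for because \<open>X 0\<close> vanishes only almost surely, so that
  \<open>X a\<close> and \<open>X a - X 0\<close> are different functions.\<close>

lemma (in prob_space) indep_var_cong_AE:
  assumes ind: "indep_var S X T Y"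
    and X': "X' \<in> measurable M S" "AE w in M. X w = X' w"
    and Y': "Y' \<in> measurable M T" "AE w in M. Y w = Y' w"
  shows "indep_var S X' T Y'"
proof -
  note rv = indep_var_rv1[OF ind] indep_var_rv2[OF ind]
  have "distr M S X = distr M S X'" "distr M T Y = distr M T Y'"
    using X' Y' rv by (auto intro!: distr_cong_AE)
  moreover have "distr M (S \<Otimes>\<^sub>M T) (\<lambda>x. (X x, Y x)) = distr M (S \<Otimes>\<^sub>M T) (\<lambda>x. (X' x, Y' x))"
    using X' Y' rv by (intro distr_cong_AE) auto
  ultimately show ?thesis
    using ind X' Y' unfolding indep_var_distribution_eq by simp
qed

lemma eucl_diff_nonneg:
  fixes a b :: "'a::ordered_euclidean_space"
  shows "a \<le> b \<Longrightarrow> 0 \<le> b - a"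
  unfolding eucl_le[of a b] eucl_le[of 0 "b - a"] by (simp add: inner_diff_left)

lemma levy_process_measurable:
  "levy_process M X \<Longrightarrow> 0 \<le> t \<Longrightarrow> X t \<in> borel_measurable M"
  by (simp add: levy_process_def)

lemma levy_process_0_AE: "levy_process M X \<Longrightarrow> AE w in M. X 0 w = 0"
  by (simp add: levy_process_def)

lemma levy_process_cadlag_AE: "levy_process M X \<Longrightarrow> AE w in M. cadlag_path (\<lambda>t. X t w)"
  by (simp add: levy_process_def)

lemma levy_process_distr_increment:
  fixes X :: "'a::ordered_euclidean_space \<Rightarrow> 'w \<Rightarrow> real"
  assumes X: "levy_process M X" and ab: "0 \<le> a" "a \<le> b"
  shows "distr M borel (\<lambda>w. X b w - X a w) = distr M borel (X (b - a))"
proof -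
  have "0 \<le> b - a"
    using ab by (simp add: eucl_diff_nonneg)
  with X ab(1) have "distr M borel (\<lambda>w. X (a + (b - a)) w - X a w) = distr M borel (X (b - a))"
    unfolding levy_process_def by blast
  then show ?thesis by simp
qed

lemma levy_process_indep_increment:
  fixes X :: "'a::ordered_euclidean_space \<Rightarrow> 'w \<Rightarrow> real"
  assumes "prob_space M" and X: "levy_process M X" and ab: "0 \<le> a" "a \<le> b"
  shows "prob_space.indep_var M borel (X a) borel (\<lambda>w. X b w - X a w)"
proof -
  interpret prob_space M by fact
  \<comment> \<open>The chain 0, a, b, b, ...; of the two increments used, the first is
    \<open>X a - X 0\<close>, which is \<open>X a\<close> almost surely.\<close>
  define t where "t j = (if j = 0 then 0 else if j = 1 then a else b)" for j :: nat
  have b0: "0 \<le> b" using ab by (rule order_trans)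
  have [measurable]: "X 0 \<in> borel_measurable M" "X a \<in> borel_measurable M" "X b \<in> borel_measurable M"
    using levy_process_measurable[OF X] ab b0 by auto
  have "t 0 = 0 \<and> (\<forall>j<2. t j \<le> t (Suc j))"
    using ab by (auto simp: t_def less_2_cases_iff)
  then have "indep_vars (\<lambda>_. borel) (\<lambda>j w. X (t (Suc j)) w - X (t j) w) {..<2}"
    using X unfolding levy_process_def by blast
  from indep_vars_imp_indep_var[OF this, of 0 1]
  have "indep_var borel (\<lambda>w. X a w - X 0 w) borel (\<lambda>w. X b w - X a w)"
    by (simp add: t_def)
  then show ?thesis
    by (rule indep_var_cong_AE) (use levy_process_0_AE[OF X] in auto)
qed

text \<open>\<open>X b\<close> is \<open>X a\<close> plus an increment that is independent of
  \<open>X a\<close> and has the law of \<open>X (b - a)\<close>. Square integrability is asked of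
  the two pieces and concluded for \<open>X b\<close>, so a time can be assembled from pieces by
  induction.\<close>

lemma levy_process_moments_add:
  fixes X :: "'a::ordered_euclidean_space \<Rightarrow> 'w \<Rightarrow> real"
  assumes "prob_space M" and X: "levy_process M X" and ab: "0 \<le> a" "a \<le> b"
    and sa: "square_integrable M (X a)" and sb: "square_integrable M (X (b - a))"
  shows "square_integrable M (X b)"
    and "(LINT w|M. X b w) = (LINT w|M. X a w) + (LINT w|M. X (b - a) w)"
    and "(LINT w|M. X a w * X b w) = (LINT w|M. (X a w)\<^sup>2) + (LINT w|M. X a w) * (LINT w|M. X (b - a) w)"
    and "(LINT w|M. (X b w)\<^sup>2) = (LINT w|M. (X a w)\<^sup>2) + 2 * ((LINT w|M. X a w) * (LINT w|M. X (b - a) w)) + (LINT w|M. (X (b - a) w)\<^sup>2)"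
proof -
  interpret prob_space M by fact
  let ?D = "\<lambda>w. X b w - X a w"
  have b0: "0 \<le> b" "0 \<le> b - a" using order_trans[OF ab] eucl_diff_nonneg[OF ab(2)] by auto
  have [measurable]: "X a \<in> borel_measurable M" "X b \<in> borel_measurable M" "X (b - a) \<in> borel_measurable M"
    using levy_process_measurable[OF X] ab b0 by auto
  note dist = levy_process_distr_increment[OF X ab]
  have transfer: "(LINT w|M. f (?D w)) = (LINT w|M. f (X (b - a) w))"
    "integrable M (\<lambda>w. f (?D w)) \<longleftrightarrow> integrable M (\<lambda>w. f (X (b - a) w))"
    if [measurable]: "f \<in> borel_measurable borel" for f :: "real \<Rightarrow> real"
  proof -
    have "(LINT w|M. f (?D w)) = (\<integral>x. f x \<partial>distr M borel ?D)"
      by (subst integral_distr) auto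
    also have "\<dots> = (LINT w|M. f (X (b - a) w))"
      unfolding dist by (subst integral_distr) auto
    finally show "(LINT w|M. f (?D w)) = (LINT w|M. f (X (b - a) w))" .
    have "integrable M (\<lambda>w. f (?D w)) \<longleftrightarrow> integrable (distr M borel ?D) f"
      by (subst integrable_distr_eq) auto
    also have "\<dots> \<longleftrightarrow> integrable M (\<lambda>w. f (X (b - a) w))"
      unfolding dist by (subst integrable_distr_eq) auto
    finally show "integrable M (\<lambda>w. f (?D w)) \<longleftrightarrow> integrable M (\<lambda>w. f (X (b - a) w))" .
  qed
  have sd: "square_integrable M ?D"
    using transfer(2)[of "\<lambda>x. x\<^sup>2"] sb by (simp add: square_integrable_def)
  have eq: "X b w = X a w + ?D w" for w by simp
  show sqb: "square_integrable M (X b)"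
    using square_integrable_add[OF sa sd] by simp
  have ia: "integrable M (X a)" and id: "integrable M ?D"
    using sa sd by (auto intro: square_integrable_integrable)
  have ia2: "integrable M (\<lambda>w. (X a w)\<^sup>2)" and id2: "integrable M (\<lambda>w. (?D w)\<^sup>2)"
    using sa sd by (auto simp: square_integrable_def)
  have iad: "integrable M (\<lambda>w. X a w * ?D w)"
    using square_integrable_mult[OF sa sd] .
  have ED: "(LINT w|M. ?D w) = (LINT w|M. X (b - a) w)"
    and ED2: "(LINT w|M. (?D w)\<^sup>2) = (LINT w|M. (X (b - a) w)\<^sup>2)"
    using transfer(1)[of "\<lambda>x. x"] transfer(1)[of "\<lambda>x. x\<^sup>2"] by auto
  have EAD: "(LINT w|M. X a w * ?D w) = (LINT w|M. X a w) * (LINT w|M. X (b - a) w)"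
    using indep_var_lebesgue_integral[OF levy_process_indep_increment[OF \<open>prob_space M\<close> X ab] ia id]
    unfolding ED .
  have "(LINT w|M. X b w) = (LINT w|M. X a w + ?D w)" by simp
  also have "\<dots> = (LINT w|M. X a w) + (LINT w|M. ?D w)"
    using ia id by (rule Bochner_Integration.integral_add)
  finally show "(LINT w|M. X b w) = (LINT w|M. X a w) + (LINT w|M. X (b - a) w)"
    unfolding ED .
  have "(LINT w|M. X a w * X b w) = (LINT w|M. (X a w)\<^sup>2 + X a w * ?D w)"
    by (intro Bochner_Integration.integral_cong) (auto simp: power2_eq_square algebra_simps)
  also have "\<dots> = (LINT w|M. (X a w)\<^sup>2) + (LINT w|M. X a w * ?D w)"
    using ia2 iad by (rule Bochner_Integration.integral_add)
  finally show "(LINT w|M. X a w * X b w) = (LINT w|M. (X a w)\<^sup>2) + (LINT w|M. X a w) * (LINT w|M. X (b - a) w)"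
    unfolding EAD .
  have "(LINT w|M. (X b w)\<^sup>2) = (LINT w|M. (X a w)\<^sup>2 + 2 * (X a w * ?D w) + (?D w)\<^sup>2)"
    by (intro Bochner_Integration.integral_cong) (auto simp: power2_eq_square algebra_simps)
  also have "\<dots> = (LINT w|M. (X a w)\<^sup>2) + 2 * (LINT w|M. X a w * ?D w) + (LINT w|M. (?D w)\<^sup>2)"
    using ia2 iad id2 by simp
  finally show "(LINT w|M. (X b w)\<^sup>2) = (LINT w|M. (X a w)\<^sup>2) + 2 * ((LINT w|M. X a w) * (LINT w|M. X (b - a) w)) + (LINT w|M. (X (b - a) w)\<^sup>2)"
    unfolding EAD ED2 .
qed

text \<open>Cauchy's functional equation, with nonnegativity in the role of continuity: it makes
  \<open>f\<close> monotone, and enclosing \<open>n * u\<close> between consecutive integers gives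
  \<open>n * |f u - u * f 1| \<le> f 1\<close> for every \<open>n\<close>.\<close>

lemma additive_nonneg_imp_linear:
  fixes f :: "real \<Rightarrow> real"
  assumes add: "\<And>u v. 0 \<le> u \<Longrightarrow> 0 \<le> v \<Longrightarrow> f (u + v) = f u + f v"
    and nn: "\<And>u. 0 \<le> u \<Longrightarrow> 0 \<le> f u" and u: "0 \<le> u"
  shows "f u = u * f 1"
proof -
  have mono: "f x \<le> f y" if "0 \<le> x" "x \<le> y" for x y
    using add[of x "y - x"] nn[of "y - x"] that by simp
  have f0: "f 0 = 0" using add[of 0 0] by simp
  have mult: "f (real n * x) = real n * f x" if "0 \<le> x" for n x
    using that by (induction n) (auto simp: f0 add algebra_simps)
  have bound: "real n * \<bar>f u - u * f 1\<bar> \<le> f 1" for n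
  proof -
    define k where "k = nat \<lfloor>real n * u\<rfloor>"
    have "0 \<le> real n * u" using u by simp
    then have k: "real k \<le> real n * u" "real n * u \<le> real k + 1"
      unfolding k_def by linarith+
    have "real k * f 1 \<le> real n * f u"
      using mono[of "real k" "real n * u"] mult[of 1 k] mult[OF u, of n] k by simp
    moreover have "real n * f u \<le> (real k + 1) * f 1"
      using mono[of "real n * u" "real (Suc k)"] mult[of 1 "Suc k"] mult[OF u, of n] k \<open>0 \<le> real n * u\<close>
      by (simp add: algebra_simps)
    moreover have "real k * f 1 \<le> real n * u * f 1" "real n * u * f 1 \<le> (real k + 1) * f 1"
      using k nn[of 1] by (auto intro!: mult_right_mono)
    ultimately have "\<bar>real n * f u - real n * u * f 1\<bar> \<le> f 1"
      by (simp add: algebra_simps abs_le_iff)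
    moreover have "\<bar>real n * f u - real n * u * f 1\<bar> = real n * \<bar>f u - u * f 1\<bar>"
    proof -
      have "real n * f u - real n * u * f 1 = real n * (f u - u * f 1)" by (simp add: algebra_simps)
      then show ?thesis by (simp add: abs_mult)
    qed
    ultimately show ?thesis by simp
  qed
  show ?thesis
  proof (rule ccontr)
    assume "f u \<noteq> u * f 1"
    then have "0 < \<bar>f u - u * f 1\<bar>" by simp
    then obtain n where "f 1 < real n * \<bar>f u - u * f 1\<bar>"
      using reals_Archimedean3 by blast
    with bound[of n] show False by simp
  qed
qed

section \<open>Layer cake formulas\<close>

text \<open>\<open>R\<close> stands for the strict or the weak inequality throughout this part.
  Events of the subordinator bound the probability of \<open>x < L t\<close> from above and that of
  \<open>x \<le> L t\<close> from below, so both forms of the tail occur.\<close>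

lemma (in prob_space) measurable_tail:
  fixes f :: "'a \<Rightarrow> real"
  assumes [measurable]: "f \<in> borel_measurable M" and R: "R = (<) \<or> R = (\<le>)"
  shows "(\<lambda>x. emeasure M {w \<in> space M. R x (f w)}) \<in> borel_measurable borel"
proof -
  have [measurable]: "Measurable.pred (borel \<Otimes>\<^sub>M M) (\<lambda>p. R (fst p) (f (snd p)))"
    using R by (elim disjE) simp_all
  have "emeasure M {w \<in> space M. R x (f w)} = (\<integral>\<^sup>+w. indicator {p. R (fst p) (f (snd p))} (x, w) \<partial>M)" for x
  proof -
    have "{w \<in> space M. R x (f w)} \<in> sets M" using R by (elim disjE) simp_all
    then have "emeasure M {w \<in> space M. R x (f w)} = (\<integral>\<^sup>+w. indicator {w \<in> space M. R x (f w)} w \<partial>M)"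
      by simp
    also have "\<dots> = (\<integral>\<^sup>+w. indicator {p. R (fst p) (f (snd p))} (x, w) \<partial>M)"
      by (intro nn_integral_cong) (auto simp: indicator_def)
    finally show ?thesis .
  qed
  moreover have "(\<lambda>x. \<integral>\<^sup>+w. indicator {p. R (fst p) (f (snd p))} (x, w) \<partial>M) \<in> borel_measurable borel"
    by (rule borel_measurable_nn_integral) (simp add: indicator_def)
  ultimately show ?thesis by simp
qed

lemma nn_integral_layer:
  assumes R: "R = (<) \<or> R = (\<le>)"
  shows "(\<integral>\<^sup>+x. (if 0 < x \<and> R x r then 1 else 0) \<partial>lborel) = ennreal r"
proof -
  have "(\<integral>\<^sup>+x. (if 0 < x \<and> R x r then 1 else 0) \<partial>lborel) = (\<integral>\<^sup>+x. indicator {x. 0 < x \<and> R x r} x \<partial>lborel)"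
    by (intro nn_integral_cong) (auto simp: indicator_def)
  also have "\<dots> = emeasure lborel {x. 0 < x \<and> R x r}"
    using R by (intro nn_integral_indicator) (elim disjE, simp_all)
  also have "\<dots> = ennreal r"
  proof (cases "0 \<le> r")
    case True
    have "{x. 0 < x \<and> R x r} = {0<..<r} \<or> {x. 0 < x \<and> R x r} = {0<..r}"
      using R by auto
    then show ?thesis
    proof
      assume "{x. 0 < x \<and> R x r} = {0<..<r}"
      then show ?thesis using True by (simp only:) simp
    next
      assume "{x. 0 < x \<and> R x r} = {0<..r}"
      then show ?thesis using True by (simp only:) simp
    qed
  next
    case False
    then have "{x. 0 < x \<and> R x r} = {}" using R by (elim disjE) auto
    then have "emeasure lborel {x. 0 < x \<and> R x r} = 0" by (simp only: emeasure_empty)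
    then show ?thesis using False by (simp only:) (simp add: ennreal_neg)
  qed
  finally show ?thesis .
qed

text \<open>Tonelli, after writing \<open>ennreal r\<close> as the length of the set of positive
  \<open>x\<close> below \<open>r\<close>. \<open>ennreal\<close> sends negative values to 0, in
  agreement with the restriction to \<open>x > 0\<close>.\<close>

lemma (in prob_space) nn_integral_tail:
  fixes f :: "'a \<Rightarrow> real"
  assumes [measurable]: "f \<in> borel_measurable M" and R: "R = (<) \<or> R = (\<le>)"
  shows "(\<integral>\<^sup>+w. ennreal (f w) \<partial>M) =
    (\<integral>\<^sup>+x. indicator {0<..} x * emeasure M {w \<in> space M. R x (f w)} \<partial>lborel)"
proof -
  interpret pair_sigma_finite M lborel ..
  have [measurable]: "Measurable.pred (M \<Otimes>\<^sub>M borel) (\<lambda>p. R (snd p) (f (fst p)))"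
    using R by (elim disjE) simp_all
  have mx: "{w \<in> space M. R x (f w)} \<in> sets M" for x
    using R by (elim disjE) simp_all
  have "(\<integral>\<^sup>+w. ennreal (f w) \<partial>M) = (\<integral>\<^sup>+w. \<integral>\<^sup>+x. (if 0 < x \<and> R x (f w) then 1 else 0) \<partial>lborel \<partial>M)"
    by (simp add: nn_integral_layer[OF R])
  also have "\<dots> = (\<integral>\<^sup>+x. \<integral>\<^sup>+w. (if 0 < x \<and> R x (f w) then 1 else 0) \<partial>M \<partial>lborel)"
    using Fubini[of "\<lambda>p. if 0 < snd p \<and> R (snd p) (f (fst p)) then 1 else 0"] by simp
  also have "\<dots> = (\<integral>\<^sup>+x. indicator {0<..} x * emeasure M {w \<in> space M. R x (f w)} \<partial>lborel)"
  proof (intro nn_integral_cong)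
    fix x :: real
    have "(\<integral>\<^sup>+w. (if 0 < x \<and> R x (f w) then 1 else 0) \<partial>M)
        = (\<integral>\<^sup>+w. indicator {0<..} x * indicator {w \<in> space M. R x (f w)} w \<partial>M)"
      by (intro nn_integral_cong) (auto simp: indicator_def)
    then show "(\<integral>\<^sup>+w. (if 0 < x \<and> R x (f w) then 1 else 0) \<partial>M)
        = indicator {0<..} x * emeasure M {w \<in> space M. R x (f w)}"
      using mx by (simp add: nn_integral_cmult)
  qed
  finally show ?thesis .
qed

text \<open>The layers of \<open>f\<close> are opened first, then those of \<open>g\<close>, with
  one exchange of integrals each; a product of layers is the indicator of a joint event. Applied to
  a clock at two times it turns mixed moments into joint probabilities.\<close>

lemma (in prob_space) nn_integral_mult_tail:
  fixes f g :: "'a \<Rightarrow> real"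
  assumes [measurable]: "f \<in> borel_measurable M" "g \<in> borel_measurable M" and R: "R = (<) \<or> R = (\<le>)"
  shows "(\<integral>\<^sup>+w. ennreal (f w) * ennreal (g w) \<partial>M) =
    (\<integral>\<^sup>+x. \<integral>\<^sup>+y. indicator {0<..} x * (indicator {0<..} y *
       emeasure M {w \<in> space M. R x (f w) \<and> R y (g w)}) \<partial>lborel \<partial>lborel)"
proof -
  interpret pair_sigma_finite M lborel ..
  have [measurable]: "Measurable.pred (M \<Otimes>\<^sub>M borel) (\<lambda>p. R (snd p) (f (fst p)))"
      "Measurable.pred (M \<Otimes>\<^sub>M borel) (\<lambda>p. R (snd p) (g (fst p)))"
    using R by (elim disjE; simp)+
  have [measurable]: "Measurable.pred M (\<lambda>w. R x (f w))" "Measurable.pred M (\<lambda>w. R x (g w))" for x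
    using R by (elim disjE; simp)+
  let ?l = "\<lambda>x r. if 0 < x \<and> R x r then 1 else 0 :: ennreal"
  have "(\<integral>\<^sup>+w. ennreal (f w) * ennreal (g w) \<partial>M)
      = (\<integral>\<^sup>+w. \<integral>\<^sup>+x. ?l x (f w) * ennreal (g w) \<partial>lborel \<partial>M)"
    by (subst nn_integral_multc) (use R in \<open>auto simp: nn_integral_layer[OF R]\<close>)
  also have "\<dots> = (\<integral>\<^sup>+x. \<integral>\<^sup>+w. ?l x (f w) * ennreal (g w) \<partial>M \<partial>lborel)"
    using Fubini[of "\<lambda>p. ?l (snd p) (f (fst p)) * ennreal (g (fst p))"] by simp
  also have "\<dots> = (\<integral>\<^sup>+x. \<integral>\<^sup>+w. \<integral>\<^sup>+y. ?l x (f w) * ?l y (g w) \<partial>lborel \<partial>M \<partial>lborel)"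
    by (subst nn_integral_cmult) (use R in \<open>auto simp: nn_integral_layer[OF R]\<close>)
  also have "\<dots> = (\<integral>\<^sup>+x. \<integral>\<^sup>+y. \<integral>\<^sup>+w. ?l x (f w) * ?l y (g w) \<partial>M \<partial>lborel \<partial>lborel)"
    using Fubini[of "\<lambda>p. ?l x (f (fst p)) * ?l (snd p) (g (fst p))" for x] by simp
  also have "\<dots> = (\<integral>\<^sup>+x. \<integral>\<^sup>+y. indicator {0<..} x * (indicator {0<..} y *
       emeasure M {w \<in> space M. R x (f w) \<and> R y (g w)}) \<partial>lborel \<partial>lborel)"
  proof (intro nn_integral_cong)
    fix x y :: real
    have "(\<integral>\<^sup>+w. ?l x (f w) * ?l y (g w) \<partial>M) =
       (\<integral>\<^sup>+w. (indicator {0<..} x * indicator {0<..} y) * indicator {w \<in> space M. R x (f w) \<and> R y (g w)} w \<partial>M)"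
      by (intro nn_integral_cong) (auto simp: indicator_def)
    also have "\<dots> = (indicator {0<..} x * indicator {0<..} y) * emeasure M {w \<in> space M. R x (f w) \<and> R y (g w)}"
      by (subst nn_integral_cmult) auto
    finally show "(\<integral>\<^sup>+w. ?l x (f w) * ?l y (g w) \<partial>M) = indicator {0<..} x * (indicator {0<..} y *
       emeasure M {w \<in> space M. R x (f w) \<and> R y (g w)})"
      by (simp add: mult.assoc)
  qed
  finally show ?thesis .
qed

section \<open>Inverses of nondecreasing functions\<close>

text \<open>The almost sure properties of a subordinator path that make its inverse behave.
  Unboundedness keeps the set under the infimum in \<open>inverse_process\<close> nonempty;
  otherwise \<open>Inf\<close> over the reals would have no useful value. The witness is positive
  because that set contains only positive points.\<close>

definition nondecreasing_unbounded :: "(real \<Rightarrow> real) \<Rightarrow> bool" where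
  "nondecreasing_unbounded h \<longleftrightarrow> mono_on {0..} h \<and> h 0 = 0 \<and> (\<forall>t. \<exists>x>0. t < h x)"

lemma nondecreasing_unbounded_mono:
  "nondecreasing_unbounded h \<Longrightarrow> 0 \<le> x \<Longrightarrow> x \<le> y \<Longrightarrow> h x \<le> h y"
  unfolding nondecreasing_unbounded_def by (auto intro: mono_onD[of "{0..}" h x y])

lemma inverse_process_nonempty:
  "nondecreasing_unbounded (\<lambda>x. H x w) \<Longrightarrow> {x. 0 < x \<and> t < H x w} \<noteq> {}"
  unfolding nondecreasing_unbounded_def by auto

lemma inverse_process_bdd_below: "bdd_below {x::real. 0 < x \<and> t < H x w}"
  by (rule bdd_belowI[of _ 0]) auto

lemma inverse_process_nonneg:
  "nondecreasing_unbounded (\<lambda>x. H x w) \<Longrightarrow> 0 \<le> inverse_process H t w"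
  unfolding inverse_process_def by (intro cInf_greatest inverse_process_nonempty) auto

lemma inverse_process_mono:
  "nondecreasing_unbounded (\<lambda>x. H x w) \<Longrightarrow> s \<le> t \<Longrightarrow> inverse_process H s w \<le> inverse_process H t w"
  unfolding inverse_process_def
  by (intro cInf_superset_mono inverse_process_nonempty inverse_process_bdd_below) auto

text \<open>With \<open>L\<close> the inverse of \<open>H\<close>, this and
  \<open>inverse_process_ge\<close> say that on a good path \<open>x < L t\<close> implies
  \<open>H x \<le> t\<close>, which implies \<open>x \<le> L t\<close>: the bridge from bounds on
  the subordinator to bounds on its inverse.\<close>

lemma inverse_process_le:
  "0 < x \<Longrightarrow> t < H x w \<Longrightarrow> inverse_process H t w \<le> x"
  unfolding inverse_process_def by (intro cInf_lower inverse_process_bdd_below) auto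

lemma inverse_process_ge:
  assumes h: "nondecreasing_unbounded (\<lambda>x. H x w)" and x: "0 < x" "H x w \<le> t"
  shows "x \<le> inverse_process H t w"
  unfolding inverse_process_def
proof (intro cInf_greatest inverse_process_nonempty[of H w, OF h])
  fix y assume y: "y \<in> {x. 0 < x \<and> t < H x w}"
  show "x \<le> y"
  proof (rule ccontr)
    assume "\<not> x \<le> y"
    then have "H y w \<le> H x w"
      using nondecreasing_unbounded_mono[OF h, of y x] y by simp
    with x y show False by simp
  qed
qed

section \<open>Tail bounds for the inverse of a stable subordinator\<close>

lemma (in prob_space) prob_le_expectation:
  assumes A: "A \<in> events" and f: "integrable M f" and le: "AE w in M. indicator A w \<le> f w"
  shows "prob A \<le> (LINT w|M. f w)"
proof -
  have "prob A = (LINT w|M. indicator A w)" using A by simp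
  also have "\<dots> \<le> (LINT w|M. f w)"
    using A by (intro integral_mono_AE f le integrable_real_indicator) (auto simp: emeasure_eq_measure)
  finally show ?thesis .
qed

text \<open>The scale \<open>c\<close>, existentially quantified in
  \<open>stable_subordinator\<close>, is fixed here. \<open>H t\<close> is measurable for
  \<open>M\<close>, whereas the inverse is handled in \<open>completion M\<close>, being well
  behaved only on a set of paths of full measure; its measurability is later read off from the
  independence of the clocks.\<close>

locale stable_subordinator_inverse =
  fixes M :: "'w measure" and \<alpha> c :: real and H :: "real \<Rightarrow> 'w \<Rightarrow> real"
  assumes prob_M: "prob_space M" and alpha: "0 < \<alpha>" "\<alpha> < 1" and c: "0 < c"
    and levy: "levy_process M H"
    and mono_AE: "AE w in M. mono_on {0..} (\<lambda>x. H x w)"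
    and laplace: "\<And>t r. 0 \<le> t \<Longrightarrow> 0 \<le> r \<Longrightarrow> (LINT w|M. exp (- r * H t w)) = exp (- c * t * r powr \<alpha>)"
    and inverse_measurable: "\<And>t. 0 \<le> t \<Longrightarrow> inverse_process H t \<in> borel_measurable (completion M)"
begin

sublocale M: prob_space M by (rule prob_M)
sublocale C: prob_space "completion M" by (rule M.prob_space_completion)

abbreviation L :: "real \<Rightarrow> 'w \<Rightarrow> real" where "L \<equiv> inverse_process H"

lemma H_measurable [measurable]: "0 \<le> t \<Longrightarrow> H t \<in> borel_measurable M"
  by (rule levy_process_measurable[OF levy])

lemma H_nonneg_AE:
  assumes "0 \<le> x"
  shows "AE w in M. 0 \<le> H x w"
  using levy_process_0_AE[OF levy] mono_AE
proof eventually_elim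
  case (elim w)
  then show ?case using mono_onD[OF elim(2), of 0 x] assms by simp
qed

lemma integrable_exp_H:
  assumes "0 \<le> x" "0 \<le> r"
  shows "integrable M (\<lambda>w. exp (- r * H x w))"
proof (rule M.integrable_const_bound)
  show "AE w in M. norm (exp (- r * H x w)) \<le> 1"
    using H_nonneg_AE[OF assms(1)] by eventually_elim (use assms in auto)
qed (use assms in simp)

text \<open>Exponential Markov inequality with \<open>r = 1 / t\<close>: on
  \<open>H x \<le> t\<close> the variable \<open>exp (1 - H x / t)\<close> is at least 1. For the
  inverse this means an exponential tail of \<open>L t\<close> on the scale
  \<open>t powr \<alpha>\<close>.\<close>

lemma prob_H_le:
  assumes x: "0 \<le> x" and t: "0 < t"
  shows "M.prob {w \<in> space M. H x w \<le> t} \<le> exp 1 * exp (- (c * t powr - \<alpha>) * x)"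
proof -
  have "M.prob {w \<in> space M. H x w \<le> t} \<le> (LINT w|M. exp 1 * exp (- (1 / t) * H x w))"
  proof (rule M.prob_le_expectation)
    show "integrable M (\<lambda>w. exp 1 * exp (- (1 / t) * H x w))"
      using integrable_exp_H[of x "1 / t"] x t by simp
    have "indicator {w \<in> space M. H x w \<le> t} w \<le> exp 1 * exp (- (1 / t) * H x w)" for w
      using t by (auto simp: indicator_def divide_le_eq simp flip: exp_add)
    then show "AE w in M. indicator {w \<in> space M. H x w \<le> t} w \<le> exp 1 * exp (- (1 / t) * H x w)"
      by simp
  qed (use x in measurable)
  also have "\<dots> = exp 1 * exp (- c * x * (1 / t) powr \<alpha>)"
    using laplace[of x "1 / t"] x t by simp
  also have "(1 / t) powr \<alpha> = t powr - \<alpha>"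
    using t by (simp add: powr_minus_divide powr_divide)
  finally show ?thesis by (simp add: mult_ac)
qed

text \<open>On \<open>t < H x\<close> the variable \<open>1 - exp (- H x / t)\<close> is at least
  \<open>1 - exp (- 1)\<close>, hence at least 1/2, which is the origin of the factor 2. Its mean is
  then bounded through \<open>1 - exp (- u) \<le> u\<close>.\<close>

lemma prob_H_gt_le:
  assumes x: "0 \<le> x" and t: "0 < t"
  shows "M.prob {w \<in> space M. t < H x w} \<le> 2 * (c * t powr - \<alpha> * x)"
proof -
  have e: "exp (- 1) \<le> (1 / 2 :: real)"
    using exp_ge_add_one_self[of 1] by (simp add: exp_minus field_simps)
  have "M.prob {w \<in> space M. t < H x w} \<le> (LINT w|M. 2 * (1 - exp (- (1 / t) * H x w)))"
  proof (rule M.prob_le_expectation)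
    show "integrable M (\<lambda>w. 2 * (1 - exp (- (1 / t) * H x w)))"
      using integrable_exp_H[of x "1 / t"] x t by simp
    show "AE w in M. indicator {w \<in> space M. t < H x w} w \<le> 2 * (1 - exp (- (1 / t) * H x w))"
      using H_nonneg_AE[OF x]
    proof eventually_elim
      case (elim w)
      show ?case
      proof (cases "t < H x w")
        case True
        then have "exp (- (1 / t) * H x w) \<le> exp (- 1)"
          using t by (simp add: le_divide_eq)
        moreover have "1 \<le> 2 * (1 - u)" if "u \<le> exp (- 1)" for u :: real
          using order_trans[OF that e] by simp
        ultimately have "1 \<le> 2 * (1 - exp (- (1 / t) * H x w))" by blast
        moreover have "indicator {w \<in> space M. t < H x w} w \<le> (1::real)" by (simp add: indicator_def)
        ultimately show ?thesis by (rule order_trans[rotated])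
      qed (use elim t in \<open>auto simp: indicator_def\<close>)
    qed
  qed (use x in measurable)
  also have "\<dots> = 2 * (1 - exp (- c * x * (1 / t) powr \<alpha>))"
    using laplace[of x "1 / t"] integrable_exp_H[of x "1 / t"] x t M.prob_space by simp
  also have "(1 / t) powr \<alpha> = t powr - \<alpha>"
    using t by (simp add: powr_minus_divide powr_divide)
  also have "2 * (1 - exp (- c * x * t powr - \<alpha>)) \<le> 2 * (c * t powr - \<alpha> * x)"
    using exp_ge_add_one_self[of "- c * x * t powr - \<alpha>"] by (simp add: mult_ac)
  finally show ?thesis .
qed

text \<open>Only here \<open>\<alpha> < 1\<close> matters: \<open>y powr \<alpha>\<close> dominates \<open>y\<close> near \<open>0\<close>, which forces a heavy tail.\<close>

lemma prob_H_gt_ge: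
  assumes x: "0 \<le> x" and t: "0 < t" and y: "0 < y"
  shows "1 - exp (- (c * t powr - \<alpha> * x) * y powr \<alpha>) - y \<le> M.prob {w \<in> space M. t < H x w}"
proof -
  let ?A = "{w \<in> space M. t < H x w}"
  have A: "?A \<in> M.events" using x by measurable
  \<comment> \<open>The Laplace transform is taken at \<open>r = y / t\<close> with \<open>y\<close>
    left free. Where \<open>H x \<le> t\<close> the integrand is at most \<open>y\<close>, elsewhere
    at most 1; a small \<open>y\<close> is chosen in the variance bound.\<close>
  have "1 - exp (- c * x * (y / t) powr \<alpha>) = (LINT w|M. 1 - exp (- (y / t) * H x w))"
    using laplace[of x "y / t"] integrable_exp_H[of x "y / t"] x t y M.prob_space by simp
  also have "\<dots> \<le> (LINT w|M. indicator ?A w + y)"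
  proof (rule integral_mono_AE)
    show "AE w in M. 1 - exp (- (y / t) * H x w) \<le> indicator ?A w + y"
    proof (rule AE_I2)
      fix w assume w: "w \<in> space M"
      show "1 - exp (- (y / t) * H x w) \<le> indicator ?A w + y"
      proof (cases "t < H x w")
        case False
        have "1 - exp (- (y / t) * H x w) \<le> (y / t) * H x w"
          using exp_ge_add_one_self[of "- (y / t) * H x w"] by simp
        also have "\<dots> \<le> (y / t) * t"
          using False y t by (intro mult_left_mono) auto
        finally show ?thesis using t by (simp add: indicator_def)
      qed (use w y in \<open>simp add: indicator_def add_increasing2\<close>)
    qed
  qed (use A integrable_exp_H[of x "y / t"] x t y in \<open>auto intro!: integrable_real_indicator simp: M.emeasure_eq_measure\<close>)
  also have "\<dots> = M.prob ?A + y"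
    using A M.prob_space by (simp add: integrable_real_indicator M.emeasure_eq_measure)
  also have "(y / t) powr \<alpha> = t powr - \<alpha> * y powr \<alpha>"
    using t y by (simp add: powr_minus_divide powr_divide)
  finally show ?thesis by (simp add: mult_ac)
qed

text \<open>Unboundedness comes from \<open>prob_H_le\<close>: for a fixed level, the probability
  that \<open>H\<close> has not passed it at time \<open>m\<close> decays exponentially in
  \<open>m\<close>.\<close>

lemma nondecreasing_unbounded_AE: "AE w in M. nondecreasing_unbounded (\<lambda>x. H x w)"
proof -
  have "AE w in M. \<exists>x>0. real n < H x w" for n :: nat
  proof -
    \<comment> \<open>\<open>Suc\<close> makes level and time positive: \<open>prob_H_le\<close>
      requires the former, the witness in \<open>nondecreasing_unbounded\<close> the latter.\<close>
    define A where "A m = {w \<in> space M. H (real (Suc m)) w \<le> real (Suc n)}" for m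
    have A: "A m \<in> M.events" for m unfolding A_def by measurable
    let ?N = "\<Inter>m. A m"
    have N: "?N \<in> M.events" using A by blast
    have "M.prob ?N \<le> exp 1 * exp (- (c * real (Suc n) powr - \<alpha>) * real (Suc m))" for m
    proof -
      have "M.prob ?N \<le> M.prob (A m)" using A by (intro M.finite_measure_mono) auto
      then show ?thesis
        using prob_H_le[of "real (Suc m)" "real (Suc n)"] unfolding A_def by simp
    qed
    moreover have "(\<lambda>m. exp 1 * exp (- (c * real (Suc n) powr - \<alpha>) * real (Suc m))) \<longlonglongrightarrow> 0"
    proof -
      have "(\<lambda>m. exp 1 * exp (- k * real (Suc m))) \<longlonglongrightarrow> 0" if "0 < k" for k :: real
        using that by real_asymp
      moreover have "0 < c * real (Suc n) powr - \<alpha>" using c by simp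
      ultimately show ?thesis by blast
    qed
    ultimately have "M.prob ?N \<le> 0"
      using LIMSEQ_le_const by blast
    then have "?N \<in> null_sets M"
      using N by (simp add: null_sets_def M.emeasure_eq_measure measure_le_0_iff)
    then have "AE w in M. w \<notin> ?N" by (rule AE_not_in)
    then show ?thesis
    proof (rule AE_mp, intro AE_I2 impI)
      fix w assume "w \<in> space M" "w \<notin> ?N"
      then obtain m where "real (Suc n) < H (real (Suc m)) w"
        unfolding A_def by (auto simp: not_le)
      then show "\<exists>x>0. real n < H x w" by (intro exI[of _ "real (Suc m)"]) auto
    qed
  qed
  then have "AE w in M. \<forall>n::nat. \<exists>x>0. real n < H x w"
    by (simp add: AE_all_countable)
  with levy_process_0_AE[OF levy] mono_AE show ?thesis
  proof eventually_elim
    case (elim w)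
    have "\<exists>x>0. t < H x w" for t
    proof -
      obtain n :: nat where "t < real n" using reals_Archimedean2 by blast
      with elim(3) show ?thesis by (meson less_trans)
    qed
    with elim show ?case by (simp add: nondecreasing_unbounded_def)
  qed
qed

end

section \<open>Joint laws of the subordinator and of its inverse at two times\<close>

context stable_subordinator_inverse
begin

lemma L_measurable [measurable]: "0 \<le> t \<Longrightarrow> L t \<in> borel_measurable (completion M)"
  by (rule inverse_measurable)

lemma nondecreasing_unbounded_AE': "AE w in completion M. nondecreasing_unbounded (\<lambda>x. H x w)"
  by (rule AE_completion[OF nondecreasing_unbounded_AE])

lemma L_nonneg_AE: "AE w in completion M. 0 \<le> L t w"
  using nondecreasing_unbounded_AE' by eventually_elim (rule inverse_process_nonneg)

lemma L_mono_AE: "s \<le> t \<Longrightarrow> AE w in completion M. L s w \<le> L t w"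
  using nondecreasing_unbounded_AE' by eventually_elim (rule inverse_process_mono)

text \<open>If \<open>H x > s\<close> then \<open>L s \<le> x\<close>, so the inclusion of events
  holds on every path. The inequalities for \<open>L\<close> are strict here and weak in the
  companion \<open>prob_joint_L_ge\<close>; both lead to the same mixed moment after integration
  over \<open>x\<close> and \<open>y\<close>.\<close>

lemma prob_joint_L_le:
  assumes "0 < x" "0 < y" "0 \<le> s" "0 \<le> t"
  shows "C.prob {w \<in> space M. x < L s w \<and> y < L t w} \<le> M.prob {w \<in> space M. H x w \<le> s \<and> H y w \<le> t}"
proof -
  have e: "{w \<in> space M. H x w \<le> s \<and> H y w \<le> t} \<in> M.events" using assms(1,2)[THEN less_imp_le] by measurable
  have "C.prob {w \<in> space M. x < L s w \<and> y < L t w} \<le> C.prob {w \<in> space M. H x w \<le> s \<and> H y w \<le> t}"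
  proof (rule C.finite_measure_mono_AE)
    show "AE w in completion M. w \<in> {w \<in> space M. x < L s w \<and> y < L t w} \<longrightarrow> w \<in> {w \<in> space M. H x w \<le> s \<and> H y w \<le> t}"
      using inverse_process_le[of x s H] inverse_process_le[of y t H] assms
      by (intro AE_I2) (fastforce simp: not_less[symmetric])
  qed (use e in simp)
  then show ?thesis using e by simp
qed

lemma prob_joint_L_ge:
  assumes "0 < x" "0 < y" "0 \<le> s" "0 \<le> t"
  shows "M.prob {w \<in> space M. H x w \<le> s \<and> H y w \<le> t} \<le> C.prob {w \<in> space M. x \<le> L s w \<and> y \<le> L t w}"
proof -
  have e: "{w \<in> space M. H x w \<le> s \<and> H y w \<le> t} \<in> M.events"
    using assms(1,2)[THEN less_imp_le] by measurable
  have "{w \<in> space (completion M). x \<le> L s w \<and> y \<le> L t w} \<in> C.events" using assms by measurable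
  then have e': "{w \<in> space M. x \<le> L s w \<and> y \<le> L t w} \<in> C.events" by simp
  have "C.prob {w \<in> space M. H x w \<le> s \<and> H y w \<le> t} \<le> C.prob {w \<in> space M. x \<le> L s w \<and> y \<le> L t w}"
  proof (rule C.finite_measure_mono_AE[OF _ e'])
    show "AE w in completion M. w \<in> {w \<in> space M. H x w \<le> s \<and> H y w \<le> t} \<longrightarrow> w \<in> {w \<in> space M. x \<le> L s w \<and> y \<le> L t w}"
      using nondecreasing_unbounded_AE'
      by eventually_elim (use assms in \<open>auto intro: inverse_process_ge\<close>)
  qed
  then show ?thesis using e by simp
qed

lemma prob_L_ge: "0 < x \<Longrightarrow> 0 \<le> t \<Longrightarrow> M.prob {w \<in> space M. H x w \<le> t} \<le> C.prob {w \<in> space M. x \<le> L t w}"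
  using prob_joint_L_ge[of x x t t] by simp

lemma prob_L_gt: "0 < x \<Longrightarrow> 0 \<le> t \<Longrightarrow> C.prob {w \<in> space M. x < L t w} \<le> M.prob {w \<in> space M. H x w \<le> t}"
  using prob_joint_L_le[of x x t t] by simp

lemma prob_L_le:
  assumes x: "0 < x" and t: "0 \<le> t"
  shows "M.prob {w \<in> space M. t < H x w} \<le> C.prob {w \<in> space M. L t w \<le> x}"
proof -
  have e: "{w \<in> space M. t < H x w} \<in> M.events" using x[THEN less_imp_le] by measurable
  have "{w \<in> space (completion M). L t w \<le> x} \<in> C.events" using t by measurable
  then have e': "{w \<in> space M. L t w \<le> x} \<in> C.events" by simp
  have "C.prob {w \<in> space M. t < H x w} \<le> C.prob {w \<in> space M. L t w \<le> x}"
    using x by (intro C.finite_measure_mono e') (auto intro: inverse_process_le)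
  then show ?thesis using e by simp
qed

text \<open>As \<open>H x\<close> is nonnegative, \<open>H y \<le> t\<close> forces the increment
  from \<open>x\<close> to \<open>y\<close> to be at most \<open>t\<close>, and that increment is
  independent of \<open>H x\<close>. This is the source of the upper bound for the clock
  covariance.\<close>

lemma prob_H_joint_le:
  assumes xy: "0 \<le> x" "x \<le> y"
  shows "M.prob {w \<in> space M. H x w \<le> s \<and> H y w \<le> t}
    \<le> M.prob {w \<in> space M. H x w \<le> s} * M.prob {w \<in> space M. H (y - x) w \<le> t}"
proof -
  let ?D = "\<lambda>w. H y w - H x w"
  have y: "0 \<le> y" "0 \<le> y - x" using xy by auto
  have "M.prob {w \<in> space M. H x w \<le> s \<and> H y w \<le> t} \<le> M.prob {w \<in> space M. H x w \<in> {..s} \<and> ?D w \<in> {..t}}"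
  proof (rule M.finite_measure_mono_AE)
    show "AE w in M. w \<in> {w \<in> space M. H x w \<le> s \<and> H y w \<le> t} \<longrightarrow> w \<in> {w \<in> space M. H x w \<in> {..s} \<and> ?D w \<in> {..t}}"
      using H_nonneg_AE[OF xy(1)] by eventually_elim auto
  qed (use xy y in measurable)
  also have "\<dots> = M.prob {w \<in> space M. H x w \<in> {..s}} * M.prob {w \<in> space M. ?D w \<in> {..t}}"
    by (rule M.prob_indep_random_variable[OF levy_process_indep_increment[OF prob_M levy xy]]) auto
  also have "M.prob {w \<in> space M. ?D w \<in> {..t}} = measure (distr M borel ?D) {..t}"
    using xy y by (subst measure_distr) (auto intro!: arg_cong[where f = M.prob])
  also have "\<dots> = M.prob {w \<in> space M. H (y - x) w \<in> {..t}}"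
    unfolding levy_process_distr_increment[OF levy xy]
    using xy y by (subst measure_distr) (auto intro!: arg_cong[where f = M.prob])
  finally show ?thesis by simp
qed

text \<open>
  Given \<open>H x > s\<close>, the event \<open>H y \<le> t\<close> forces the increment to be at most \<open>t - s\<close>, while given
  \<open>H x \<le> s\<close> such an increment suffices for it; hence the two events are positively correlated.
\<close>

lemma prob_H_joint_ge:
  assumes xy: "0 \<le> x" "0 \<le> y" and st: "s \<le> t"
  shows "M.prob {w \<in> space M. H x w \<le> s} * M.prob {w \<in> space M. H y w \<le> t}
    \<le> M.prob {w \<in> space M. H x w \<le> s \<and> H y w \<le> t}"
proof (cases "x \<le> y")
  case False
  have "M.prob {w \<in> space M. H x w \<le> s} * M.prob {w \<in> space M. H y w \<le> t} \<le> M.prob {w \<in> space M. H x w \<le> s} * 1"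
    by (intro mult_left_mono) auto
  also have "\<dots> = M.prob {w \<in> space M. H x w \<le> s}" by simp
  \<comment> \<open>For \<open>y < x\<close> the path gives
    \<open>H y \<le> H x \<le> s \<le> t\<close>, so the second condition of the joint event is
    automatic up to a null set.\<close>
  also have "\<dots> \<le> M.prob {w \<in> space M. H x w \<le> s \<and> H y w \<le> t}"
  proof (rule M.finite_measure_mono_AE)
    show "AE w in M. w \<in> {w \<in> space M. H x w \<le> s} \<longrightarrow> w \<in> {w \<in> space M. H x w \<le> s \<and> H y w \<le> t}"
      using nondecreasing_unbounded_AE
    proof eventually_elim
      case (elim w)
      have "H y w \<le> H x w" using nondecreasing_unbounded_mono[OF elim, of y x] False xy by simp
      then show ?case using st by auto
    qed
  qed (use xy in measurable)
  finally show ?thesis .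
next
  case True
  let ?D = "\<lambda>w. H y w - H x w"
  note ind = levy_process_indep_increment[OF prob_M levy xy(1) True]
  let ?q = "M.prob {w \<in> space M. ?D w \<in> {..t - s}}"
  let ?a = "M.prob {w \<in> space M. H x w \<le> s}" and ?a' = "M.prob {w \<in> space M. s < H x w}"
  let ?u = "M.prob {w \<in> space M. H x w \<le> s \<and> H y w \<le> t}"
  let ?v = "M.prob {w \<in> space M. s < H x w \<and> H y w \<le> t}"
  have aa: "?a + ?a' = 1"
  proof -
    have "?a + ?a' = M.prob ({w \<in> space M. H x w \<le> s} \<union> {w \<in> space M. s < H x w})"
      by (rule M.finite_measure_Union[symmetric]) (use xy in \<open>measurable, auto\<close>)
    also have "{w \<in> space M. H x w \<le> s} \<union> {w \<in> space M. s < H x w} = space M" by auto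
    finally show ?thesis by (simp add: M.prob_space)
  qed
  have uv: "M.prob {w \<in> space M. H y w \<le> t} = ?u + ?v"
  proof -
    have "?u + ?v = M.prob ({w \<in> space M. H x w \<le> s \<and> H y w \<le> t} \<union> {w \<in> space M. s < H x w \<and> H y w \<le> t})"
      by (rule M.finite_measure_Union[symmetric]) (use xy in \<open>measurable, auto\<close>)
    also have "{w \<in> space M. H x w \<le> s \<and> H y w \<le> t} \<union> {w \<in> space M. s < H x w \<and> H y w \<le> t}
        = {w \<in> space M. H y w \<le> t}" by auto
    finally show ?thesis by simp
  qed
  have "?a * ?q = M.prob {w \<in> space M. H x w \<in> {..s} \<and> ?D w \<in> {..t - s}}"
    using M.prob_indep_random_variable[OF ind, of "{..s}" "{..t - s}"] by simp
  also have "\<dots> \<le> ?u"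
    by (rule M.finite_measure_mono) (use xy in \<open>measurable, auto\<close>)
  finally have u: "?a * ?q \<le> ?u" .
  have "?v \<le> M.prob {w \<in> space M. H x w \<in> {s<..} \<and> ?D w \<in> {..t - s}}"
    by (rule M.finite_measure_mono) (use xy in \<open>measurable, auto\<close>)
  also have "\<dots> = ?a' * ?q"
    using M.prob_indep_random_variable[OF ind, of "{s<..}" "{..t - s}"] by simp
  finally have v: "?v \<le> ?a' * ?q" .
  \<comment> \<open>Elimination of \<open>?q\<close>: since \<open>?a' = 1 - ?a\<close>, the outcome
    \<open>?a * ?v \<le> (1 - ?a) * ?u\<close> rearranges to \<open>?a * (?u + ?v) \<le> ?u\<close>,
    which is the claim.\<close>
  have "?a * ?v \<le> ?a * (?a' * ?q)" by (intro mult_left_mono v) simp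
  also have "\<dots> = ?a' * (?a * ?q)" by simp
  also have "\<dots> \<le> ?a' * ?u" by (intro mult_left_mono u) simp
  finally have "?a * ?v \<le> (1 - ?a) * ?u" using aa by (simp add: eq_diff_eq[symmetric] add.commute)
  then show ?thesis unfolding uv by (simp add: algebra_simps)
qed

section \<open>Moments of the inverse of a stable subordinator\<close>

lemma nn_integral_exp_le:
  assumes k: "0 < k"
  shows "(\<integral>\<^sup>+x. indicator {0<..} x * ennreal (exp (- k * x)) \<partial>lborel) \<le> ennreal (1 / k)"
proof -
  interpret E: prob_space "density lborel (exponential_density k)"
    by (rule prob_space_exponential_density[OF k])
  have "(\<integral>\<^sup>+x. indicator {0<..} x * ennreal (exp (- k * x)) \<partial>lborel)
      \<le> (\<integral>\<^sup>+x. ennreal (1 / k) * ennreal (exponential_density k x) \<partial>lborel)"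
    using k by (intro nn_integral_mono)
      (auto simp: indicator_def exponential_density_def mult_ac simp flip: ennreal_mult)
  also have "\<dots> = ennreal (1 / k) * (\<integral>\<^sup>+x. ennreal (exponential_density k x) \<partial>lborel)"
    by (intro nn_integral_cmult) simp
  also have "(\<integral>\<^sup>+x. ennreal (exponential_density k x) \<partial>lborel) = 1"
    using E.emeasure_space_1 by (simp add: emeasure_density)
  finally show ?thesis by simp
qed

text \<open>The joint tail is bounded by the tail at \<open>max x y\<close>, and
  \<open>max x y \<ge> (x + y) / 2\<close> splits the exponential into a product. The double
  integral becomes the square of an integral of size at most \<open>2 / k\<close>, whence
  \<open>4 * exp 1 / k^2\<close>.\<close>

lemma L_second_moment_nn:
  assumes t: "0 < t"
  shows "(\<integral>\<^sup>+w. ennreal (L t w) * ennreal (L t w) \<partial>completion M) \<le> ennreal (4 * exp 1 / c\<^sup>2 * t powr (2 * \<alpha>))"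
proof -
  define k where "k = c * t powr - \<alpha>"
  have k: "0 < k" using c t by (simp add: k_def)
  have k2: "0 < k / 2" using k by simp
  have bound: "C.prob {w \<in> space M. x < L t w \<and> y < L t w} \<le> exp 1 * (exp (- (k / 2) * x) * exp (- (k / 2) * y))"
    if "0 < x" "0 < y" for x y
  proof -
    have *: "M.prob {w \<in> space M. H x w \<le> t \<and> H y w \<le> t} \<le> exp 1 * exp (- k * z)" if "z = x \<or> z = y" for z
    proof -
      have z: "0 < z" using that \<open>0 < x\<close> \<open>0 < y\<close> by auto
      have "M.prob {w \<in> space M. H x w \<le> t \<and> H y w \<le> t} \<le> M.prob {w \<in> space M. H z w \<le> t}"
        using that z by (intro M.finite_measure_mono) (measurable, auto)
      also have "\<dots> \<le> exp 1 * exp (- k * z)"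
        using prob_H_le[of z t] z t by (simp add: k_def)
      finally show ?thesis .
    qed
    have "C.prob {w \<in> space M. x < L t w \<and> y < L t w} \<le> M.prob {w \<in> space M. H x w \<le> t \<and> H y w \<le> t}"
      using prob_joint_L_le[of x y t t] that t by simp
    also have "\<dots> \<le> exp 1 * exp (- k * max x y)" by (rule *) (auto simp: max_def)
    also have "\<dots> \<le> exp 1 * exp (- (k / 2) * x + - (k / 2) * y)"
    proof -
      have "k * ((x + y) / 2) \<le> k * max x y" using k by (intro mult_left_mono) auto
      then show ?thesis by (simp add: algebra_simps add_divide_distrib)
    qed
    finally show ?thesis unfolding exp_add .
  qed
  let ?g = "\<lambda>x. indicator {0<..} x * ennreal (exp (- (k / 2) * x))"
  have "(\<integral>\<^sup>+w. ennreal (L t w) * ennreal (L t w) \<partial>completion M)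
     = (\<integral>\<^sup>+x. \<integral>\<^sup>+y. indicator {0<..} x * (indicator {0<..} y *
       emeasure (completion M) {w \<in> space M. x < L t w \<and> y < L t w}) \<partial>lborel \<partial>lborel)"
    using C.nn_integral_mult_tail[OF L_measurable L_measurable disjI1[OF refl], of t t] t[THEN less_imp_le]
    unfolding space_completion by blast
  also have "\<dots> \<le> (\<integral>\<^sup>+x. \<integral>\<^sup>+y. ennreal (exp 1) * (?g x * ?g y) \<partial>lborel \<partial>lborel)"
  proof (intro nn_integral_mono)
    fix x y :: real
    have *: "emeasure (completion M) {w \<in> space M. x < L t w \<and> y < L t w}
        \<le> ennreal (exp 1) * (ennreal (exp (- (k / 2) * x)) * ennreal (exp (- (k / 2) * y)))" if "0 < x" "0 < y"
    proof -
      have "ennreal (exp 1) * (ennreal (exp (- (k / 2) * x)) * ennreal (exp (- (k / 2) * y)))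
          = ennreal (exp 1 * (exp (- (k / 2) * x) * exp (- (k / 2) * y)))"
        by (simp only: ennreal_mult[OF exp_ge_zero mult_nonneg_nonneg[OF exp_ge_zero exp_ge_zero]]
            ennreal_mult[OF exp_ge_zero exp_ge_zero])
      then show ?thesis
        unfolding C.emeasure_eq_measure using ennreal_leI[OF bound[OF that]] by (simp only:)
    qed
    show "indicator {0<..} x * (indicator {0<..} y * emeasure (completion M) {w \<in> space M. x < L t w \<and> y < L t w})
        \<le> ennreal (exp 1) * (?g x * ?g y)"
    proof (cases "0 < x \<and> 0 < y")
      case True
      then show ?thesis using * by (simp only: indicator_simps greaterThan_iff mult_1)
    next
      case False
      then have "indicator {0<..} x = (0::ennreal) \<or> indicator {0<..} y = (0::ennreal)" by (auto simp: indicator_def)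
      then show ?thesis by (elim disjE) (simp_all only: mult_zero_left mult_zero_right zero_le)
    qed
  qed
  also have "\<dots> = ennreal (exp 1) * ((\<integral>\<^sup>+x. ?g x \<partial>lborel) * (\<integral>\<^sup>+y. ?g y \<partial>lborel))"
    by (simp add: nn_integral_cmult nn_integral_multc)
  also have "\<dots> \<le> ennreal (exp 1) * (ennreal (1 / (k / 2)) * ennreal (1 / (k / 2)))"
    by (intro mult_left_mono mult_mono nn_integral_exp_le k2) auto
  also have "\<dots> = ennreal (exp 1 * ((1 / (k / 2)) * (1 / (k / 2))))"
    using k by (simp flip: ennreal_mult)
  also have "exp 1 * ((1 / (k / 2)) * (1 / (k / 2))) = 4 * exp 1 / c\<^sup>2 * t powr (2 * \<alpha>)"
  proof -
    define T where "T = t powr \<alpha>"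
    have "k = c / T" "t powr (2 * \<alpha>) = T\<^sup>2" "0 < T"
      using t by (simp_all add: k_def T_def powr_minus_divide power2_eq_square flip: powr_add)
    then show ?thesis using c by (simp add: power2_eq_square)
  qed
  finally show ?thesis .
qed

lemma L_square_integrable_pos:
  assumes t: "0 < t"
  shows "square_integrable (completion M) (L t)"
    and "(LINT w|completion M. (L t w)\<^sup>2) \<le> 4 * exp 1 / c\<^sup>2 * t powr (2 * \<alpha>)"
proof -
  have [measurable]: "L t \<in> borel_measurable (completion M)" using t by simp
  have le: "(\<integral>\<^sup>+w. ennreal ((L t w)\<^sup>2) \<partial>completion M) \<le> ennreal (4 * exp 1 / c\<^sup>2 * t powr (2 * \<alpha>))"
  proof -
    have "(\<integral>\<^sup>+w. ennreal ((L t w)\<^sup>2) \<partial>completion M) = (\<integral>\<^sup>+w. ennreal (L t w) * ennreal (L t w) \<partial>completion M)"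
      using L_nonneg_AE[of t]
      by (intro nn_integral_cong_AE, eventually_elim) (simp add: power2_eq_square ennreal_mult)
    then show ?thesis using L_second_moment_nn[OF t] by simp
  qed
  then have int: "integrable (completion M) (\<lambda>w. (L t w)\<^sup>2)"
    by (intro integrableI_nonneg) (auto simp: top.not_eq_extremum intro: le_less_trans)
  then show "square_integrable (completion M) (L t)" by (simp add: square_integrable_def)
  have "ennreal (LINT w|completion M. (L t w)\<^sup>2) \<le> ennreal (4 * exp 1 / c\<^sup>2 * t powr (2 * \<alpha>))"
    using le nn_integral_eq_integral[OF int] by simp
  then show "(LINT w|completion M. (L t w)\<^sup>2) \<le> 4 * exp 1 / c\<^sup>2 * t powr (2 * \<alpha>)"
    by (subst (asm) ennreal_le_iff) auto
qed

lemma L_square_integrable: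
  assumes t: "0 \<le> t"
  shows "square_integrable (completion M) (L t)"
proof (cases "t = 0")
  case True
  \<comment> \<open>The Laplace bounds require \<open>t > 0\<close>; at 0 the clock is dominated by
    its value at 1.\<close>
  have "integrable (completion M) (\<lambda>w. (L 0 w)\<^sup>2)"
  proof (rule Bochner_Integration.integrable_bound)
    show "integrable (completion M) (\<lambda>w. (L 1 w)\<^sup>2)"
      using L_square_integrable_pos(1)[of 1] by (simp add: square_integrable_def)
    show "AE w in completion M. norm ((L 0 w)\<^sup>2) \<le> norm ((L 1 w)\<^sup>2)"
      using L_nonneg_AE[of 0] L_mono_AE[of 0 1, simplified] by eventually_elim (simp add: power_mono)
  qed simp
  then show ?thesis using True by (simp add: square_integrable_def)
next
  case False
  with t show ?thesis by (intro L_square_integrable_pos(1)) simp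
qed

lemma L_second_moment_mono:
  assumes "0 \<le> s" "s \<le> t"
  shows "(LINT w|completion M. (L s w)\<^sup>2) \<le> (LINT w|completion M. (L t w)\<^sup>2)"
proof (rule integral_mono_AE)
  show "AE w in completion M. (L s w)\<^sup>2 \<le> (L t w)\<^sup>2"
    using L_nonneg_AE[of s] L_mono_AE[OF assms(2)] by eventually_elim (simp add: power_mono)
  have "0 \<le> t" using assms by simp
  then show "integrable (completion M) (\<lambda>w. (L t w)\<^sup>2)"
    using L_square_integrable unfolding square_integrable_def by blast
  show "integrable (completion M) (\<lambda>w. (L s w)\<^sup>2)"
    using L_square_integrable[OF assms(1)] unfolding square_integrable_def by blast
qed

lemma L_second_moment_le:
  assumes t: "0 \<le> t"
  shows "(LINT w|completion M. (L t w)\<^sup>2) \<le> 4 * exp 1 / c\<^sup>2 * t powr (2 * \<alpha>)"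
proof (cases "t = 0")
  case True
  \<comment> \<open>The case \<open>t = 0\<close> is a limit: \<open>L 0\<close> lies almost surely
    below \<open>L (1 / Suc n)\<close>, whose second moment tends to 0.\<close>
  have "(\<lambda>n. 4 * exp 1 / c\<^sup>2 * (1 / real (Suc n)) powr (2 * \<alpha>)) \<longlonglongrightarrow> 4 * exp 1 / c\<^sup>2 * 0 powr (2 * \<alpha>)"
  proof (intro tendsto_mult tendsto_const tendsto_powr')
    show "(\<lambda>n. 1 / real (Suc n)) \<longlonglongrightarrow> 0" by real_asymp
  qed (use alpha in auto)
  moreover have "(LINT w|completion M. (L 0 w)\<^sup>2) \<le> 4 * exp 1 / c\<^sup>2 * (1 / real (Suc n)) powr (2 * \<alpha>)" for n
    using L_second_moment_mono[of 0 "1 / real (Suc n)"] L_square_integrable_pos(2)[of "1 / real (Suc n)"] by simp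
  ultimately have "(LINT w|completion M. (L 0 w)\<^sup>2) \<le> 4 * exp 1 / c\<^sup>2 * 0 powr (2 * \<alpha>)"
    using LIMSEQ_le_const by blast
  then show ?thesis using True by simp
next
  case False
  with t show ?thesis by (intro L_square_integrable_pos(2)) simp
qed

text \<open>The level is a quarter of the scale \<open>t powr \<alpha> / c\<close>, which is what
  makes the bound of \<open>prob_H_gt_le\<close> equal to 1/2.\<close>

lemma prob_L_ge_half:
  assumes t: "0 < t"
  shows "1 / 2 \<le> C.prob {w \<in> space M. t powr \<alpha> / (4 * c) \<le> L t w}"
proof -
  let ?x = "t powr \<alpha> / (4 * c)"
  have x: "0 < ?x" using c t by simp
  have "M.prob {w \<in> space M. t < H ?x w} \<le> 2 * (c * t powr - \<alpha> * ?x)"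
    by (rule prob_H_gt_le[OF less_imp_le[OF x] t])
  also have "\<dots> = 1 / 2" using c t by (simp add: powr_minus field_simps)
  finally have "M.prob {w \<in> space M. t < H ?x w} \<le> 1 / 2" .
  moreover have "M.prob {w \<in> space M. \<not> t < H ?x w} = 1 - M.prob {w \<in> space M. t < H ?x w}"
    using x by (intro M.prob_neg) simp
  ultimately have "1 / 2 \<le> M.prob {w \<in> space M. H ?x w \<le> t}" by (simp add: not_less)
  then show ?thesis by (rule order_trans[OF _ prob_L_ge[OF x less_imp_le[OF t]]])
qed

text \<open>Markov's inequality at the level \<open>t powr \<alpha> / (4 * c)\<close>, reached with
  probability at least 1/2; the product of both numbers explains the 8.\<close>

lemma L_expectation_ge:
  assumes t: "0 \<le> t"
  shows "t powr \<alpha> / (8 * c) \<le> (LINT w|completion M. L t w)"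
proof (cases "t = 0")
  case True
  then show ?thesis using L_nonneg_AE by (simp add: integral_nonneg_AE)
next
  case False
  with t have t: "0 < t" by simp
  let ?x = "t powr \<alpha> / (4 * c)"
  let ?A = "{w \<in> space M. ?x \<le> L t w}"
  have x: "0 < ?x" using c t by simp
  have "{w \<in> space (completion M). ?x \<le> L t w} \<in> C.events" using t[THEN less_imp_le] by measurable
  then have A: "?A \<in> C.events" unfolding space_completion .
  have "?x * (1 / 2) \<le> ?x * C.prob ?A" by (rule mult_left_mono[OF prob_L_ge_half[OF t] less_imp_le[OF x]])
  also have "C.prob ?A \<le> (LINT w|completion M. L t w / ?x)"
  proof (rule C.prob_le_expectation[OF A])
    show "integrable (completion M) (\<lambda>w. L t w / ?x)"
      using C.square_integrable_integrable[OF L_square_integrable[of t]] t by simp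
    show "AE w in completion M. indicator ?A w \<le> L t w / ?x"
      using L_nonneg_AE[of t] by eventually_elim (use x in \<open>auto simp: indicator_def simp del: divide_divide_eq_right\<close>)
  qed
  then have "?x * C.prob ?A \<le> ?x * (LINT w|completion M. L t w / ?x)"
    by (rule mult_left_mono[OF _ less_imp_le[OF x]])
  also have "\<dots> = (LINT w|completion M. L t w)" using c t by simp
  finally have "?x * (1 / 2) \<le> (LINT w|completion M. L t w)" .
  moreover have "?x * (1 / 2) = t powr \<alpha> / (8 * c)" by simp
  ultimately show ?thesis by (simp only:)
qed

text \<open>On whichever side of the midpoint of \<open>a\<close> and \<open>b\<close> the mean
  lies, one of the two events keeps \<open>f\<close> at distance at least \<open>(a - b) / 2\<close>
  from it.\<close>

lemma (in prob_space) variance_ge: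
  assumes f: "square_integrable M f" and ab: "b \<le> a" and p: "0 \<le> p"
    and A: "p \<le> prob {w \<in> space M. a \<le> f w}" and B: "p \<le> prob {w \<in> space M. f w \<le> b}"
  shows "((a - b) / 2)\<^sup>2 * p \<le> variance f"
proof -
  have [measurable]: "f \<in> borel_measurable M" using f by (simp add: square_integrable_def)
  define m where "m = expectation f"
  have int: "integrable M (\<lambda>w. (f w - m)\<^sup>2)"
    using square_integrable_diff[OF f square_integrable_const] by (simp add: square_integrable_def)
  have "\<exists>E\<in>events. p \<le> prob E \<and> (\<forall>w\<in>E. ((a - b) / 2)\<^sup>2 \<le> (f w - m)\<^sup>2)"
  proof (cases "m \<le> (a + b) / 2")
    case True
    have "((a - b) / 2)\<^sup>2 \<le> (f w - m)\<^sup>2" if "a \<le> f w" for w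
      using True ab that by (intro power_mono) (auto simp: field_simps)
    then show ?thesis using A by (intro bexI[of _ "{w \<in> space M. a \<le> f w}"]) auto
  next
    case False
    have "((a - b) / 2)\<^sup>2 \<le> (m - f w)\<^sup>2" if "f w \<le> b" for w
      using False ab that by (intro power_mono) (auto simp: field_simps)
    then show ?thesis using B by (intro bexI[of _ "{w \<in> space M. f w \<le> b}"]) (auto simp: power2_commute)
  qed
  then obtain E where E: "E \<in> events" "p \<le> prob E" "\<And>w. w \<in> E \<Longrightarrow> ((a - b) / 2)\<^sup>2 \<le> (f w - m)\<^sup>2" by blast
  have "((a - b) / 2)\<^sup>2 * p \<le> ((a - b) / 2)\<^sup>2 * prob E" using E(2) by (intro mult_left_mono) auto
  also have "\<dots> = (LINT w|M. ((a - b) / 2)\<^sup>2 * indicator E w)" using E(1) by simp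
  also have "\<dots> \<le> (LINT w|M. (f w - m)\<^sup>2)"
    using E by (intro integral_mono int integrable_mult_right integrable_real_indicator)
      (auto simp: indicator_def emeasure_eq_measure)
  finally show ?thesis unfolding m_def .
qed

text \<open>\<open>variance_ge\<close> for the gap between \<open>t powr \<alpha> / (8 * c)\<close>
  and \<open>t powr \<alpha> / (4 * c)\<close>. Half its width is
  \<open>t powr \<alpha> / (16 * c)\<close>, which gives the 256; the remaining factor is the
  probability \<open>p\<close> of finding the clock below the gap.\<close>

lemma L_variance_ge:
  assumes t: "0 \<le> t"
  shows "(1 / 32) powr (1 / (1 - \<alpha>)) / (256 * c\<^sup>2) * t powr (2 * \<alpha>) \<le> C.variance (L t)"
proof (cases "t = 0")
  case False
  with t have t: "0 < t" by simp
  \<comment> \<open>\<open>p\<close> solves \<open>p powr \<alpha> = 32 * p\<close>. At the lower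
    level the exponent in \<open>prob_H_gt_ge\<close> with \<open>y = p\<close> is
    \<open>p powr \<alpha> / 8 = 4 * p\<close>, so the bound there is
    \<open>1 - exp (- 4 * p) - p\<close>. As \<open>p\<close> is at most 1/32,
    \<open>exp (- 4 * p)\<close> is at most \<open>1 - 2 * p\<close>, which leaves
    \<open>p\<close>.\<close>
  define p :: real where "p = (1 / 32) powr (1 / (1 - \<alpha>))"
  have p0: "0 < p" by (simp add: p_def)
  have "p \<le> (1 / 32) powr 1"
    unfolding p_def using alpha by (intro powr_mono') (auto simp: le_divide_eq)
  then have p1: "p \<le> 1 / 32" by simp
  have "p powr (1 - \<alpha>) = 1 / 32" unfolding p_def powr_powr using alpha by simp
  moreover have "p powr (1 - \<alpha>) * p powr \<alpha> = p" using p0 by (simp flip: powr_add)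
  ultimately have "1 / 32 * p powr \<alpha> = p" by metis
  then have pa: "p powr \<alpha> = 32 * p" by simp
  let ?x = "t powr \<alpha> / (4 * c)" and ?y = "t powr \<alpha> / (8 * c)"
  have y: "0 < ?y" using c t by simp
  have "c * t powr - \<alpha> * ?y = 1 / 8" using c t by (simp add: powr_minus field_simps)
  then have "1 - exp (- (1 / 8) * (32 * p)) - p \<le> M.prob {w \<in> space M. t < H ?y w}"
    using prob_H_gt_ge[of ?y t p] y t p0 pa by (simp only: less_imp_le)
  moreover have "p \<le> 1 - exp (- (1 / 8) * (32 * p)) - p"
  proof -
    have "exp (- (4 * p)) \<le> 1 / (1 + 4 * p)"
      using exp_ge_add_one_self[of "4 * p"] p0 by (simp add: exp_minus divide_inverse le_imp_inverse_le)
    also have "\<dots> \<le> 1 - 2 * p"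
    proof -
      have "0 \<le> 2 * p * (1 - 4 * p)" using p0 p1 by simp
      then have "1 \<le> (1 - 2 * p) * (1 + 4 * p)" by (simp add: algebra_simps)
      then show ?thesis using p0 by (simp add: divide_le_eq)
    qed
    finally show ?thesis by simp
  qed
  ultimately have pB: "p \<le> C.prob {w \<in> space M. L t w \<le> ?y}"
    using prob_L_le[OF y less_imp_le[OF t]] by linarith
  have pA: "p \<le> C.prob {w \<in> space M. ?x \<le> L t w}"
    using prob_L_ge_half[OF t] p1 by linarith
  have "((?x - ?y) / 2)\<^sup>2 * p \<le> C.variance (L t)"
  proof (rule C.variance_ge[unfolded space_completion, OF L_square_integrable[OF less_imp_le[OF t]] _ less_imp_le[OF p0] pA pB])
    show "?y \<le> ?x" using c t by (intro divide_left_mono) auto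
  qed
  moreover have "((?x - ?y) / 2)\<^sup>2 * p = p / (256 * c\<^sup>2) * t powr (2 * \<alpha>)"
  proof -
    have "(?x - ?y) / 2 = t powr \<alpha> / (16 * c)" using c by (simp add: field_simps)
    moreover have "(t powr \<alpha>)\<^sup>2 = t powr (2 * \<alpha>)" using t by (simp add: power2_eq_square flip: powr_add)
    ultimately show ?thesis by (simp add: power_divide power_mult_distrib)
  qed
  ultimately show ?thesis by (simp add: p_def)
next
  case True
  then have "(1 / 32) powr (1 / (1 - \<alpha>)) / (256 * c\<^sup>2) * t powr (2 * \<alpha>) = 0" by simp
  then show ?thesis by (simp only:) (rule C.variance_positive)
qed

text \<open>Both bounds compare layer cake integrals over \<open>(x, y)\<close>. The lower one is
  the positive correlation in \<open>prob_H_joint_ge\<close>. For the upper one, the region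
  \<open>y \<le> x\<close> contributes at most the second moment of \<open>L s\<close>; on
  \<open>x < y\<close> the bound of \<open>prob_H_joint_le\<close> involves \<open>y\<close> only
  through \<open>y - x\<close>, so its integral factors into the product of the two means.\<close>

lemma L_covariance_bounds:
  assumes s: "0 \<le> s" and st: "s \<le> t"
  shows "(LINT w|completion M. L s w) * (LINT w|completion M. L t w) \<le> (LINT w|completion M. L s w * L t w)"
    and "(LINT w|completion M. L s w * L t w) \<le>
      (LINT w|completion M. (L s w)\<^sup>2) + (LINT w|completion M. L s w) * (LINT w|completion M. L t w)"
proof -
  have t: "0 \<le> t" using s st by simp
  have [measurable]: "L s \<in> borel_measurable (completion M)" "L t \<in> borel_measurable (completion M)"
    using s t by auto
  let ?P = "completion M"
  let ?i = "indicator {0<..} :: real \<Rightarrow> ennreal"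
  let ?lt = "\<lambda>u x. emeasure ?P {w \<in> space M. x < L u w}"
  let ?le = "\<lambda>u x. emeasure ?P {w \<in> space M. x \<le> L u w}"
  have tail_meas [measurable]: "?lt u \<in> borel_measurable borel" "?le u \<in> borel_measurable borel" if "0 \<le> u" for u
    using C.measurable_tail[OF L_measurable[OF that] disjI1[OF refl]]
      C.measurable_tail[OF L_measurable[OF that] disjI2[OF refl]] unfolding space_completion by blast+
  have ennreal_mult_le: "ennreal b * ennreal d \<le> ennreal a" if "b * d \<le> a" "0 \<le> b" "0 \<le> d" for a b d
    using that by (simp add: ennreal_leI flip: ennreal_mult)
  have ennreal_le_mult: "ennreal a \<le> ennreal b * ennreal d" if "a \<le> b * d" "0 \<le> b" "0 \<le> d" for a b d
    using that by (simp add: ennreal_leI flip: ennreal_mult)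
  have nn: "(\<integral>\<^sup>+w. ennreal (L u w) \<partial>?P) = ennreal (LINT w|?P. L u w)" if "0 \<le> u" for u
    using C.square_integrable_integrable[OF L_square_integrable[OF that]] L_nonneg_AE
    by (rule nn_integral_eq_integral)
  have nn2: "(\<integral>\<^sup>+w. ennreal (L u w) * ennreal (L v w) \<partial>?P) = ennreal (LINT w|?P. L u w * L v w)"
    if "0 \<le> u" "0 \<le> v" for u v
  proof -
    have "(\<integral>\<^sup>+w. ennreal (L u w) * ennreal (L v w) \<partial>?P) = (\<integral>\<^sup>+w. ennreal (L u w * L v w) \<partial>?P)"
      using L_nonneg_AE[of u] L_nonneg_AE[of v] by (intro nn_integral_cong_AE, eventually_elim) (simp add: ennreal_mult)
    also have "\<dots> = ennreal (LINT w|?P. L u w * L v w)"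
    proof (rule nn_integral_eq_integral)
      show "AE w in ?P. 0 \<le> L u w * L v w"
        using L_nonneg_AE[of u] L_nonneg_AE[of v] by eventually_elim simp
    qed (use that L_square_integrable square_integrable_mult in blast)
    finally show ?thesis .
  qed
  have E0: "0 \<le> (LINT w|?P. L u w)" for u
    using L_nonneg_AE by (rule integral_nonneg_AE)
  have E20: "0 \<le> (LINT w|?P. L u w * L v w)" for u v
  proof (rule integral_nonneg_AE)
    show "AE w in ?P. 0 \<le> L u w * L v w"
      using L_nonneg_AE[of u] L_nonneg_AE[of v] by eventually_elim simp
  qed
  have "ennreal ((LINT w|?P. L s w) * (LINT w|?P. L t w)) = (\<integral>\<^sup>+w. ennreal (L s w) \<partial>?P) * (\<integral>\<^sup>+w. ennreal (L t w) \<partial>?P)"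
    by (simp add: nn s t E0 ennreal_mult)
  also have "\<dots> = (\<integral>\<^sup>+x. ?i x * ?lt s x \<partial>lborel) * (\<integral>\<^sup>+y. ?i y * ?lt t y \<partial>lborel)"
    using C.nn_integral_tail[OF L_measurable[OF s] disjI1[OF refl]] C.nn_integral_tail[OF L_measurable[OF t] disjI1[OF refl]]
    unfolding space_completion by (simp only:)
  also have "\<dots> = (\<integral>\<^sup>+x. \<integral>\<^sup>+y. (?i x * ?lt s x) * (?i y * ?lt t y) \<partial>lborel \<partial>lborel)"
    using s t by (simp add: nn_integral_cmult nn_integral_multc)
  also have "\<dots> \<le> (\<integral>\<^sup>+x. \<integral>\<^sup>+y. ?i x * (?i y * emeasure ?P {w \<in> space M. x \<le> L s w \<and> y \<le> L t w}) \<partial>lborel \<partial>lborel)"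
  proof (intro nn_integral_mono)
    fix x y :: real
    show "(?i x * ?lt s x) * (?i y * ?lt t y) \<le> ?i x * (?i y * emeasure ?P {w \<in> space M. x \<le> L s w \<and> y \<le> L t w})"
    proof (cases "0 < x \<and> 0 < y")
      case True
      then have xy: "0 < x" "0 < y" by auto
      have "C.prob {w \<in> space M. x < L s w} * C.prob {w \<in> space M. y < L t w}
         \<le> M.prob {w \<in> space M. H x w \<le> s} * M.prob {w \<in> space M. H y w \<le> t}"
        using xy s t by (intro mult_mono prob_L_gt) auto
      also have "\<dots> \<le> M.prob {w \<in> space M. H x w \<le> s \<and> H y w \<le> t}"
        using xy st by (intro prob_H_joint_ge) auto
      also have "\<dots> \<le> C.prob {w \<in> space M. x \<le> L s w \<and> y \<le> L t w}"
        using xy s t by (intro prob_joint_L_ge) auto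
      finally have "?lt s x * ?lt t y \<le> emeasure ?P {w \<in> space M. x \<le> L s w \<and> y \<le> L t w}"
        unfolding C.emeasure_eq_measure by (rule ennreal_mult_le[OF _ measure_nonneg measure_nonneg])
      then show ?thesis
        using xy by (simp only: indicator_simps greaterThan_iff mult_1)
    next
      case False
      then have "?i x = 0 \<or> ?i y = 0" by (auto simp: indicator_def)
      then show ?thesis by (elim disjE) (simp_all only: mult_zero_left mult_zero_right zero_le)
    qed
  qed
  also have "\<dots> = ennreal (LINT w|?P. L s w * L t w)"
    using C.nn_integral_mult_tail[OF L_measurable[OF s] L_measurable[OF t] disjI2[OF refl]] nn2[OF s t]
    unfolding space_completion by (simp only:)
  finally show "(LINT w|?P. L s w) * (LINT w|?P. L t w) \<le> (LINT w|?P. L s w * L t w)"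
    by (simp add: E20)
  \<comment> \<open>Names for the three tails. \<open>T (max x y)\<close> is the joint tail of
    \<open>L s\<close> with itself, so its integral over all positive \<open>x\<close> and
    \<open>y\<close> is the second moment of \<open>L s\<close>. Only \<open>y \<le> x\<close> calls
    for this term, but keeping it everywhere makes that integral appear whole.\<close>
  define T where "T = ?lt s"
  define U where "U = ?le s"
  define V where "V = ?le t"
  have [measurable]: "T \<in> borel_measurable borel" "U \<in> borel_measurable borel" "V \<in> borel_measurable borel"
    unfolding T_def U_def V_def using tail_meas s t by blast+
  have T_max: "T (max x y) = emeasure ?P {w \<in> space M. x < L s w \<and> y < L s w}" for x y
    by (simp add: T_def)
  have TUV: "U = ?le s" "V = ?le t" by (simp_all add: U_def V_def)
  \<comment> \<open>Translation invariance of Lebesgue measure removes \<open>x\<close> from the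
    inner integral.\<close>
  have shift: "(\<integral>\<^sup>+y. ?i (y - x) * V (y - x) \<partial>lborel) = (\<integral>\<^sup>+w. ennreal (L t w) \<partial>?P)" for x
  proof -
    have "(\<integral>\<^sup>+w. ennreal (L t w) \<partial>?P) = (\<integral>\<^sup>+y. ?i y * ?le t y \<partial>lborel)"
      using C.nn_integral_tail[OF L_measurable[OF t] disjI2[OF refl]] unfolding space_completion .
    also have "\<dots> = (\<integral>\<^sup>+y. ?i (- x + y) * ?le t (- x + y) \<partial>lborel)"
    proof -
      have m: "(\<lambda>y. ?i y * ?le t y) \<in> borel_measurable borel"
        using t by measurable
      show ?thesis
        by (subst nn_integral_real_affine[OF m one_neq_zero, of "- x"]) (simp only: abs_one ennreal_1 mult_1)
    qed
    finally show ?thesis unfolding V_def by (simp only: uminus_add_conv_diff)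
  qed
  have "ennreal (LINT w|?P. L s w * L t w) =
     (\<integral>\<^sup>+x. \<integral>\<^sup>+y. ?i x * (?i y * emeasure ?P {w \<in> space M. x < L s w \<and> y < L t w}) \<partial>lborel \<partial>lborel)"
    unfolding nn2[OF s t, symmetric]
    using C.nn_integral_mult_tail[OF L_measurable[OF s] L_measurable[OF t] disjI1[OF refl]]
    unfolding space_completion .
  also have "\<dots> \<le> (\<integral>\<^sup>+x. \<integral>\<^sup>+y. ?i x * (?i y * T (max x y))
      + (?i x * ?le s x) * (?i (y - x) * ?le t (y - x)) \<partial>lborel \<partial>lborel)"
  proof (intro nn_integral_mono)
    fix x y :: real
    show "?i x * (?i y * emeasure ?P {w \<in> space M. x < L s w \<and> y < L t w}) \<le>
      ?i x * (?i y * T (max x y)) + (?i x * ?le s x) * (?i (y - x) * ?le t (y - x))"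
    proof (cases "0 < x \<and> 0 < y")
      case True
      then have xy: "0 < x" "0 < y" by auto
      show ?thesis
      proof (cases "y \<le> x")
        case True
        have "{w \<in> space ?P. max x y < L s w} \<in> C.events" by measurable
        then have "{w \<in> space M. max x y < L s w} \<in> C.events" unfolding space_completion .
        moreover have "{w \<in> space M. x < L s w \<and> y < L t w} \<subseteq> {w \<in> space M. max x y < L s w}"
          using True by auto
        ultimately have "emeasure ?P {w \<in> space M. x < L s w \<and> y < L t w} \<le> T (max x y)"
          unfolding T_def by (rule emeasure_mono[rotated])
        then show ?thesis
          using xy by (simp only: indicator_simps greaterThan_iff mult_1) (rule add_increasing2[OF zero_le])
      next
        case False
        have "C.prob {w \<in> space M. x < L s w \<and> y < L t w} \<le> M.prob {w \<in> space M. H x w \<le> s \<and> H y w \<le> t}"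
          using xy s t by (intro prob_joint_L_le) auto
        also have "\<dots> \<le> M.prob {w \<in> space M. H x w \<le> s} * M.prob {w \<in> space M. H (y - x) w \<le> t}"
          using xy False by (intro prob_H_joint_le) auto
        also have "\<dots> \<le> C.prob {w \<in> space M. x \<le> L s w} * C.prob {w \<in> space M. y - x \<le> L t w}"
          using xy False s t by (intro mult_mono prob_L_ge) auto
        finally have "emeasure ?P {w \<in> space M. x < L s w \<and> y < L t w} \<le> ?le s x * ?le t (y - x)"
          unfolding C.emeasure_eq_measure by (rule ennreal_le_mult[OF _ measure_nonneg measure_nonneg])
        moreover have "0 < y - x" using False by simp
        ultimately show ?thesis
          using xy by (simp only: indicator_simps greaterThan_iff mult_1) (rule add_increasing[OF zero_le])
      qed
    next
      case False
      then have "?i x = 0 \<or> ?i y = 0" by (auto simp: indicator_def)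
      then show ?thesis by (elim disjE) (simp_all only: mult_zero_left mult_zero_right zero_le)
    qed
  qed
  also have "\<dots> = (\<integral>\<^sup>+x. \<integral>\<^sup>+y. ?i x * (?i y * T (max x y)) + (?i x * U x) * (?i (y - x) * V (y - x)) \<partial>lborel \<partial>lborel)"
    unfolding TUV by (simp only:)
  also have "\<dots> = (\<integral>\<^sup>+x. (\<integral>\<^sup>+y. ?i x * (?i y * T (max x y)) \<partial>lborel)
      + (\<integral>\<^sup>+y. (?i x * U x) * (?i (y - x) * V (y - x)) \<partial>lborel) \<partial>lborel)"
    by (intro nn_integral_cong nn_integral_add) measurable
  also have "\<dots> = (\<integral>\<^sup>+x. (\<integral>\<^sup>+y. ?i x * (?i y * T (max x y)) \<partial>lborel)
      + (?i x * U x) * (\<integral>\<^sup>+w. ennreal (L t w) \<partial>?P) \<partial>lborel)"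
  proof (intro nn_integral_cong arg_cong2[where f = "(+)"] refl)
    fix x :: real
    have "(\<integral>\<^sup>+y. (?i x * U x) * (?i (y - x) * V (y - x)) \<partial>lborel) = (?i x * U x) * (\<integral>\<^sup>+y. ?i (y - x) * V (y - x) \<partial>lborel)"
      by (rule nn_integral_cmult) measurable
    then show "(\<integral>\<^sup>+y. (?i x * U x) * (?i (y - x) * V (y - x)) \<partial>lborel) = (?i x * U x) * (\<integral>\<^sup>+w. ennreal (L t w) \<partial>?P)"
      unfolding shift .
  qed
  also have "\<dots> = (\<integral>\<^sup>+x. \<integral>\<^sup>+y. ?i x * (?i y * T (max x y)) \<partial>lborel \<partial>lborel)
      + (\<integral>\<^sup>+x. (?i x * U x) * (\<integral>\<^sup>+w. ennreal (L t w) \<partial>?P) \<partial>lborel)"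
    by (rule nn_integral_add) measurable
  also have "(\<integral>\<^sup>+x. (?i x * U x) * (\<integral>\<^sup>+w. ennreal (L t w) \<partial>?P) \<partial>lborel)
      = (\<integral>\<^sup>+x. ?i x * U x \<partial>lborel) * (\<integral>\<^sup>+w. ennreal (L t w) \<partial>?P)"
    by (rule nn_integral_multc) measurable
  also have "(\<integral>\<^sup>+x. ?i x * U x \<partial>lborel) = ennreal (LINT w|?P. L s w)"
    unfolding nn[OF s, symmetric] TUV
    using C.nn_integral_tail[OF L_measurable[OF s] disjI2[OF refl], symmetric] unfolding space_completion .
  also have "(\<integral>\<^sup>+x. \<integral>\<^sup>+y. ?i x * (?i y * T (max x y)) \<partial>lborel \<partial>lborel) = ennreal (LINT w|?P. (L s w)\<^sup>2)"
    unfolding power2_eq_square nn2[OF s s, symmetric] T_max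
    using C.nn_integral_mult_tail[OF L_measurable[OF s] L_measurable[OF s] disjI1[OF refl], symmetric]
    unfolding space_completion .
  also have "(\<integral>\<^sup>+w. ennreal (L t w) \<partial>?P) = ennreal (LINT w|?P. L t w)"
    by (rule nn[OF t])
  finally have le: "ennreal (LINT w|?P. L s w * L t w)
    \<le> ennreal (LINT w|?P. (L s w)\<^sup>2) + ennreal (LINT w|?P. L s w) * ennreal (LINT w|?P. L t w)" .
  have le': "a \<le> b + p * q" if "ennreal a \<le> ennreal b + ennreal p * ennreal q" "0 \<le> b" "0 \<le> p" "0 \<le> q" for a b p q
    using that by (simp flip: ennreal_mult ennreal_plus)
  show "(LINT w|?P. L s w * L t w) \<le> (LINT w|?P. (L s w)\<^sup>2) + (LINT w|?P. L s w) * (LINT w|?P. L t w)"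
    by (rule le'[OF le _ E0 E0]) (rule integral_nonneg_AE, simp)
qed

end

section \<open>Evaluating a random field at an independent random time\<close>

lemma measurable_larger_sets:
  "f \<in> measurable F N \<Longrightarrow> space F = space M \<Longrightarrow> sets F \<subseteq> sets M \<Longrightarrow> f \<in> measurable M N"
  by (auto simp: measurable_def)

text \<open>Independence is available as a statement on sets; the layer cake formula reduces the
  claim to \<open>A\<close> and the level sets \<open>x < f\<close>, which lie in
  \<open>F\<close>.\<close>

lemma (in prob_space) nn_integral_indep_indicator:
  fixes f :: "'a \<Rightarrow> real"
  assumes ind: "indep_set (sets G) (sets F)" and F: "space F = space M"
    and A: "A \<in> sets G" and f: "f \<in> borel_measurable F"
  shows "(\<integral>\<^sup>+w. ennreal (f w) * indicator A w \<partial>M) = (\<integral>\<^sup>+w. ennreal (f w) \<partial>M) * emeasure M A"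
proof -
  have AM [measurable]: "A \<in> events" using indep_setD_ev1[OF ind] A by blast
  have fM [measurable]: "f \<in> borel_measurable M"
    using f F indep_setD_ev2[OF ind] by (rule measurable_larger_sets)
  have "(\<integral>\<^sup>+w. ennreal (f w) * indicator A w \<partial>M) = (\<integral>\<^sup>+w. ennreal (f w * indicator A w) \<partial>M)"
    by (intro nn_integral_cong) (simp add: indicator_def)
  also have "\<dots> = (\<integral>\<^sup>+x. indicator {0<..} x * emeasure M {w \<in> space M. x < f w * indicator A w} \<partial>lborel)"
    by (rule nn_integral_tail) auto
  also have "\<dots> = (\<integral>\<^sup>+x. (indicator {0<..} x * emeasure M {w \<in> space M. x < f w}) * emeasure M A \<partial>lborel)"
  proof (intro nn_integral_cong)
    fix x :: real
    show "indicator {0<..} x * emeasure M {w \<in> space M. x < f w * indicator A w}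
        = (indicator {0<..} x * emeasure M {w \<in> space M. x < f w}) * emeasure M A"
    proof (cases "0 < x")
      case True
      have "{w \<in> space M. x < f w * indicator A w} = A \<inter> {w \<in> space M. x < f w}"
        using True sets.sets_into_space[OF AM] by (auto simp: indicator_def split: if_splits)
      moreover have "{w \<in> space M. x < f w} \<in> sets F"
        using f unfolding F[symmetric] by measurable
      ultimately have "prob {w \<in> space M. x < f w * indicator A w} = prob {w \<in> space M. x < f w} * prob A"
        using indep_setD[OF ind A] by simp
      then show ?thesis
        using True unfolding emeasure_eq_measure by (simp add: ennreal_mult)
    qed simp
  qed
  also have "\<dots> = (\<integral>\<^sup>+x. indicator {0<..} x * emeasure M {w \<in> space M. x < f w} \<partial>lborel) * emeasure M A"
    using measurable_tail[OF fM disjI1[OF refl]] by (intro nn_integral_multc) simp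
  also have "(\<integral>\<^sup>+x. indicator {0<..} x * emeasure M {w \<in> space M. x < f w} \<partial>lborel) = (\<integral>\<^sup>+w. ennreal (f w) \<partial>M)"
    by (rule nn_integral_tail[symmetric]) auto
  finally show ?thesis .
qed

text \<open>Conditioning on a countably valued index: on each event \<open>Q = q\<close> the family
  is evaluated at a fixed index, and independence separates the event from \<open>Y q\<close>. On
  the right the index is frozen while \<eta> runs over fresh outcomes.\<close>

lemma (in prob_space) nn_integral_countable_mixture:
  fixes Y :: "'i \<Rightarrow> 'a \<Rightarrow> real"
  assumes ind: "indep_set (sets G) (sets F)" and G: "space G = space M" and F: "space F = space M"
    and I: "countable I" and Q: "Q \<in> measurable G (count_space I)"
    and Y: "\<And>q. q \<in> I \<Longrightarrow> Y q \<in> borel_measurable F"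
  shows "(\<integral>\<^sup>+w. ennreal (Y (Q w) w) \<partial>M) = (\<integral>\<^sup>+w. (\<integral>\<^sup>+\<eta>. ennreal (Y (Q w) \<eta>) \<partial>M) \<partial>M)"
proof -
  have QM [measurable]: "Q \<in> measurable M (count_space I)"
    using Q G indep_setD_ev1[OF ind] by (rule measurable_larger_sets)
  have YM [measurable]: "Y q \<in> borel_measurable M" if "q \<in> I" for q
    using Y[OF that] F indep_setD_ev2[OF ind] by (rule measurable_larger_sets)
  have QI: "Q w \<in> I" if "w \<in> space M" for w
    using measurable_space[OF QM that] by simp
  define A where "A q = {w \<in> space M. Q w = q}" for q
  have AG: "A q \<in> sets G" if "q \<in> I" for q
  proof -
    have "Q -` {q} \<inter> space G \<in> sets G" using Q that by (intro measurable_sets) auto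
    moreover have "Q -` {q} \<inter> space G = A q" by (auto simp: A_def G)
    ultimately show ?thesis by simp
  qed
  have AM: "A q \<in> events" if "q \<in> I" for q
    using AG[OF that] indep_setD_ev1[OF ind] by blast
  have split: "h (Q w) = (\<integral>\<^sup>+q. h q * indicator (A q) w \<partial>count_space I)" if w: "w \<in> space M" for h :: "'i \<Rightarrow> ennreal" and w
  proof -
    have "(\<integral>\<^sup>+q. h q * indicator (A q) w \<partial>count_space I) = (\<Sum>q\<in>{Q w}. h q * indicator (A q) w)"
      using QI[OF w] by (intro nn_integral_count_space') (auto simp: A_def indicator_def)
    then show ?thesis using w by (simp add: A_def)
  qed
  have "(\<integral>\<^sup>+w. ennreal (Y (Q w) w) \<partial>M) = (\<integral>\<^sup>+w. \<integral>\<^sup>+q. ennreal (Y q w) * indicator (A q) w \<partial>count_space I \<partial>M)"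
    by (intro nn_integral_cong split)
  also have "\<dots> = (\<integral>\<^sup>+q. \<integral>\<^sup>+w. ennreal (Y q w) * indicator (A q) w \<partial>M \<partial>count_space I)"
    using AM by (intro nn_integral_count_space_nn_integral[OF I]) simp
  also have "\<dots> = (\<integral>\<^sup>+q. \<integral>\<^sup>+w. (\<integral>\<^sup>+\<eta>. ennreal (Y q \<eta>) \<partial>M) * indicator (A q) w \<partial>M \<partial>count_space I)"
  proof (rule nn_integral_cong)
    fix q assume "q \<in> space (count_space I)"
    then have q: "q \<in> I" by simp
    show "(\<integral>\<^sup>+w. ennreal (Y q w) * indicator (A q) w \<partial>M) = (\<integral>\<^sup>+w. (\<integral>\<^sup>+\<eta>. ennreal (Y q \<eta>) \<partial>M) * indicator (A q) w \<partial>M)"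
      unfolding nn_integral_indep_indicator[OF ind F AG[OF q] Y[OF q]] nn_integral_cmult_indicator[OF AM[OF q]] ..
  qed
  also have "\<dots> = (\<integral>\<^sup>+w. \<integral>\<^sup>+q. (\<integral>\<^sup>+\<eta>. ennreal (Y q \<eta>) \<partial>M) * indicator (A q) w \<partial>count_space I \<partial>M)"
    using AM by (intro nn_integral_count_space_nn_integral[OF I, symmetric]) simp
  also have "\<dots> = (\<integral>\<^sup>+w. (\<integral>\<^sup>+\<eta>. ennreal (Y (Q w) \<eta>) \<partial>M) \<partial>M)"
    by (intro nn_integral_cong split[symmetric])
  finally show ?thesis .
qed

lemma (in prob_space) square_integrable_countable_mixture:
  fixes Z :: "'i \<Rightarrow> 'a \<Rightarrow> real"
  assumes ind: "indep_set (sets G) (sets F)" and G: "space G = space M" and F: "space F = space M"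
    and I: "countable I" and Q: "Q \<in> measurable G (count_space I)"
    and Z: "\<And>q. q \<in> I \<Longrightarrow> Z q \<in> borel_measurable F" "\<And>q. q \<in> I \<Longrightarrow> square_integrable M (Z q)"
    and int: "integrable M (\<lambda>w. \<integral>\<eta>. (Z (Q w) \<eta>)\<^sup>2 \<partial>M)"
  shows "square_integrable M (\<lambda>w. Z (Q w) w)"
    and "(LINT w|M. (Z (Q w) w)\<^sup>2) = (LINT w|M. (\<integral>\<eta>. (Z (Q w) \<eta>)\<^sup>2 \<partial>M))"
proof -
  have QM: "Q \<in> measurable M (count_space I)"
    using Q G indep_setD_ev1[OF ind] by (rule measurable_larger_sets)
  have QI: "Q w \<in> I" if "w \<in> space M" for w
    using measurable_space[OF QM that] by simp
  have meas: "(\<lambda>w. Z (Q w) w) \<in> borel_measurable M"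
    by (rule measurable_compose_countable'[where f = Z and g = Q and I = I, OF _ QM I])
      (use Z(2) in \<open>simp add: square_integrable_def\<close>)
  have "(\<integral>\<^sup>+w. ennreal ((Z (Q w) w)\<^sup>2) \<partial>M) = (\<integral>\<^sup>+w. (\<integral>\<^sup>+\<eta>. ennreal ((Z (Q w) \<eta>)\<^sup>2) \<partial>M) \<partial>M)"
    using Z(1) by (intro nn_integral_countable_mixture[OF ind G F I Q]) simp
  also have "\<dots> = (\<integral>\<^sup>+w. ennreal (\<integral>\<eta>. (Z (Q w) \<eta>)\<^sup>2 \<partial>M) \<partial>M)"
    using Z(2) QI by (intro nn_integral_cong nn_integral_eq_integral) (auto simp: square_integrable_def)
  also have "\<dots> = ennreal (LINT w|M. (\<integral>\<eta>. (Z (Q w) \<eta>)\<^sup>2 \<partial>M))"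
    using int by (intro nn_integral_eq_integral) auto
  finally have eq: "(\<integral>\<^sup>+w. ennreal ((Z (Q w) w)\<^sup>2) \<partial>M) = ennreal (LINT w|M. (\<integral>\<eta>. (Z (Q w) \<eta>)\<^sup>2 \<partial>M))" .
  have sq: "integrable M (\<lambda>w. (Z (Q w) w)\<^sup>2)"
    by (rule integrableI_nonneg) (use meas eq in auto)
  then show "square_integrable M (\<lambda>w. Z (Q w) w)"
    using meas by (simp add: square_integrable_def)
  have "ennreal (LINT w|M. (Z (Q w) w)\<^sup>2) = ennreal (LINT w|M. (\<integral>\<eta>. (Z (Q w) \<eta>)\<^sup>2 \<partial>M))"
    unfolding eq[symmetric] by (rule nn_integral_eq_integral[OF sq, symmetric]) simp
  then show "(LINT w|M. (Z (Q w) w)\<^sup>2) = (LINT w|M. (\<integral>\<eta>. (Z (Q w) \<eta>)\<^sup>2 \<partial>M))"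
    by (subst (asm) ennreal_inj) (auto intro!: integral_nonneg_AE)
qed

text \<open>Polarization: the formula for squares, applied to \<open>Y\<close>, \<open>Z\<close> and
  \<open>Y + Z\<close>, yields the mixed moment of signed variables.\<close>

lemma (in prob_space) integral_mult_countable_mixture:
  fixes Y Z :: "'i \<Rightarrow> 'a \<Rightarrow> real"
  assumes ind: "indep_set (sets G) (sets F)" and G: "space G = space M" and F: "space F = space M"
    and I: "countable I" and Q: "Q \<in> measurable G (count_space I)"
    and Y: "\<And>q. q \<in> I \<Longrightarrow> Y q \<in> borel_measurable F" "\<And>q. q \<in> I \<Longrightarrow> square_integrable M (Y q)"
    and Z: "\<And>q. q \<in> I \<Longrightarrow> Z q \<in> borel_measurable F" "\<And>q. q \<in> I \<Longrightarrow> square_integrable M (Z q)"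
    and intY: "integrable M (\<lambda>w. \<integral>\<eta>. (Y (Q w) \<eta>)\<^sup>2 \<partial>M)"
    and intZ: "integrable M (\<lambda>w. \<integral>\<eta>. (Z (Q w) \<eta>)\<^sup>2 \<partial>M)"
    and intYZ: "integrable M (\<lambda>w. \<integral>\<eta>. Y (Q w) \<eta> * Z (Q w) \<eta> \<partial>M)"
  shows "(LINT w|M. Y (Q w) w * Z (Q w) w) = (LINT w|M. (\<integral>\<eta>. Y (Q w) \<eta> * Z (Q w) \<eta> \<partial>M))"
proof -
  note Ymix = square_integrable_countable_mixture[OF ind G F I Q Y intY]
  note Zmix = square_integrable_countable_mixture[OF ind G F I Q Z intZ]
  have QM: "Q \<in> measurable M (count_space I)"
    using Q G indep_setD_ev1[OF ind] by (rule measurable_larger_sets)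
  have QI: "Q w \<in> I" if "w \<in> space M" for w
    using measurable_space[OF QM that] by simp
  have expand: "(\<integral>\<eta>. (f \<eta> + g \<eta>)\<^sup>2 \<partial>M) = (\<integral>\<eta>. (f \<eta>)\<^sup>2 \<partial>M) + 2 * (\<integral>\<eta>. f \<eta> * g \<eta> \<partial>M) + (\<integral>\<eta>. (g \<eta>)\<^sup>2 \<partial>M)"
    if f: "square_integrable M f" and g: "square_integrable M g" for f g
  proof -
    have "(\<integral>\<eta>. (f \<eta> + g \<eta>)\<^sup>2 \<partial>M) = (\<integral>\<eta>. (f \<eta>)\<^sup>2 + 2 * (f \<eta> * g \<eta>) + (g \<eta>)\<^sup>2 \<partial>M)"
      by (intro Bochner_Integration.integral_cong) (auto simp: power2_sum)
    then show ?thesis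
      using f g square_integrable_mult[OF f g] by (simp add: square_integrable_def)
  qed
  have inner: "(\<integral>\<eta>. (Y (Q w) \<eta> + Z (Q w) \<eta>)\<^sup>2 \<partial>M) =
      (\<integral>\<eta>. (Y (Q w) \<eta>)\<^sup>2 \<partial>M) + 2 * (\<integral>\<eta>. Y (Q w) \<eta> * Z (Q w) \<eta> \<partial>M) + (\<integral>\<eta>. (Z (Q w) \<eta>)\<^sup>2 \<partial>M)"
    if "w \<in> space M" for w
    using expand Y(2) Z(2) QI[OF that] by blast
  have int: "integrable M (\<lambda>w. \<integral>\<eta>. (Y (Q w) \<eta> + Z (Q w) \<eta>)\<^sup>2 \<partial>M)"
  proof -
    have "integrable M (\<lambda>w. (\<integral>\<eta>. (Y (Q w) \<eta>)\<^sup>2 \<partial>M) + 2 * (\<integral>\<eta>. Y (Q w) \<eta> * Z (Q w) \<eta> \<partial>M) + (\<integral>\<eta>. (Z (Q w) \<eta>)\<^sup>2 \<partial>M))"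
      using intY intZ intYZ by auto
    then show ?thesis using inner by (simp cong: Bochner_Integration.integrable_cong)
  qed
  have "(LINT w|M. (Y (Q w) w + Z (Q w) w)\<^sup>2) = (LINT w|M. (\<integral>\<eta>. (Y (Q w) \<eta> + Z (Q w) \<eta>)\<^sup>2 \<partial>M))"
    using Y Z int by (intro square_integrable_countable_mixture(2)[OF ind G F I Q]) (auto intro: square_integrable_add)
  also have "\<dots> = (LINT w|M. (\<integral>\<eta>. (Y (Q w) \<eta>)\<^sup>2 \<partial>M) + 2 * (\<integral>\<eta>. Y (Q w) \<eta> * Z (Q w) \<eta> \<partial>M) + (\<integral>\<eta>. (Z (Q w) \<eta>)\<^sup>2 \<partial>M))"
    using inner by (intro Bochner_Integration.integral_cong) auto
  also have "\<dots> = (LINT w|M. (\<integral>\<eta>. (Y (Q w) \<eta>)\<^sup>2 \<partial>M)) + 2 * (LINT w|M. (\<integral>\<eta>. Y (Q w) \<eta> * Z (Q w) \<eta> \<partial>M))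
      + (LINT w|M. (\<integral>\<eta>. (Z (Q w) \<eta>)\<^sup>2 \<partial>M))"
    using intY intZ intYZ by simp
  finally show ?thesis
    using expand[OF Ymix(1) Zmix(1)] Ymix(2) Zmix(2) by linarith
qed

text \<open>The Levy structure distilled into moments: \<open>F\<close> carries the field,
  \<open>G\<close> the random times, \<mu> the means and \<sigma> the variances along the axes. The
  mixed moment is prescribed for ordered pairs of times. Completeness of \<open>M\<close> makes
  almost sure limits measurable.\<close>

locale independent_levy_time =
  prob_space M + complete_measure M for M :: "'w measure" +
  fixes F G :: "'w measure" and X :: "real ^ 'n \<Rightarrow> 'w \<Rightarrow> real" and \<mu> \<sigma> :: "real ^ 'n"
  assumes indep: "indep_set (sets G) (sets F)" and space_G: "space G = space M" and space_F: "space F = space M"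
    and X_measurable: "\<And>t. 0 \<le> t \<Longrightarrow> X t \<in> borel_measurable F"
    and X_square_integrable: "\<And>t. 0 \<le> t \<Longrightarrow> square_integrable M (X t)"
    and X_expectation: "\<And>t. 0 \<le> t \<Longrightarrow> (LINT w|M. X t w) = \<mu> \<bullet> t"
    and X_mixed_moment: "\<And>a b. 0 \<le> a \<Longrightarrow> a \<le> b \<Longrightarrow> (LINT w|M. X a w * X b w) = \<sigma> \<bullet> a + (\<mu> \<bullet> a) * (\<mu> \<bullet> b)"
    and X_cadlag: "AE w in M. cadlag_path (\<lambda>t. X t w)"
begin

lemma inner_vec_sum: "v \<bullet> A w = (\<Sum>k\<in>UNIV. v $ k * (A w $ k))" for v :: "real ^ 'm" and A :: "'w \<Rightarrow> real ^ 'm"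
  by (simp add: inner_vec_def)

lemma square_integrable_inner:
  assumes "\<And>k. square_integrable M (\<lambda>w. A w $ k)"
  shows "square_integrable M (\<lambda>w. v \<bullet> A w)"
  unfolding inner_vec_sum by (rule square_integrable_sum) (rule square_integrable_cmult[OF assms])

lemma G_measurable_imp: "f \<in> measurable G N \<Longrightarrow> f \<in> measurable M N"
  by (rule measurable_larger_sets[OF _ space_G indep_setD_ev1[OF indep]])

definition grid :: "(real ^ 'n) set" where
  "grid = {v. \<forall>k. v $ k \<in> \<rat> \<and> 0 \<le> v $ k}"

lemma countable_grid: "countable grid"
proof -
  have "countable ((\<lambda>f. \<chi> k. f k) ` (PiE UNIV (\<lambda>_. \<rat> :: real set)) :: (real ^ 'n) set)"
    by (intro countable_image countable_PiE) (auto simp: countable_rat)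
  moreover have "grid \<subseteq> (\<lambda>f. \<chi> k. f k) ` (PiE UNIV (\<lambda>_. \<rat> :: real set))"
  proof
    fix v assume v: "v \<in> grid"
    then have "(\<lambda>k. v $ k) \<in> PiE UNIV (\<lambda>_. \<rat>)" by (auto simp: grid_def)
    then show "v \<in> (\<lambda>f. \<chi> k. f k) ` (PiE UNIV (\<lambda>_. \<rat> :: real set))"
      by (intro image_eqI[of _ _ "\<lambda>k. v $ k"]) (simp_all add: vec_eq_iff)
  qed
  ultimately show ?thesis by (rule countable_subset[rotated])
qed

lemma grid_nonneg: "v \<in> grid \<Longrightarrow> 0 \<le> v"
  by (simp add: grid_def less_eq_vec_def)

text \<open>Both times are treated as one random index. Its values are the ordered pairs, because
  the mixed moment formula speaks of \<open>a \<le> b\<close>.\<close>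

lemma grid_pair_measurable:
  assumes A: "\<And>k. (\<lambda>w. A w $ k) \<in> borel_measurable G" "\<And>w. A w \<in> grid"
    and B: "\<And>k. (\<lambda>w. B w $ k) \<in> borel_measurable G" "\<And>w. B w \<in> grid" and le: "\<And>w. A w \<le> B w"
  shows "(\<lambda>w. (A w, B w)) \<in> measurable G (count_space {(a, b). a \<in> grid \<and> b \<in> grid \<and> a \<le> b})"
proof -
  have cnt: "countable {(a, b). a \<in> grid \<and> b \<in> grid \<and> a \<le> b}"
    by (rule countable_subset[OF _ countable_SIGMA[OF countable_grid countable_grid]]) auto
  have "(\<lambda>w. (A w, B w)) -` {(a, b)} \<inter> space G \<in> sets G" for a b
  proof -
    have "(\<lambda>w. (A w, B w)) -` {(a, b)} \<inter> space G = {w \<in> space G. (\<forall>k. A w $ k = a $ k) \<and> (\<forall>k. B w $ k = b $ k)}"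
      by (auto simp: vec_eq_iff)
    also have "\<dots> \<in> sets G"
      using A(1) B(1) by measurable
    finally show ?thesis .
  qed
  then show ?thesis
    unfolding measurable_count_space_eq_countable[OF cnt] using A(2) B(2) le by auto
qed

lemma grid_time_moments:
  assumes A: "\<And>k. (\<lambda>w. A w $ k) \<in> borel_measurable G" "\<And>w. A w \<in> grid" "\<And>k. square_integrable M (\<lambda>w. A w $ k)"
    and B: "\<And>k. (\<lambda>w. B w $ k) \<in> borel_measurable G" "\<And>w. B w \<in> grid" "\<And>k. square_integrable M (\<lambda>w. B w $ k)"
    and le: "\<And>w. A w \<le> B w"
  shows "square_integrable M (\<lambda>w. X (A w) w)"
    and "(LINT w|M. X (A w) w) = (LINT w|M. \<mu> \<bullet> A w)"
    and "(LINT w|M. X (A w) w * X (B w) w) = (LINT w|M. \<sigma> \<bullet> A w + (\<mu> \<bullet> A w) * (\<mu> \<bullet> B w))"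
proof -
  let ?I = "{(a, b). a \<in> grid \<and> b \<in> grid \<and> a \<le> b}"
  let ?Q = "\<lambda>w. (A w, B w)"
  let ?Y = "\<lambda>q. X (fst q)" and ?Z = "\<lambda>q. X (snd q)"
  have cnt: "countable ?I"
    by (rule countable_subset[OF _ countable_SIGMA[OF countable_grid countable_grid]]) auto
  note Q = grid_pair_measurable[OF A(1,2) B(1,2) le]
  have nn: "0 \<le> A w" "0 \<le> B w" for w using A(2) B(2) grid_nonneg by auto
  have second: "(\<integral>\<eta>. (X v \<eta>)\<^sup>2 \<partial>M) = \<sigma> \<bullet> v + (\<mu> \<bullet> v)\<^sup>2" if "0 \<le> v" for v
    using X_mixed_moment[OF that order_refl] by (simp add: power2_eq_square)
  have sq: "square_integrable M (\<lambda>w. v \<bullet> A w)" "square_integrable M (\<lambda>w. v \<bullet> B w)" for v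
    using A(3) B(3) by (auto intro: square_integrable_inner)
  have Y: "?Y q \<in> borel_measurable F" "square_integrable M (?Y q)" "?Z q \<in> borel_measurable F" "square_integrable M (?Z q)"
    if "q \<in> ?I" for q
    using that X_measurable X_square_integrable grid_nonneg by auto
  have intA: "integrable M (\<lambda>w. \<sigma> \<bullet> A w + (\<mu> \<bullet> A w)\<^sup>2)" and intB: "integrable M (\<lambda>w. \<sigma> \<bullet> B w + (\<mu> \<bullet> B w)\<^sup>2)"
    using square_integrable_integrable[OF sq(1), of \<sigma>] sq(1)[of \<mu>]
      square_integrable_integrable[OF sq(2), of \<sigma>] sq(2)[of \<mu>]
    by (simp_all add: square_integrable_def)
  have intAB: "integrable M (\<lambda>w. \<sigma> \<bullet> A w + (\<mu> \<bullet> A w) * (\<mu> \<bullet> B w))"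
    by (intro Bochner_Integration.integrable_add square_integrable_integrable[OF sq(1)] square_integrable_mult[OF sq(1) sq(2)])
  have intY: "integrable M (\<lambda>w. \<integral>\<eta>. (?Y (?Q w) \<eta>)\<^sup>2 \<partial>M)"
    using intA by (simp add: second nn)
  have intZ: "integrable M (\<lambda>w. \<integral>\<eta>. (?Z (?Q w) \<eta>)\<^sup>2 \<partial>M)"
    using intB by (simp add: second nn)
  have "square_integrable M (\<lambda>w. ?Y (?Q w) w)"
    by (rule square_integrable_countable_mixture(1)[OF indep space_G space_F cnt Q Y(1,2) intY])
  then show "square_integrable M (\<lambda>w. X (A w) w)" by simp
  have "(LINT w|M. ?Y (?Q w) w * ?Z (?Q w) w) = (LINT w|M. (\<integral>\<eta>. ?Y (?Q w) \<eta> * ?Z (?Q w) \<eta> \<partial>M))"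
    by (rule integral_mult_countable_mixture[OF indep space_G space_F cnt Q Y intY intZ])
      (use intAB in \<open>simp_all add: X_mixed_moment nn le\<close>)
  then show "(LINT w|M. X (A w) w * X (B w) w) = (LINT w|M. \<sigma> \<bullet> A w + (\<mu> \<bullet> A w) * (\<mu> \<bullet> B w))"
    by (simp add: X_mixed_moment nn le)
  \<comment> \<open>The mean is obtained as a mixed moment whose second field is the constant
    1.\<close>
  have "(LINT w|M. ?Y (?Q w) w * (\<lambda>_ _. 1) (?Q w) w) = (LINT w|M. (\<integral>\<eta>. ?Y (?Q w) \<eta> * (\<lambda>_ _. 1) (?Q w) \<eta> \<partial>M))"
    by (rule integral_mult_countable_mixture[OF indep space_G space_F cnt Q Y(1,2) _ _ intY])
      (use square_integrable_integrable[OF sq(1)] in \<open>simp_all add: X_expectation nn square_integrable_const\<close>)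
  then show "(LINT w|M. X (A w) w) = (LINT w|M. \<mu> \<bullet> A w)"
    by (simp add: X_expectation nn)
qed

end

section \<open>Rounding of random times to dyadic points from above\<close>

lemma (in complete_measure) borel_measurable_AE_cong:
  fixes f g :: "'a \<Rightarrow> real"
  assumes g: "g \<in> borel_measurable M" and ae: "AE x in M. g x = f x"
  shows "f \<in> borel_measurable M"
proof (rule measurableI)
  fix S :: "real set" assume S: "S \<in> sets borel"
  show "f -` S \<inter> space M \<in> sets M"
  proof (rule in_sets_AE)
    show "g -` S \<inter> space M \<in> sets M" using g S by (rule measurable_sets)
    show "AE x in M. (x \<in> g -` S \<inter> space M) = (x \<in> f -` S \<inter> space M)"
      using ae by eventually_elim auto
  qed auto
qed simp

text \<open>In every coordinate the first multiple of \<open>1 / 2 ^ n\<close> strictly above.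
  Rounding upwards yields a decreasing sequence, the kind along which \<open>cadlag_path\<close>
  guarantees convergence to the value itself and not merely a limit.\<close>

definition upper_grid :: "nat \<Rightarrow> real ^ 'n \<Rightarrow> real ^ 'n" where
  "upper_grid n x = (\<chi> k. (of_int \<lfloor>2 ^ n * x $ k\<rfloor> + 1) / 2 ^ n)"

lemma upper_grid_bounds:
  "x $ k \<le> upper_grid n x $ k" "upper_grid n x $ k \<le> x $ k + 1 / 2 ^ n"
proof -
  have "2 ^ n * x $ k \<le> of_int \<lfloor>2 ^ n * x $ k\<rfloor> + 1" by linarith
  then show "x $ k \<le> upper_grid n x $ k"
    by (simp add: upper_grid_def field_simps)
  have "of_int \<lfloor>2 ^ n * x $ k\<rfloor> + 1 \<le> 2 ^ n * x $ k + 1" by linarith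
  then show "upper_grid n x $ k \<le> x $ k + 1 / 2 ^ n"
    by (simp add: upper_grid_def field_simps)
qed

lemma upper_grid_ge: "x \<le> upper_grid n x"
  by (simp add: less_eq_vec_def upper_grid_bounds)

lemma upper_grid_mono: "x \<le> y \<Longrightarrow> upper_grid n x \<le> upper_grid n y"
  by (auto simp: less_eq_vec_def upper_grid_def intro!: divide_right_mono floor_mono)

lemma decseq_upper_grid: "decseq (\<lambda>n. upper_grid n x)"
proof (rule decseq_SucI)
  fix n
  have *: "of_int \<lfloor>2 * y\<rfloor> + 1 \<le> 2 * (of_int \<lfloor>y\<rfloor> + 1 :: real)" for y :: real
  proof -
    have "\<lfloor>2 * y\<rfloor> \<le> 2 * \<lfloor>y\<rfloor> + 1" by linarith
    then have "\<lfloor>2 * y\<rfloor> + 1 \<le> 2 * (\<lfloor>y\<rfloor> + 1)" by simp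
    then have "of_int (\<lfloor>2 * y\<rfloor> + 1) \<le> (of_int (2 * (\<lfloor>y\<rfloor> + 1)) :: real)" by (simp only: of_int_le_iff)
    then show ?thesis by simp
  qed
  have "(of_int \<lfloor>2 ^ Suc n * x $ k\<rfloor> + 1) / 2 ^ Suc n \<le> (of_int \<lfloor>2 ^ n * x $ k\<rfloor> + 1 :: real) / 2 ^ n" for k
  proof -
    have "(of_int \<lfloor>2 ^ Suc n * x $ k\<rfloor> + 1) / 2 ^ Suc n \<le> 2 * (of_int \<lfloor>2 ^ n * x $ k\<rfloor> + 1 :: real) / 2 ^ Suc n"
      using *[of "2 ^ n * x $ k"] by (intro divide_right_mono) (simp_all add: mult.assoc)
    also have "2 * (of_int \<lfloor>2 ^ n * x $ k\<rfloor> + 1 :: real) / 2 ^ Suc n = (of_int \<lfloor>2 ^ n * x $ k\<rfloor> + 1) / 2 ^ n"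
      unfolding power_Suc by (rule mult_divide_mult_cancel_left) simp
    finally show ?thesis .
  qed
  then show "upper_grid (Suc n) x \<le> upper_grid n x"
    by (simp add: less_eq_vec_def upper_grid_def)
qed

lemma upper_grid_LIMSEQ: "(\<lambda>n. upper_grid n x) \<longlonglongrightarrow> x"
proof (rule vec_tendstoI)
  fix k
  have lim: "(\<lambda>n. x $ k + 1 / 2 ^ n) \<longlonglongrightarrow> x $ k" by real_asymp
  show "(\<lambda>n. upper_grid n x $ k) \<longlonglongrightarrow> x $ k"
    by (rule tendsto_sandwich[OF _ _ tendsto_const lim]) (simp_all add: upper_grid_bounds always_eventually)
qed

text \<open>\<open>y\<close> is \<open>x\<close> itself or a finer rounding of \<open>x\<close>;
  both uses occur below.\<close>

lemma inner_diff_upper_grid_le: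
  assumes "y \<le> upper_grid n x" "x \<le> y"
  shows "\<bar>v \<bullet> upper_grid n x - v \<bullet> y\<bar> \<le> (\<Sum>k\<in>UNIV. \<bar>v $ k\<bar>) / 2 ^ n"
proof -
  have "v \<bullet> upper_grid n x - v \<bullet> y = (\<Sum>k\<in>UNIV. v $ k * (upper_grid n x $ k - y $ k))"
    by (simp add: inner_vec_def sum_subtractf right_diff_distrib)
  also have "\<bar>\<dots>\<bar> \<le> (\<Sum>k\<in>UNIV. \<bar>v $ k * (upper_grid n x $ k - y $ k)\<bar>)"
    by (rule sum_abs)
  also have "\<dots> \<le> (\<Sum>k\<in>UNIV. \<bar>v $ k\<bar> * (1 / 2 ^ n))"
  proof (rule sum_mono)
    fix k
    have "0 \<le> upper_grid n x $ k - y $ k" "upper_grid n x $ k - y $ k \<le> 1 / 2 ^ n"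
      using assms upper_grid_bounds(2)[of n x k] unfolding less_eq_vec_def
      by (simp, smt (verit))
    then show "\<bar>v $ k * (upper_grid n x $ k - y $ k)\<bar> \<le> \<bar>v $ k\<bar> * (1 / 2 ^ n)"
      unfolding abs_mult by (intro mult_left_mono) auto
  qed
  finally show ?thesis by (simp add: sum_divide_distrib)
qed

context independent_levy_time
begin

lemma upper_grid_in_grid: "0 \<le> x \<Longrightarrow> upper_grid n x \<in> grid"
  by (auto simp: grid_def upper_grid_def less_eq_vec_def intro!: Rats_divide Rats_add)

context
  fixes A :: "'w \<Rightarrow> real ^ 'n"
  assumes A: "\<And>k. (\<lambda>w. A w $ k) \<in> borel_measurable G" "\<And>w. 0 \<le> A w" "\<And>k. square_integrable M (\<lambda>w. A w $ k)"
begin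

lemma upper_grid_measurable: "(\<lambda>w. upper_grid n (A w) $ k) \<in> borel_measurable G"
  unfolding upper_grid_def using A(1) by simp

lemma upper_grid_square_integrable: "square_integrable M (\<lambda>w. upper_grid n (A w) $ k)"
proof -
  have [measurable]: "(\<lambda>w. upper_grid n (A w) $ k) \<in> borel_measurable M" "(\<lambda>w. A w $ k) \<in> borel_measurable M"
    using upper_grid_measurable A(1) by (auto intro: G_measurable_imp)
  have "square_integrable M (\<lambda>w. upper_grid n (A w) $ k - A w $ k)"
    unfolding square_integrable_def
  proof (intro conjI integrable_const_bound)
    have "\<bar>upper_grid n (A w) $ k - A w $ k\<bar> \<le> 1" for w
    proof -
      have "1 / 2 ^ n \<le> (1 :: real)" by simp
      then show ?thesis
        using upper_grid_bounds(1)[of "A w" k n] upper_grid_bounds(2)[of n "A w" k] by linarith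
    qed
    then show "AE w in M. norm ((upper_grid n (A w) $ k - A w $ k)\<^sup>2) \<le> 1"
      by (simp add: abs_square_le_1)
  qed simp_all
  from square_integrable_add[OF this A(3)[of k]] show ?thesis by simp
qed

text \<open>For ordered times the second moment of the increment is the mean of
  \<open>\<sigma> \<bullet> (b - a) + (\<mu> \<bullet> (b - a))^2\<close>, and the two roundings
  differ by at most \<open>1 / 2 ^ n\<close> in each coordinate. The bound is uniform in
  \<open>m\<close>, as Fatou will require.\<close>

lemma upper_grid_time_increment:
  assumes nm: "n \<le> m"
  shows "(LINT w|M. (X (upper_grid n (A w)) w - X (upper_grid m (A w)) w)\<^sup>2)
    \<le> ((\<Sum>k\<in>UNIV. \<bar>\<sigma> $ k\<bar>) + (\<Sum>k\<in>UNIV. \<bar>\<mu> $ k\<bar>)\<^sup>2) / 2 ^ n"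
proof -
  define a where "a w = upper_grid m (A w)" for w
  define b where "b w = upper_grid n (A w)" for w
  let ?S = "\<Sum>k\<in>UNIV. \<bar>\<sigma> $ k\<bar>" and ?U = "\<Sum>k\<in>UNIV. \<bar>\<mu> $ k\<bar>"
  have ab: "a w \<le> b w" for w
    unfolding a_def b_def using decseq_upper_grid nm by (rule decseqD)
  have facts: "(\<lambda>w. a w $ k) \<in> borel_measurable G" "a w \<in> grid" "square_integrable M (\<lambda>w. a w $ k)"
    "(\<lambda>w. b w $ k) \<in> borel_measurable G" "b w \<in> grid" "square_integrable M (\<lambda>w. b w $ k)" for k w
    unfolding a_def b_def using upper_grid_measurable upper_grid_square_integrable upper_grid_in_grid[OF A(2)] by auto
  note mab = grid_time_moments[OF facts(1-3) facts(4-6) ab]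
  note maa = grid_time_moments[OF facts(1-3) facts(1-3) order_refl]
  note mbb = grid_time_moments[OF facts(4-6) facts(4-6) order_refl]
  have sq: "square_integrable M (\<lambda>w. v \<bullet> a w)" "square_integrable M (\<lambda>w. v \<bullet> b w)" for v
    using facts(3,6) by (auto intro: square_integrable_inner)
  note Xa = mab(1) and Xb = mbb(1)
  have int: "integrable M (\<lambda>w. \<sigma> \<bullet> a w + (\<mu> \<bullet> a w) * (\<mu> \<bullet> a w))" "integrable M (\<lambda>w. \<sigma> \<bullet> b w + (\<mu> \<bullet> b w) * (\<mu> \<bullet> b w))"
    "integrable M (\<lambda>w. \<sigma> \<bullet> a w + (\<mu> \<bullet> a w) * (\<mu> \<bullet> b w))"
    by (intro Bochner_Integration.integrable_add square_integrable_integrable[OF sq(1)] square_integrable_integrable[OF sq(2)]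
        square_integrable_mult[OF sq(1) sq(2)] square_integrable_mult[OF sq(1) sq(1)] square_integrable_mult[OF sq(2) sq(2)])+
  have "(LINT w|M. (X (b w) w - X (a w) w)\<^sup>2)
    = (LINT w|M. X (b w) w * X (b w) w - 2 * (X (a w) w * X (b w) w) + X (a w) w * X (a w) w)"
    by (intro Bochner_Integration.integral_cong) (auto simp: power2_eq_square algebra_simps)
  also have "\<dots> = (LINT w|M. X (b w) w * X (b w) w) - 2 * (LINT w|M. X (a w) w * X (b w) w)
     + (LINT w|M. X (a w) w * X (a w) w)"
    using square_integrable_mult[OF Xa Xa] square_integrable_mult[OF Xb Xb] square_integrable_mult[OF Xa Xb] by simp
  also have "\<dots> = (LINT w|M. \<sigma> \<bullet> b w + (\<mu> \<bullet> b w) * (\<mu> \<bullet> b w)) - 2 * (LINT w|M. \<sigma> \<bullet> a w + (\<mu> \<bullet> a w) * (\<mu> \<bullet> b w))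
     + (LINT w|M. \<sigma> \<bullet> a w + (\<mu> \<bullet> a w) * (\<mu> \<bullet> a w))"
    unfolding maa(3) mbb(3) mab(3) ..
  also have "\<dots> = (LINT w|M. (\<sigma> \<bullet> b w + (\<mu> \<bullet> b w) * (\<mu> \<bullet> b w)) - 2 * (\<sigma> \<bullet> a w + (\<mu> \<bullet> a w) * (\<mu> \<bullet> b w))
     + (\<sigma> \<bullet> a w + (\<mu> \<bullet> a w) * (\<mu> \<bullet> a w)))"
    by (simp only: Bochner_Integration.integral_add Bochner_Integration.integral_diff Bochner_Integration.integral_mult_right_zero
        Bochner_Integration.integrable_add Bochner_Integration.integrable_diff Bochner_Integration.integrable_mult_right int)
  also have "\<dots> \<le> (LINT w|M. (?S + ?U\<^sup>2) / 2 ^ n)"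
  proof (rule integral_mono)
    show "integrable M (\<lambda>w. (\<sigma> \<bullet> b w + (\<mu> \<bullet> b w) * (\<mu> \<bullet> b w)) - 2 * (\<sigma> \<bullet> a w + (\<mu> \<bullet> a w) * (\<mu> \<bullet> b w))
     + (\<sigma> \<bullet> a w + (\<mu> \<bullet> a w) * (\<mu> \<bullet> a w)))"
      by (intro Bochner_Integration.integrable_add Bochner_Integration.integrable_diff Bochner_Integration.integrable_mult_right int)
    fix w
    have d: "\<bar>v \<bullet> b w - v \<bullet> a w\<bar> \<le> (\<Sum>k\<in>UNIV. \<bar>v $ k\<bar>) / 2 ^ n" for v
      using inner_diff_upper_grid_le[of "a w" n "A w" v] ab[of w] upper_grid_ge[of "A w" m]
      by (simp add: a_def b_def)
    have U0: "0 \<le> ?U" by (intro sum_nonneg) simp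
    have "(\<mu> \<bullet> b w - \<mu> \<bullet> a w)\<^sup>2 \<le> (?U / 2 ^ n)\<^sup>2"
      using d[of \<mu>] by (rule power2_le_iff_abs_le[THEN iffD2, rotated]) (simp add: U0)
    also have "\<dots> \<le> ?U\<^sup>2 / 2 ^ n"
    proof -
      \<comment> \<open>\<open>1 / 4 ^ n\<close> is weakened to \<open>1 / 2 ^ n\<close>, so that
        both contributions share one rate.\<close>
      have "(2::real) ^ n \<le> (2 ^ n)\<^sup>2" by (simp add: power2_eq_square)
      then show ?thesis unfolding power_divide by (intro divide_left_mono) auto
    qed
    finally have "(\<mu> \<bullet> b w - \<mu> \<bullet> a w)\<^sup>2 \<le> ?U\<^sup>2 / 2 ^ n" .
    moreover have "(\<sigma> \<bullet> b w + (\<mu> \<bullet> b w) * (\<mu> \<bullet> b w)) - 2 * (\<sigma> \<bullet> a w + (\<mu> \<bullet> a w) * (\<mu> \<bullet> b w))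
     + (\<sigma> \<bullet> a w + (\<mu> \<bullet> a w) * (\<mu> \<bullet> a w)) = (\<sigma> \<bullet> b w - \<sigma> \<bullet> a w) + (\<mu> \<bullet> b w - \<mu> \<bullet> a w)\<^sup>2"
      by (simp add: power2_eq_square algebra_simps)
    ultimately show "(\<sigma> \<bullet> b w + (\<mu> \<bullet> b w) * (\<mu> \<bullet> b w)) - 2 * (\<sigma> \<bullet> a w + (\<mu> \<bullet> a w) * (\<mu> \<bullet> b w))
     + (\<sigma> \<bullet> a w + (\<mu> \<bullet> a w) * (\<mu> \<bullet> a w)) \<le> (?S + ?U\<^sup>2) / 2 ^ n"
      using d[of \<sigma>] by (simp add: add_divide_distrib abs_le_iff)
  qed simp
  also have "\<dots> = (?S + ?U\<^sup>2) / 2 ^ n" by (simp add: prob_space)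
  finally show ?thesis by (simp add: a_def b_def)
qed

lemma upper_grid_time_LIMSEQ_AE: "AE w in M. (\<lambda>n. X (upper_grid n (A w)) w) \<longlonglongrightarrow> X (A w) w"
  using X_cadlag
proof eventually_elim
  case (elim w)
  have nn: "\<forall>n. 0 \<le> upper_grid n (A w)"
    using order_trans[OF A(2) upper_grid_ge] by blast
  have imp: "(\<forall>n. 0 \<le> u n) \<and> decseq u \<and> u \<longlonglongrightarrow> A w \<longrightarrow> (\<lambda>n. X (u n) w) \<longlonglongrightarrow> X (A w) w" for u
    by (rule elim[unfolded cadlag_path_def, THEN conjunct1, THEN spec, THEN spec])
  show ?case
    by (rule imp[THEN mp]) (intro conjI nn decseq_upper_grid upper_grid_LIMSEQ)
qed

lemma upper_grid_time_square_integrable: "square_integrable M (\<lambda>w. X (upper_grid n (A w)) w)"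
  by (rule grid_time_moments(1)[OF upper_grid_measurable upper_grid_in_grid[OF A(2)] upper_grid_square_integrable
        upper_grid_measurable upper_grid_in_grid[OF A(2)] upper_grid_square_integrable order_refl])

text \<open>The field at the random time is an almost sure limit of random variables, and
  completeness of \<open>M\<close> makes it one as well.\<close>

lemma time_measurable: "(\<lambda>w. X (A w) w) \<in> borel_measurable M"
proof (rule borel_measurable_AE_cong)
  show "(\<lambda>w. lim (\<lambda>n. X (upper_grid n (A w)) w)) \<in> borel_measurable M"
    using upper_grid_time_square_integrable by (intro borel_measurable_lim_metric) (simp add: square_integrable_def)
  show "AE w in M. lim (\<lambda>n. X (upper_grid n (A w)) w) = X (A w) w"
    using upper_grid_time_LIMSEQ_AE by eventually_elim (rule limI)
qed

text \<open>Fatou in the finer index \<open>m\<close> turns the uniform increment bound into a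
  distance to the limit, of order \<open>1 / 2 ^ n\<close>. Square integrability of the limit
  follows by subtracting that difference from a rounded version.\<close>

lemma upper_grid_time_L2:
  "square_integrable M (\<lambda>w. X (A w) w)"
  "(\<lambda>n. \<integral>w. (X (upper_grid n (A w)) w - X (A w) w)\<^sup>2 \<partial>M) \<longlonglongrightarrow> 0"
proof -
  let ?K = "(\<Sum>k\<in>UNIV. \<bar>\<sigma> $ k\<bar>) + (\<Sum>k\<in>UNIV. \<bar>\<mu> $ k\<bar>)\<^sup>2"
  let ?Xn = "\<lambda>n w. X (upper_grid n (A w)) w"
  have [measurable]: "(\<lambda>w. X (A w) w) \<in> borel_measurable M" by (rule time_measurable)
  have sqn: "square_integrable M (?Xn n)" for n by (rule upper_grid_time_square_integrable)
  have [measurable]: "?Xn n \<in> borel_measurable M" for n using sqn by (simp add: square_integrable_def)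
  have nn: "(\<integral>\<^sup>+w. ennreal ((?Xn n w - X (A w) w)\<^sup>2) \<partial>M) \<le> ennreal (?K / 2 ^ n)" for n
  proof -
    have "(\<integral>\<^sup>+w. ennreal ((?Xn n w - X (A w) w)\<^sup>2) \<partial>M)
        = (\<integral>\<^sup>+w. liminf (\<lambda>m. ennreal ((?Xn n w - ?Xn m w)\<^sup>2)) \<partial>M)"
    proof (rule nn_integral_cong_AE)
      show "AE w in M. ennreal ((?Xn n w - X (A w) w)\<^sup>2) = liminf (\<lambda>m. ennreal ((?Xn n w - ?Xn m w)\<^sup>2))"
        using upper_grid_time_LIMSEQ_AE
      proof eventually_elim
        case (elim w)
        then have "(\<lambda>m. ennreal ((?Xn n w - ?Xn m w)\<^sup>2)) \<longlonglongrightarrow> ennreal ((?Xn n w - X (A w) w)\<^sup>2)"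
          by (intro tendsto_ennrealI tendsto_power tendsto_diff tendsto_const)
        then show ?case by (intro lim_imp_Liminf[symmetric]) auto
      qed
    qed
    also have "\<dots> \<le> liminf (\<lambda>m. \<integral>\<^sup>+w. ennreal ((?Xn n w - ?Xn m w)\<^sup>2) \<partial>M)"
      by (intro nn_integral_liminf) measurable
    also have "\<dots> \<le> ennreal (?K / 2 ^ n)"
    proof (rule Liminf_le)
      show "\<forall>\<^sub>F m in sequentially. (\<integral>\<^sup>+w. ennreal ((?Xn n w - ?Xn m w)\<^sup>2) \<partial>M) \<le> ennreal (?K / 2 ^ n)"
        using eventually_ge_at_top[of n]
      proof eventually_elim
        case (elim m)
        have "integrable M (\<lambda>w. (?Xn n w - ?Xn m w)\<^sup>2)"
          using square_integrable_diff[OF sqn sqn] by (simp add: square_integrable_def)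
        then have "(\<integral>\<^sup>+w. ennreal ((?Xn n w - ?Xn m w)\<^sup>2) \<partial>M) = ennreal (LINT w|M. (?Xn n w - ?Xn m w)\<^sup>2)"
          by (rule nn_integral_eq_integral) simp
        then show ?case using upper_grid_time_increment[OF elim] by (simp add: ennreal_leI)
      qed
    qed simp
    finally show ?thesis .
  qed
  have sqd: "square_integrable M (\<lambda>w. ?Xn n w - X (A w) w)" for n
    unfolding square_integrable_def
  proof
    show "integrable M (\<lambda>w. (?Xn n w - X (A w) w)\<^sup>2)"
      using nn[of n] by (intro integrableI_nonneg) (auto simp: top.not_eq_extremum intro: le_less_trans)
  qed measurable
  show sq: "square_integrable M (\<lambda>w. X (A w) w)"
    using square_integrable_diff[OF sqn sqd, of 0 0] by simp
  have le: "(LINT w|M. (?Xn n w - X (A w) w)\<^sup>2) \<le> ?K / 2 ^ n" for n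
  proof -
    have "integrable M (\<lambda>w. (?Xn n w - X (A w) w)\<^sup>2)"
      using sqd by (simp add: square_integrable_def)
    then have "ennreal (LINT w|M. (?Xn n w - X (A w) w)\<^sup>2) \<le> ennreal (?K / 2 ^ n)"
      using nn[of n] by (subst nn_integral_eq_integral[symmetric]) simp_all
    moreover have "0 \<le> ?K / 2 ^ n" by (intro divide_nonneg_nonneg add_nonneg_nonneg sum_nonneg) auto
    ultimately show ?thesis by (subst (asm) ennreal_le_iff) auto
  qed
  have "(\<lambda>n. ?K / 2 ^ n) \<longlonglongrightarrow> 0" by (rule LIMSEQ_divide_realpow_zero) simp
  then show "(\<lambda>n. \<integral>w. (?Xn n w - X (A w) w)\<^sup>2 \<partial>M) \<longlonglongrightarrow> 0"
    by (rule tendsto_sandwich[OF _ _ tendsto_const, rotated 2]) (simp_all add: le)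
qed

lemma upper_grid_inner_L2:
  "square_integrable M (\<lambda>w. v \<bullet> upper_grid n (A w))"
  "(\<lambda>n. \<integral>w. (v \<bullet> upper_grid n (A w) - v \<bullet> A w)\<^sup>2 \<partial>M) \<longlonglongrightarrow> 0"
proof -
  show sq: "square_integrable M (\<lambda>w. v \<bullet> upper_grid n (A w))" for n
    by (rule square_integrable_inner[OF upper_grid_square_integrable])
  let ?V = "\<Sum>k\<in>UNIV. \<bar>v $ k\<bar>"
  have V: "0 \<le> ?V / 2 ^ n" for n by (intro divide_nonneg_nonneg sum_nonneg) auto
  have le: "(LINT w|M. (v \<bullet> upper_grid n (A w) - v \<bullet> A w)\<^sup>2) \<le> (?V / 2 ^ n)\<^sup>2" for n
  proof -
    have "(v \<bullet> upper_grid n (A w) - v \<bullet> A w)\<^sup>2 \<le> (?V / 2 ^ n)\<^sup>2" for w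
      using inner_diff_upper_grid_le[OF upper_grid_ge order_refl, of v n "A w"]
      by (rule power2_le_iff_abs_le[THEN iffD2, rotated]) (rule V)
    moreover have "integrable M (\<lambda>w. (v \<bullet> upper_grid n (A w) - v \<bullet> A w)\<^sup>2)"
      using square_integrable_diff[OF sq square_integrable_inner[OF A(3)]] by (simp add: square_integrable_def)
    ultimately have "(LINT w|M. (v \<bullet> upper_grid n (A w) - v \<bullet> A w)\<^sup>2) \<le> (LINT w|M. (?V / 2 ^ n)\<^sup>2)"
      by (intro integral_mono) auto
    then show ?thesis by (simp add: prob_space)
  qed
  have "(\<lambda>n. ?V / 2 ^ n) \<longlonglongrightarrow> 0" by (rule LIMSEQ_divide_realpow_zero) simp
  from tendsto_power[OF this, of 2] have "(\<lambda>n. (?V / 2 ^ n)\<^sup>2) \<longlonglongrightarrow> 0" by simp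
  then show "(\<lambda>n. \<integral>w. (v \<bullet> upper_grid n (A w) - v \<bullet> A w)\<^sup>2 \<partial>M) \<longlonglongrightarrow> 0"
    by (rule tendsto_sandwich[OF _ _ tendsto_const, rotated 2]) (simp_all add: le)
qed

end

text \<open>At rounded times the identities are known, and both sides converge by
  \<open>L2_tendsto_integral_mult\<close>. Rounding is monotone, so the rounded \<open>A\<close>
  stays below the rounded \<open>B\<close> and the mixed moment formula remains applicable.\<close>

lemma random_time_moments:
  assumes A: "\<And>k. (\<lambda>w. A w $ k) \<in> borel_measurable G" "\<And>w. 0 \<le> A w" "\<And>k. square_integrable M (\<lambda>w. A w $ k)"
    and B: "\<And>k. (\<lambda>w. B w $ k) \<in> borel_measurable G" "\<And>k. square_integrable M (\<lambda>w. B w $ k)"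
    and le: "\<And>w. A w \<le> B w"
  shows "square_integrable M (\<lambda>w. X (A w) w)"
    and "(LINT w|M. X (A w) w) = (LINT w|M. \<mu> \<bullet> A w)"
    and "(LINT w|M. X (A w) w * X (B w) w) = (LINT w|M. \<sigma> \<bullet> A w) + (LINT w|M. (\<mu> \<bullet> A w) * (\<mu> \<bullet> B w))"
proof -
  have B0: "0 \<le> B w" for w using order_trans[OF A(2) le] .
  note B' = B(1) B0 B(2)
  note gA = upper_grid_measurable[OF A] upper_grid_in_grid[OF A(2)] upper_grid_square_integrable[OF A]
  note gB = upper_grid_measurable[OF B'] upper_grid_in_grid[OF B0] upper_grid_square_integrable[OF B']
  note XA = upper_grid_time_square_integrable[OF A] upper_grid_time_L2[OF A]
  note XB = upper_grid_time_square_integrable[OF B'] upper_grid_time_L2[OF B']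
  note one = square_integrable_const[of 1]
  have one_lim: "(\<lambda>n::nat. \<integral>w. ((1::real) - 1)\<^sup>2 \<partial>M) \<longlonglongrightarrow> 0" by simp
  note iA = square_integrable_inner[OF A(3)] and iB = square_integrable_inner[OF B(2)]
  show "square_integrable M (\<lambda>w. X (A w) w)" by (rule XA(2))
  have "(\<lambda>n. \<integral>w. X (upper_grid n (A w)) w * 1 \<partial>M) \<longlonglongrightarrow> (LINT w|M. X (A w) w * 1)"
    by (rule L2_tendsto_integral_mult[OF XA(1) XA(2) one one XA(3) one_lim])
  then have m1: "(\<lambda>n. \<integral>w. (\<mu> \<bullet> upper_grid n (A w)) * 1 \<partial>M) \<longlonglongrightarrow> (LINT w|M. X (A w) w * 1)"
    unfolding mult_1_right grid_time_moments(2)[OF gA gA order_refl] .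
  have mean: "(\<lambda>n. \<integral>w. (v \<bullet> upper_grid n (A w)) * 1 \<partial>M) \<longlonglongrightarrow> (LINT w|M. (v \<bullet> A w) * 1)" for v
    by (rule L2_tendsto_integral_mult[OF upper_grid_inner_L2(1)[OF A] iA one one upper_grid_inner_L2(2)[OF A] one_lim])
  from LIMSEQ_unique[OF m1 mean] show "(LINT w|M. X (A w) w) = (LINT w|M. \<mu> \<bullet> A w)" by simp
  have l1: "(\<lambda>n. \<integral>w. X (upper_grid n (A w)) w * X (upper_grid n (B w)) w \<partial>M) \<longlonglongrightarrow> (LINT w|M. X (A w) w * X (B w) w)"
    by (rule L2_tendsto_integral_mult[OF XA(1,2) XB(1,2) XA(3) XB(3)])
  have eq: "(LINT w|M. X (upper_grid n (A w)) w * X (upper_grid n (B w)) w)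
      = (LINT w|M. (\<sigma> \<bullet> upper_grid n (A w)) * 1) + (LINT w|M. (\<mu> \<bullet> upper_grid n (A w)) * (\<mu> \<bullet> upper_grid n (B w)))" for n
    unfolding grid_time_moments(3)[OF gA gB upper_grid_mono[OF le]] mult_1_right
    by (intro Bochner_Integration.integral_add square_integrable_integrable[OF upper_grid_inner_L2(1)[OF A]]
        square_integrable_mult[OF upper_grid_inner_L2(1)[OF A] upper_grid_inner_L2(1)[OF B']])
  have "(\<lambda>n. \<integral>w. (\<mu> \<bullet> upper_grid n (A w)) * (\<mu> \<bullet> upper_grid n (B w)) \<partial>M) \<longlonglongrightarrow> (LINT w|M. (\<mu> \<bullet> A w) * (\<mu> \<bullet> B w))"
    by (rule L2_tendsto_integral_mult[OF upper_grid_inner_L2(1)[OF A] iA upper_grid_inner_L2(1)[OF B'] iB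
          upper_grid_inner_L2(2)[OF A] upper_grid_inner_L2(2)[OF B']])
  from tendsto_add[OF mean[of \<sigma>] this]
  have "(\<lambda>n. \<integral>w. X (upper_grid n (A w)) w * X (upper_grid n (B w)) w \<partial>M) \<longlonglongrightarrow>
      (LINT w|M. (\<sigma> \<bullet> A w) * 1) + (LINT w|M. (\<mu> \<bullet> A w) * (\<mu> \<bullet> B w))"
    unfolding eq .
  from LIMSEQ_unique[OF l1 this]
  show "(LINT w|M. X (A w) w * X (B w) w) = (LINT w|M. \<sigma> \<bullet> A w) + (LINT w|M. (\<mu> \<bullet> A w) * (\<mu> \<bullet> B w))"
    by simp
qed

end

section \<open>Moments of Levy processes\<close>

lemma twice_differentiable_nearE:
  assumes "twice_differentiable_near f x"
  obtains U g where "open U" "x \<in> U" "\<And>y. y \<in> U \<Longrightarrow> (f has_vector_derivative g y) (at y)"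
    "g differentiable (at x)"
proof -
  obtain U where U: "open U" "x \<in> U" "f differentiable_on U"
      "(\<lambda>y. vector_derivative f (at y)) differentiable_on U"
    using assms unfolding twice_differentiable_near_def by blast
  show ?thesis
  proof
    show "open U" "x \<in> U" by fact+
    show "(f has_vector_derivative vector_derivative f (at y)) (at y)" if "y \<in> U" for y
      using U that by (metis at_within_open differentiable_on_def vector_derivative_works)
    show "(\<lambda>y. vector_derivative f (at y)) differentiable at x"
      using U by (metis at_within_open differentiable_on_def)
  qed
qed

text \<open>\<open>G\<close>, the real part of \<open>char M\<close>, has its maximum 1 at 0, so
  \<open>G' 0 = 0\<close>. Differentiability of \<open>G'\<close> at 0 bounds \<open>- G' h\<close>
  by a multiple of \<open>h\<close>, and the mean value theorem gives the quadratic bound for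
  \<open>square_integrable_of_char_bound\<close>. The mean results from comparing two expressions
  for the derivative at 0.\<close>

lemma (in real_distribution) moments_of_char_eq_exp:
  assumes psi: "twice_differentiable_near \<psi> 0" and char: "\<And>\<xi>. char M \<xi> = exp (of_real u * \<psi> \<xi>)"
  shows "integrable M (\<lambda>x. x\<^sup>2)"
    and "\<psi> 0 = 0 \<Longrightarrow> \<i> * of_real (\<integral>x. x \<partial>M) = of_real u * vector_derivative \<psi> (at 0)"
proof -
  obtain U g where U: "open U" "0 \<in> U" and g: "\<And>y. y \<in> U \<Longrightarrow> (\<psi> has_vector_derivative g y) (at y)"
    and gd: "g differentiable (at 0)"
    using twice_differentiable_nearE[OF psi] by blast
  have char_deriv: "(char M has_vector_derivative char M y * (of_real u * g y)) (at y)" if "y \<in> U" for y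
  proof -
    have "((\<lambda>\<xi>. exp (of_real u * \<psi> \<xi>)) has_vector_derivative (of_real u * g y) * exp (of_real u * \<psi> y)) (at y)"
      using field_vector_diff_chain_at[of "\<lambda>\<xi>. of_real u * \<psi> \<xi>" "of_real u * g y" y exp "exp (of_real u * \<psi> y)"]
        has_vector_derivative_mult_right[OF g[OF that], of "of_real u"]
      by (simp add: o_def DERIV_exp)
    then show ?thesis
      by (simp add: char[abs_def] mult.commute)
  qed
  define G where "G y = Re (char M y)" for y
  define G' where "G' y = Re (char M y * (of_real u * g y))" for y
  have G: "(G has_real_derivative G' y) (at y)" if "y \<in> U" for y
    using char_deriv[OF that] unfolding G_def[abs_def] G'_def
    by (simp add: has_vector_derivative_complex_iff)
  obtain e where e: "0 < e" "ball 0 e \<subseteq> U"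
    using U by (meson openE)
  have G0: "G 0 = 1" by (simp add: G_def char_zero)
  have Gle: "G y \<le> 1" for y
    using cmod_char_le_1[of y] complex_Re_le_cmod[of "char M y"] by (simp add: G_def)
  have G'0: "G' 0 = 0"
    by (rule DERIV_local_max[OF G[OF U(2)] e(1)]) (simp add: G0 Gle)
  have "char M differentiable (at 0)"
    using char_deriv[OF U(2)] by (rule differentiableI_vector)
  then have "(\<lambda>y. char M y * (of_real u * g y)) differentiable (at 0)"
    using gd by (intro differentiable_mult differentiable_const)
  then obtain D where "((\<lambda>y. char M y * (of_real u * g y)) has_vector_derivative D) (at 0)"
    by (meson vector_derivative_works)
  then have "(G' has_real_derivative Re D) (at 0)"
    unfolding G'_def[abs_def] by (simp add: has_vector_derivative_complex_iff)
  then have "(\<lambda>h. (G' (0 + h) - G' 0) / h) \<midarrow>0\<rightarrow> Re D"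
    by (rule DERIV_D)
  then have "\<forall>\<^sub>F h in at 0. dist ((G' (0 + h) - G' 0) / h) (Re D) < 1"
    by (rule tendstoD) simp
  then obtain d where d: "0 < d" "\<And>h. h \<noteq> 0 \<Longrightarrow> \<bar>h\<bar> < d \<Longrightarrow> \<bar>G' h / h - Re D\<bar> < 1"
    unfolding eventually_at by (auto simp: G'0 dist_real_def)
  \<comment> \<open>The summand 1 is the tolerance in the limit of \<open>G' h / h\<close>.\<close>
  define C where "C = \<bar>Re D\<bar> + 1"
  have G'_bound: "- G' h \<le> C * h" if "0 < h" "h < d" for h
  proof -
    have "- (G' h / h) \<le> C"
      using d(2)[of h] that unfolding C_def by linarith
    then show ?thesis using that by (simp add: field_simps)
  qed
  show sq: "integrable M (\<lambda>x. x\<^sup>2)"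
  proof (rule square_integrable_of_char_bound)
    show "0 < min d e" using d e by simp
    fix h assume h: "0 < h" "h < min d e"
    have "\<exists>z>0. z < h \<and> G h - G 0 = (h - 0) * G' z"
      using h e(2) by (intro MVT2 G) (auto simp: subset_iff)
    then obtain z where z: "0 < z" "z < h" "G h - 1 = h * G' z"
      by (auto simp: G0)
    have "1 - G h = h * (- G' z)" using z by simp
    also have "\<dots> \<le> h * (C * h)"
    proof (intro mult_left_mono)
      have "- G' z \<le> C * z" using G'_bound[of z] z h by simp
      also have "\<dots> \<le> C * h" using z by (intro mult_left_mono) (auto simp: C_def)
      finally show "- G' z \<le> C * h" .
    qed (use h in simp)
    finally show "1 - Re (char M h) \<le> C * h\<^sup>2"
      by (simp add: G_def power2_eq_square mult_ac)
  qed
  assume "\<psi> 0 = 0"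
  have "\<i> * of_real (\<integral>x. x \<partial>M) = char M 0 * (of_real u * g 0)"
    using vector_derivative_unique_at[OF char_has_vector_derivative_at_0[OF sq] char_deriv[OF U(2)]] .
  then show "\<i> * of_real (\<integral>x. x \<partial>M) = of_real u * vector_derivative \<psi> (at 0)"
    using vector_derivative_at[OF g[OF U(2)]] by (simp add: char_zero)
qed

text \<open>\<open>u = 1\<close> forces \<open>Re z = 0\<close>. At \<open>u = 1 / |Im z|\<close>
  the exponent would have modulus 1, while the nonzero solutions of \<open>exp w = 1\<close> on the
  imaginary axis have modulus above 6. Ranging over all \<open>u\<close> removes the ambiguity of
  the complex logarithm in the exponents.\<close>

lemma exp_scaled_eq_1_imp_0:
  fixes z :: complex
  assumes "\<And>u. 0 \<le> u \<Longrightarrow> exp (of_real u * z) = 1"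
  shows "z = 0"
proof (rule complex_eqI)
  have Re: "Re z = 0"
    using assms[of 1] by (simp add: exp_eq_1)
  show "Re z = Re 0" using Re by simp
  show "Im z = Im 0"
  proof (rule ccontr)
    assume "Im z \<noteq> Im 0"
    then have y: "Im z \<noteq> 0" by simp
    obtain n :: int where n: "(1 / \<bar>Im z\<bar>) * Im z = of_int (2 * n) * pi"
      using assms[of "1 / \<bar>Im z\<bar>"] unfolding exp_eq_1 by auto
    then have "\<bar>of_int (2 * n) * pi\<bar> = \<bar>(1 / \<bar>Im z\<bar>) * Im z\<bar>" by simp
    then have 1: "2 * \<bar>of_int n\<bar> * pi = 1"
      using y by (simp add: abs_mult)
    then have "n \<noteq> 0" by auto
    then have "1 \<le> \<bar>real_of_int n\<bar>" by linarith
    then have "2 * 1 * 3 \<le> 2 * \<bar>real_of_int n\<bar> * pi"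
      using pi_gt3 by (intro mult_mono) auto
    with 1 show False by simp
  qed
qed

context
  fixes M :: "'w measure" and X :: "real ^ 'n \<Rightarrow> 'w \<Rightarrow> real" and \<psi> :: "'n \<Rightarrow> real \<Rightarrow> complex"
    and \<mu> :: "real ^ 'n"
  assumes P: "prob_space M" and X: "levy_process M X" and psi: "levy_exponent M X \<psi>"
    and diff: "\<And>j. twice_differentiable_near (\<psi> j) 0" and nz: "\<And>j. deriv2 (\<psi> j) 0 \<noteq> 0"
    and mu: "\<And>j. \<mu> $ j = prob_space.expectation M (X (axis j 1))"
begin

interpretation prob_space M by (rule P)

lemma axis_scale_nonneg: "0 \<le> u \<Longrightarrow> 0 \<le> u *\<^sub>R (axis j 1 :: real ^ 'n)"
  by (simp add: less_eq_vec_def axis_def)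

lemma axis_process_measurable [measurable]:
  "0 \<le> u \<Longrightarrow> X (u *\<^sub>R axis j 1) \<in> borel_measurable M"
  by (intro levy_process_measurable[OF X] axis_scale_nonneg)

lemma axis_char:
  "0 \<le> u \<Longrightarrow> char (distr M borel (X (u *\<^sub>R axis j 1))) \<xi> = exp (of_real u * \<psi> j \<xi>)"
  using psi unfolding levy_exponent_def by blast

lemma axis_real_distribution:
  "0 \<le> u \<Longrightarrow> real_distribution (distr M borel (X (u *\<^sub>R axis j 1)))"
  by (rule real_distribution_distr) measurable

lemma exponent_0: "\<psi> j 0 = 0"
proof (rule exp_scaled_eq_1_imp_0)
  show "exp (of_real u * \<psi> j 0) = 1" if "0 \<le> u" for u
    unfolding axis_char[OF that, symmetric]
    by (rule real_distribution.char_zero[OF axis_real_distribution[OF that]])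
qed

lemma axis_square_integrable:
  assumes u: "0 \<le> u"
  shows "square_integrable M (X (u *\<^sub>R axis j 1))"
proof -
  have "integrable (distr M borel (X (u *\<^sub>R axis j 1))) (\<lambda>x. x\<^sup>2)"
    using real_distribution.moments_of_char_eq_exp(1)[OF axis_real_distribution[OF u] diff axis_char[OF u]] .
  then show ?thesis
    using u by (simp add: integrable_distr_eq square_integrable_def)
qed

lemma axis_expectation:
  assumes u: "0 \<le> u"
  shows "(LINT w|M. X (u *\<^sub>R axis j 1) w) = u * \<mu> $ j"
proof -
  have *: "\<i> * of_real (LINT w|M. X (h *\<^sub>R axis j 1) w) = of_real h * vector_derivative (\<psi> j) (at 0)"
    if h: "0 \<le> h" for h
    using real_distribution.moments_of_char_eq_exp(2)[OF axis_real_distribution[OF h] diff axis_char[OF h] exponent_0]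
      h by (simp add: integral_distr)
  have "\<i> * of_real (LINT w|M. X (u *\<^sub>R axis j 1) w) = \<i> * of_real (u * \<mu> $ j)"
    using *[OF u] *[of 1] by (simp add: mu mult_ac)
  then show ?thesis
    by (simp only: mult_cancel_left of_real_eq_iff) simp
qed

text \<open>Independent stationary increments make the variance along an axis additive in
  \<open>u\<close>, and nonnegativity then makes it linear.\<close>

lemma axis_variance_linear:
  assumes u: "0 \<le> u"
  shows "(LINT w|M. (X (u *\<^sub>R axis j 1) w)\<^sup>2) = u * variance (X (axis j 1)) + (u * \<mu> $ j)\<^sup>2"
proof -
  define v where "v h = variance (X (h *\<^sub>R axis j 1))" for h
  have v_eq: "v h = (LINT w|M. (X (h *\<^sub>R axis j 1) w)\<^sup>2) - (h * \<mu> $ j)\<^sup>2" if "0 \<le> h" for h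
  proof -
    have sq: "square_integrable M (X (h *\<^sub>R axis j 1))" by (rule axis_square_integrable[OF that])
    then have "integrable M (\<lambda>w. (X (h *\<^sub>R axis j 1) w)\<^sup>2)" by (simp add: square_integrable_def)
    from variance_eq[OF square_integrable_integrable[OF sq] this]
    show ?thesis unfolding v_def axis_expectation[OF that] .
  qed
  have "v u = u * v 1"
  proof (rule additive_nonneg_imp_linear[OF _ _ u])
    show "0 \<le> v h" for h by (simp add: v_def)
    fix a b :: real assume ab: "0 \<le> a" "0 \<le> b"
    let ?e = "axis j 1 :: real ^ 'n"
    have le: "a *\<^sub>R ?e \<le> (a + b) *\<^sub>R ?e" and d: "(a + b) *\<^sub>R ?e - a *\<^sub>R ?e = b *\<^sub>R ?e"
      using ab by (simp_all add: less_eq_vec_def axis_def scaleR_add_left)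
    have "(LINT w|M. (X ((a + b) *\<^sub>R ?e) w)\<^sup>2) = (LINT w|M. (X (a *\<^sub>R ?e) w)\<^sup>2)
        + 2 * ((a * \<mu> $ j) * (b * \<mu> $ j)) + (LINT w|M. (X (b *\<^sub>R ?e) w)\<^sup>2)"
      using levy_process_moments_add(4)[OF P X axis_scale_nonneg le axis_square_integrable, unfolded d,
          OF ab(1) ab(1) axis_square_integrable[OF ab(2)]]
      by (simp add: axis_expectation ab)
    then show "v (a + b) = v a + v b"
      using ab by (simp add: v_eq power2_eq_square algebra_simps)
  qed
  then show ?thesis
    using v_eq[OF u] by (simp add: v_def)
qed

text \<open>A vanishing variance reduces the process along this axis to the drift
  \<open>u * \<mu> $ j\<close>. The exponent is then the linear function
  \<open>\<i> * \<mu> $ j * \<xi>\<close>, whose second derivative is 0.\<close>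

lemma axis_variance_pos: "0 < variance (X (axis j 1))"
proof (rule ccontr)
  assume "\<not> 0 < variance (X (axis j 1))"
  moreover have "0 \<le> variance (X (axis j 1))" by simp
  ultimately have v0: "variance (X (axis j 1)) = 0" by simp
  have "\<psi> j \<xi> = of_real \<xi> * (\<i> * of_real (\<mu> $ j))" for \<xi>
  proof -
    have "exp (of_real u * (\<psi> j \<xi> - of_real \<xi> * (\<i> * of_real (\<mu> $ j)))) = 1" if u: "0 \<le> u" for u
    proof -
      let ?Y = "X (u *\<^sub>R axis j 1)"
      have sq: "square_integrable M ?Y" by (rule axis_square_integrable[OF u])
      have "(LINT w|M. (?Y w - u * \<mu> $ j)\<^sup>2) = 0"
        using variance_eq[of ?Y] sq square_integrable_integrable[OF sq] axis_variance_linear[OF u, of j] v0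
        by (simp add: axis_expectation[OF u] square_integrable_def)
      moreover have "integrable M (\<lambda>w. (?Y w - u * \<mu> $ j)\<^sup>2)"
        using square_integrable_diff[OF sq square_integrable_const] by (simp add: square_integrable_def)
      ultimately have ae: "AE w in M. ?Y w = u * \<mu> $ j"
        by (subst (asm) integral_nonneg_eq_0_iff_AE) auto
      have "exp (of_real u * \<psi> j \<xi>) = (LINT w|M. iexp (\<xi> * ?Y w))"
        using u by (subst axis_char[symmetric]) (auto simp: char_def integral_distr)
      also have "\<dots> = (LINT w|M. iexp (\<xi> * (u * \<mu> $ j)))"
        using ae u by (intro integral_cong_AE) auto
      also have "\<dots> = exp (of_real u * (of_real \<xi> * (\<i> * of_real (\<mu> $ j))))"
        using prob_space by (simp add: mult_ac)
      finally show ?thesis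
        by (simp add: right_diff_distrib exp_diff)
    qed
    then have "\<psi> j \<xi> - of_real \<xi> * (\<i> * of_real (\<mu> $ j)) = 0"
      by (rule exp_scaled_eq_1_imp_0)
    then show ?thesis by simp
  qed
  then have "\<psi> j = (\<lambda>\<xi>. \<xi> *\<^sub>R (\<i> * of_real (\<mu> $ j)))"
    by (simp add: fun_eq_iff scaleR_conv_of_real)
  moreover have "((\<lambda>\<xi>::real. \<xi> *\<^sub>R z) has_vector_derivative z) (at y)" for z :: complex and y
    by (auto intro!: derivative_eq_intros)
  ultimately have "vector_derivative (\<psi> j) (at y) = \<i> * of_real (\<mu> $ j)" for y
    by (simp add: vector_derivative_at)
  then have "deriv2 (\<psi> j) 0 = 0"
    by (simp add: deriv2_def)
  with nz[of j] show False by simp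
qed

definition axis_variances :: "real ^ 'n" where
  "axis_variances = (\<chi> j. variance (X (axis j 1)))"

lemma axis_variances_pos: "0 < axis_variances $ j"
  by (simp add: axis_variances_def axis_variance_pos)

text \<open>\<open>t\<close> is reached one axis at a time: \<open>r J\<close> keeps the coordinates
  in \<open>J\<close>, and enlarging \<open>J\<close> by \<open>j\<close> adds an increment
  distributed as \<open>X (t $ j *\<^sub>R axis j 1)\<close>.\<close>

lemma levy_process_moments:
  assumes t: "0 \<le> t"
  shows "square_integrable M (X t)"
    and "(LINT w|M. X t w) = \<mu> \<bullet> t"
    and "(LINT w|M. (X t w)\<^sup>2) = axis_variances \<bullet> t + (\<mu> \<bullet> t)\<^sup>2"
proof -
  define r where "r J = (\<chi> k. if k \<in> J then t $ k else 0)" for J :: "'n set"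
  have tk: "0 \<le> t $ k" for k using t by (simp add: less_eq_vec_def)
  have "square_integrable M (X (r J)) \<and> (LINT w|M. X (r J) w) = \<mu> \<bullet> r J \<and>
     (LINT w|M. (X (r J) w)\<^sup>2) = axis_variances \<bullet> r J + (\<mu> \<bullet> r J)\<^sup>2" if "finite J" for J
    using that
  proof induction
    case empty
    have r0: "r {} = 0" by (simp add: r_def vec_eq_iff)
    have [measurable]: "X 0 \<in> borel_measurable M" by (simp add: levy_process_measurable[OF X])
    have ae: "AE w in M. X 0 w = 0" by (rule levy_process_0_AE[OF X])
    have "square_integrable M (X 0)"
      using square_integrable_const[of 0] by (rule square_integrable_cong_AE) (use ae in auto)
    moreover have "(LINT w|M. X 0 w) = (LINT w|M. 0)"
      using ae by (intro integral_cong_AE) auto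
    moreover have "(LINT w|M. (X 0 w)\<^sup>2) = (LINT w|M. 0)"
      using ae by (intro integral_cong_AE) auto
    ultimately show ?case unfolding r0 by simp
  next
    case (insert j J)
    let ?e = "axis j 1 :: real ^ 'n"
    have r: "0 \<le> r J" "r J \<le> r (insert j J)" and d: "r (insert j J) - r J = (t $ j) *\<^sub>R ?e"
      using insert.hyps tk by (auto simp: r_def less_eq_vec_def vec_eq_iff axis_def)
    have eq: "r (insert j J) = r J + (t $ j) *\<^sub>R ?e" using d by (simp add: algebra_simps)
    note IH = insert.IH
    note sq = axis_square_integrable[OF tk[of j], of j]
    note m = levy_process_moments_add[OF P X r, unfolded d, OF conjunct1[OF IH] sq]
    have in1: "\<mu> \<bullet> ?e = \<mu> $ j" and in2: "axis_variances \<bullet> ?e = variance (X ?e)"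
      by (auto simp: inner_axis axis_variances_def)
    show ?case
    proof (intro conjI)
      show "square_integrable M (X (r (insert j J)))" by (rule m(1))
      show "(LINT w|M. X (r (insert j J)) w) = \<mu> \<bullet> r (insert j J)"
        using m(2) IH by (simp add: axis_expectation[OF tk] eq inner_add_right in1)
      show "(LINT w|M. (X (r (insert j J)) w)\<^sup>2) = axis_variances \<bullet> r (insert j J) + (\<mu> \<bullet> r (insert j J))\<^sup>2"
      proof -
        have "(LINT w|M. (X (r (insert j J)) w)\<^sup>2) = axis_variances \<bullet> r J + (\<mu> \<bullet> r J)\<^sup>2
            + 2 * ((\<mu> \<bullet> r J) * (t $ j * \<mu> $ j)) + (t $ j * variance (X ?e) + (t $ j * \<mu> $ j)\<^sup>2)"
          using m(4) IH by (simp only: axis_expectation[OF tk] axis_variance_linear[OF tk])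
        then show ?thesis
          by (simp add: eq inner_add_right in1 in2 power2_sum)
      qed
    qed
  qed
  from this[of UNIV] have "square_integrable M (X (r UNIV)) \<and> (LINT w|M. X (r UNIV) w) = \<mu> \<bullet> r UNIV \<and>
     (LINT w|M. (X (r UNIV) w)\<^sup>2) = axis_variances \<bullet> r UNIV + (\<mu> \<bullet> r UNIV)\<^sup>2" by simp
  moreover have "r UNIV = t" by (simp add: r_def vec_eq_iff)
  ultimately show "square_integrable M (X t)"
    and "(LINT w|M. X t w) = \<mu> \<bullet> t"
    and "(LINT w|M. (X t w)\<^sup>2) = axis_variances \<bullet> t + (\<mu> \<bullet> t)\<^sup>2" by simp_all
qed

lemma levy_process_mixed_moment:
  assumes ab: "0 \<le> a" "a \<le> b"
  shows "(LINT w|M. X a w * X b w) = axis_variances \<bullet> a + (\<mu> \<bullet> a) * (\<mu> \<bullet> b)"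
proof -
  have d: "0 \<le> b - a" by (rule eucl_diff_nonneg[OF ab(2)])
  have "(LINT w|M. X a w * X b w) = axis_variances \<bullet> a + (\<mu> \<bullet> a)\<^sup>2 + (\<mu> \<bullet> a) * (\<mu> \<bullet> (b - a))"
    using levy_process_moments_add(3)[OF P X ab levy_process_moments(1)[OF ab(1)] levy_process_moments(1)[OF d]]
    by (simp only: levy_process_moments[OF ab(1)] levy_process_moments[OF d])
  then show ?thesis
    by (simp add: inner_diff_right power2_eq_square algebra_simps)
qed

end

section \<open>Covariance of the time-changed process\<close>

lemma process_sigma_eq_sets:
  "process_sigma M T Y = sets (sigma (space M) {Y t -` B \<inter> space M | t B. t \<in> T \<and> B \<in> sets borel})"
  unfolding process_sigma_def by (rule sets_measure_of[symmetric]) auto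

lemma process_sigma_subset: "process_sigma M T Y \<subseteq> Pow (space M)"
proof
  fix a assume "a \<in> process_sigma M T Y"
  then have "a \<subseteq> space M"
    unfolding process_sigma_def by (rule sigma_sets_into_sp[rotated]) auto
  then show "a \<in> Pow (space M)" by simp
qed

lemma Int_stable_process_sigma: "Int_stable (process_sigma M T Y)"
  unfolding process_sigma_eq_sets by (rule sets.Int_stable)

lemma process_sigma_measurable:
  assumes "process_sigma M T Y \<subseteq> sets N" "space N = space M" "t \<in> T"
  shows "Y t \<in> borel_measurable N"
proof (rule measurableI)
  fix B :: "real set" assume "B \<in> sets borel"
  then have "Y t -` B \<inter> space M \<in> process_sigma M T Y"
    unfolding process_sigma_def using assms(3) by (intro sigma_sets.Basic) blast
  then show "Y t -` B \<inter> space N \<in> sets N" using assms by auto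
qed simp

lemma (in prob_space) indep_var_of_indep_set:
  fixes Y Z :: "'a \<Rightarrow> real"
  assumes ind: "indep_set \<A> \<B>" and Y: "Y \<in> borel_measurable M" "\<And>S. S \<in> sets borel \<Longrightarrow> Y -` S \<inter> space M \<in> \<A>"
    and Z: "Z \<in> borel_measurable M" "\<And>S. S \<in> sets borel \<Longrightarrow> Z -` S \<inter> space M \<in> \<B>"
  shows "indep_var borel Y borel Z"
  unfolding indep_var_eq
proof (intro conjI Y(1) Z(1) indep_set_sigma_sets indep_setI)
  fix a b assume "a \<in> {Y -` A \<inter> space M |A. A \<in> sets borel}" "b \<in> {Z -` A \<inter> space M |A. A \<in> sets borel}"
  then show "prob (a \<inter> b) = prob a * prob b"
    using Y(2) Z(2) by (auto intro!: indep_setD[OF ind])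
next
  show "{Y -` A \<inter> space M |A. A \<in> sets borel} \<subseteq> events" "{Z -` A \<inter> space M |A. A \<in> sets borel} \<subseteq> events"
    using Y(1) Z(1) by auto
  show "Int_stable {Y -` A \<inter> space M |A. A \<in> sets borel}" "Int_stable {Z -` A \<inter> space M |A. A \<in> sets borel}"
    unfolding Int_stable_def
  proof safe
    fix S T :: "real set" assume "S \<in> sets borel" "T \<in> sets borel"
    then show "\<exists>C. Y -` S \<inter> space M \<inter> (Y -` T \<inter> space M) = Y -` C \<inter> space M \<and> C \<in> sets borel"
      and "\<exists>C. Z -` S \<inter> space M \<inter> (Z -` T \<inter> space M) = Z -` C \<inter> space M \<and> C \<in> sets borel"
      by (auto intro!: exI[of _ "S \<inter> T"])
  qed
qed

context
  fixes M :: "'w measure" and X :: "real ^ 'n \<Rightarrow> 'w \<Rightarrow> real" and L :: "'n \<Rightarrow> real \<Rightarrow> 'w \<Rightarrow> real"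
  assumes P: "prob_space M" and ind: "independent_processes M X L"
begin

interpretation prob_space M by (rule P)

lemma independent_processes_indep_sets:
  "indep_sets (case_option (process_sigma M {0..} X) (\<lambda>k. process_sigma M {0..} (L k))) UNIV"
  using ind unfolding independent_processes_def .

lemma independent_processes_time_events: "process_sigma M {0..} (L k) \<subseteq> events"
proof -
  have "\<forall>i\<in>UNIV. (case_option (process_sigma M {0..} X) (\<lambda>k. process_sigma M {0..} (L k))) i \<subseteq> events"
    using independent_processes_indep_sets unfolding indep_sets_def by blast
  from this[THEN bspec, of "Some k"] show ?thesis by simp
qed

lemma independent_processes_time_measurable: "0 \<le> u \<Longrightarrow> L k u \<in> borel_measurable M"
  by (rule process_sigma_measurable[OF independent_processes_time_events refl]) simp

lemma independent_processes_time_indep_var: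
  assumes "j \<noteq> k" "0 \<le> u" "0 \<le> v"
  shows "indep_var borel (L j u) borel (L k v)"
proof (rule indep_var_of_indep_set)
  show "indep_set (process_sigma M {0..} (L j)) (process_sigma M {0..} (L k))"
  proof (rule indep_setI)
    fix a b assume ab: "a \<in> process_sigma M {0..} (L j)" "b \<in> process_sigma M {0..} (L k)"
    define A where "A i = (if i = Some j then a else b)" for i
    have "prob (\<Inter>i\<in>{Some j, Some k}. A i) = (\<Prod>i\<in>{Some j, Some k}. prob (A i))"
      by (rule indep_setsD[OF independent_processes_indep_sets]) (use ab assms(1) in \<open>auto simp: A_def\<close>)
    then show "prob (a \<inter> b) = prob a * prob b" using assms(1) by (simp add: A_def Int_commute mult.commute)
  qed (rule independent_processes_time_events)+
  have "L i r -` S \<inter> space M \<in> process_sigma M {0..} (L i)" if "S \<in> sets borel" "0 \<le> r" for i r S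
    unfolding process_sigma_def using that by (intro sigma_sets.Basic) auto
  then show "\<And>S. S \<in> sets borel \<Longrightarrow> L j u -` S \<inter> space M \<in> process_sigma M {0..} (L j)"
    "\<And>S. S \<in> sets borel \<Longrightarrow> L k v -` S \<inter> space M \<in> process_sigma M {0..} (L k)"
    using assms by auto
qed (use assms independent_processes_time_measurable in auto)

text \<open>One sigma-algebra for all clocks: a random time vector mixes them, so conditioning on it
  uses independence of the field from the clocks jointly.\<close>

definition times_sigma :: "'w measure" where
  "times_sigma = sigma (space M) (\<Union>k. process_sigma M {0..} (L k))"

definition field_sigma :: "'w measure" where
  "field_sigma = sigma (space M) (process_sigma M {0..} X)"

lemma space_times_sigma: "space times_sigma = space M"
  unfolding times_sigma_def using process_sigma_subset by (intro space_measure_of) blast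

lemma space_field_sigma: "space field_sigma = space M"
  unfolding field_sigma_def using process_sigma_subset by (intro space_measure_of) blast

lemma sets_times_sigma: "sets times_sigma = sigma_sets (space M) (\<Union>k. process_sigma M {0..} (L k))"
  unfolding times_sigma_def using process_sigma_subset by (intro sets_measure_of) blast

lemma sets_field_sigma: "sets field_sigma = sigma_sets (space M) (process_sigma M {0..} X)"
  unfolding field_sigma_def using process_sigma_subset by (intro sets_measure_of) blast

text \<open>The index set splits into two blocks, the clocks under \<open>True\<close> and the field
  under \<open>False\<close>; independence passes to the sigma-algebras generated by disjoint blocks
  of Int-stable families.\<close>

lemma indep_times_field: "indep_set (sets times_sigma) (sets field_sigma)"
proof -
  let ?E = "case_option (process_sigma M {0..} X) (\<lambda>k. process_sigma M {0..} (L k))"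
  let ?I = "\<lambda>b. if b then range Some else {None}"
  have UN: "(\<Union>b\<in>UNIV. ?I b) = UNIV"
    by (auto simp: UNIV_bool) (metis option.exhaust rangeI)
  have "indep_sets (\<lambda>b. sigma_sets (space M) (\<Union>i\<in>?I b. ?E i)) UNIV"
  proof (rule indep_sets_collect_sigma)
    show "indep_sets ?E (\<Union>b\<in>UNIV. ?I b)" unfolding UN by (rule independent_processes_indep_sets)
    show "Int_stable (?E i)" for i by (cases i) (simp_all add: Int_stable_process_sigma)
    show "disjoint_family_on ?I UNIV" by (auto simp: disjoint_family_on_def)
  qed
  then show ?thesis
    unfolding indep_set_def
    by (rule indep_sets_cong[THEN iffD1, rotated 2])
      (auto simp: sets_times_sigma sets_field_sigma split: bool.split)
qed

lemma times_sigma_measurable: "0 \<le> u \<Longrightarrow> L k u \<in> borel_measurable times_sigma"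
  by (rule process_sigma_measurable[OF _ space_times_sigma, of "{0..}"]) (auto simp: sets_times_sigma)

lemma field_sigma_measurable: "0 \<le> t \<Longrightarrow> X t \<in> borel_measurable field_sigma"
  by (rule process_sigma_measurable[OF _ space_field_sigma, of "{0..}"]) (auto simp: sets_field_sigma)

end

lemma (in prob_space) covariance_eq:
  assumes Y: "square_integrable M Y" and Z: "square_integrable M Z"
  shows "covariance M Y Z = (LINT w|M. Y w * Z w) - (LINT w|M. Y w) * (LINT w|M. Z w)"
proof -
  let ?y = "\<integral>w. Y w \<partial>M" and ?z = "\<integral>w. Z w \<partial>M"
  have "covariance M Y Z = (LINT w|M. Y w * Z w - ?z * Y w - ?y * Z w + ?y * ?z)"
    unfolding covariance_def by (intro Bochner_Integration.integral_cong) (auto simp: algebra_simps)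
  also have "\<dots> = (LINT w|M. Y w * Z w) - ?z * ?y - ?y * ?z + ?y * ?z"
    using square_integrable_mult[OF Y Z] square_integrable_integrable[OF Y] square_integrable_integrable[OF Z]
    by (simp add: prob_space)
  finally show ?thesis by simp
qed

lemma (in prob_space) covariance_self: "covariance M Y Y = variance Y"
  by (simp add: covariance_def power2_eq_square)

text \<open>
  Off-diagonal pairs of clocks are independent, so in the covariance of \<open>\<mu> \<bullet> L\<close> at two times only the
  diagonal terms survive.
\<close>

lemma time_change_covariance:
  fixes M :: "'w measure" and X :: "real ^ 'n \<Rightarrow> 'w \<Rightarrow> real" and L :: "'n \<Rightarrow> real \<Rightarrow> 'w \<Rightarrow> real"
    and \<mu> \<sigma> s t :: "real ^ 'n"
  assumes "prob_space M" "complete_measure M"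
    and ind: "independent_processes M X L"
    and X_sq: "\<And>t. 0 \<le> t \<Longrightarrow> square_integrable M (X t)"
    and X_mean: "\<And>t. 0 \<le> t \<Longrightarrow> (LINT w|M. X t w) = \<mu> \<bullet> t"
    and X_mixed: "\<And>a b. 0 \<le> a \<Longrightarrow> a \<le> b \<Longrightarrow> (LINT w|M. X a w * X b w) = \<sigma> \<bullet> a + (\<mu> \<bullet> a) * (\<mu> \<bullet> b)"
    and X_cadlag: "AE w in M. cadlag_path (\<lambda>t. X t w)"
    and L_sq: "\<And>k u. 0 \<le> u \<Longrightarrow> square_integrable M (L k u)"
    and L_nonneg: "\<And>k u. 0 \<le> u \<Longrightarrow> AE w in M. 0 \<le> L k u w"
    and L_mono: "\<And>k u v. u \<le> v \<Longrightarrow> AE w in M. L k u w \<le> L k v w"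
    and s: "0 \<le> s" and st: "s \<le> t"
  shows "covariance M (time_change X L s) (time_change X L t) =
    (\<Sum>k\<in>UNIV. \<sigma> $ k * (LINT w|M. L k (s $ k) w)) +
    (\<Sum>k\<in>UNIV. (\<mu> $ k)\<^sup>2 * covariance M (L k (s $ k)) (L k (t $ k)))"
proof -
  interpret prob_space M by fact
  interpret complete_measure M by fact
  interpret independent_levy_time M "field_sigma M X" "times_sigma M L" X \<mu> \<sigma>
    by unfold_locales
      (use indep_times_field[OF \<open>prob_space M\<close> ind] space_times_sigma[OF \<open>prob_space M\<close> ind]
        space_field_sigma[OF \<open>prob_space M\<close> ind] field_sigma_measurable[OF \<open>prob_space M\<close> ind]
        X_sq X_mean X_mixed X_cadlag in \<open>simp_all only:\<close>)
  have sk: "0 \<le> s $ k" "s $ k \<le> t $ k" "0 \<le> t $ k" for k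
    using s st order_trans[OF s st] by (auto simp: less_eq_vec_def)
  \<comment> \<open>Versions of the clock vectors with \<open>0 \<le> A w\<close> and
    \<open>A w \<le> B w\<close> for every \<open>w\<close>, as \<open>random_time_moments\<close>
    demands. Clamping alters the clocks only on null sets and keeps them measurable for
    \<open>times_sigma M L\<close>.\<close>
  define A :: "'w \<Rightarrow> real ^ 'n" where "A w = (\<chi> k. max 0 (L k (s $ k) w))" for w
  define B :: "'w \<Rightarrow> real ^ 'n" where "B w = (\<chi> k. max (A w $ k) (L k (t $ k) w))" for w
  have AE_A: "AE w in M. \<forall>k\<in>UNIV. A w $ k = L k (s $ k) w"
  proof (rule AE_finite_allI)
    show "AE w in M. A w $ k = L k (s $ k) w" for k
      using L_nonneg[OF sk(1)[of k], of k] by eventually_elim (simp add: A_def)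
  qed simp
  have AE_B: "AE w in M. \<forall>k\<in>UNIV. B w $ k = L k (t $ k) w"
  proof (rule AE_finite_allI)
    show "AE w in M. B w $ k = L k (t $ k) w" for k
      using AE_A L_mono[OF sk(2)[of k], of k] by eventually_elim (simp add: B_def)
  qed simp
  have A_meas: "(\<lambda>w. A w $ k) \<in> borel_measurable (times_sigma M L)" for k
    using times_sigma_measurable[OF \<open>prob_space M\<close> ind sk(1)] by (simp add: A_def)
  have B_meas: "(\<lambda>w. B w $ k) \<in> borel_measurable (times_sigma M L)" for k
    using times_sigma_measurable[OF \<open>prob_space M\<close> ind sk(3)] A_meas by (simp add: B_def)
  have A_sq: "square_integrable M (\<lambda>w. A w $ k)" for k
    by (rule square_integrable_cong_AE[OF L_sq[OF sk(1)] G_measurable_imp[OF A_meas]]) (use AE_A in eventually_elim, simp)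
  have B_sq: "square_integrable M (\<lambda>w. B w $ k)" for k
    by (rule square_integrable_cong_AE[OF L_sq[OF sk(3)] G_measurable_imp[OF B_meas]]) (use AE_B in eventually_elim, simp)
  have A0: "0 \<le> A w" and AB: "A w \<le> B w" for w
    by (simp_all add: A_def B_def less_eq_vec_def)
  have B0: "0 \<le> B w" for w using order_trans[OF A0 AB] .
  note mA = random_time_moments[OF A_meas A0 A_sq B_meas B_sq AB]
  note mB = random_time_moments[OF B_meas B0 B_sq B_meas B_sq order_refl]
  have tcA: "AE w in M. X (A w) w = time_change X L s w"
    using AE_A by eventually_elim (simp add: time_change_def vec_eq_iff[symmetric] vec_lambda_unique)
  have tcB: "AE w in M. X (B w) w = time_change X L t w"
    using AE_B by eventually_elim (simp add: time_change_def vec_eq_iff[symmetric] vec_lambda_unique)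
  have XA: "(\<lambda>w. X (A w) w) \<in> borel_measurable M" and XB: "(\<lambda>w. X (B w) w) \<in> borel_measurable M"
    using mA(1) mB(1) by (auto simp: square_integrable_def)
  have tA_meas: "time_change X L s \<in> borel_measurable M" and tB_meas: "time_change X L t \<in> borel_measurable M"
    by (rule borel_measurable_AE_cong[OF XA tcA], rule borel_measurable_AE_cong[OF XB tcB])
  have sqs: "square_integrable M (time_change X L s)" and sqt: "square_integrable M (time_change X L t)"
    by (rule square_integrable_cong_AE[OF mA(1) tA_meas tcA], rule square_integrable_cong_AE[OF mB(1) tB_meas tcB])
  let ?l = "\<lambda>k. \<integral>w. L k (s $ k) w \<partial>M" and ?m = "\<lambda>k. \<integral>w. L k (t $ k) w \<partial>M"
  have intA: "(LINT w|M. v \<bullet> A w) = (\<Sum>k\<in>UNIV. v $ k * ?l k)" for v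
  proof -
    have "(LINT w|M. v \<bullet> A w) = (\<Sum>k\<in>UNIV. v $ k * (LINT w|M. A w $ k))"
      unfolding inner_vec_sum using square_integrable_integrable[OF A_sq] by simp
    also have "\<dots> = (\<Sum>k\<in>UNIV. v $ k * ?l k)"
    proof (intro sum.cong arg_cong2[where f = "(*)"] refl integral_cong_AE)
      show "AE w in M. A w $ k = L k (s $ k) w" for k using AE_A by eventually_elim simp
    qed (use A_sq L_sq sk in \<open>auto simp: square_integrable_def\<close>)
    finally show ?thesis .
  qed
  have intB: "(LINT w|M. v \<bullet> B w) = (\<Sum>k\<in>UNIV. v $ k * ?m k)" for v
  proof -
    have "(LINT w|M. v \<bullet> B w) = (\<Sum>k\<in>UNIV. v $ k * (LINT w|M. B w $ k))"
      unfolding inner_vec_sum using square_integrable_integrable[OF B_sq] by simp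
    also have "\<dots> = (\<Sum>k\<in>UNIV. v $ k * ?m k)"
    proof (intro sum.cong arg_cong2[where f = "(*)"] refl integral_cong_AE)
      show "AE w in M. B w $ k = L k (t $ k) w" for k using AE_B by eventually_elim simp
    qed (use B_sq L_sq sk in \<open>auto simp: square_integrable_def\<close>)
    finally show ?thesis .
  qed
  let ?c = "\<lambda>j k. \<integral>w. L j (s $ j) w * L k (t $ k) w \<partial>M"
  have intAB: "(LINT w|M. (\<mu> \<bullet> A w) * (\<mu> \<bullet> B w)) = (\<Sum>j\<in>UNIV. \<Sum>k\<in>UNIV. \<mu> $ j * \<mu> $ k * ?c j k)"
  proof -
    have "(LINT w|M. (\<mu> \<bullet> A w) * (\<mu> \<bullet> B w)) = (LINT w|M. (\<Sum>j\<in>UNIV. \<Sum>k\<in>UNIV. (\<mu> $ j * \<mu> $ k) * (A w $ j * B w $ k)))"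
      unfolding inner_vec_sum sum_product by (intro Bochner_Integration.integral_cong sum.cong refl) (simp add: mult_ac)
    also have "\<dots> = (\<Sum>j\<in>UNIV. \<Sum>k\<in>UNIV. (\<mu> $ j * \<mu> $ k) * (LINT w|M. A w $ j * B w $ k))"
      using square_integrable_mult[OF A_sq B_sq] by simp
    also have "\<dots> = (\<Sum>j\<in>UNIV. \<Sum>k\<in>UNIV. \<mu> $ j * \<mu> $ k * ?c j k)"
    proof (intro sum.cong arg_cong2[where f = "(*)"] refl integral_cong_AE)
      show "AE w in M. A w $ j * B w $ k = L j (s $ j) w * L k (t $ k) w" for j k
        using AE_A AE_B by eventually_elim simp
    qed (use A_sq B_sq L_sq sk in \<open>auto simp: square_integrable_def intro!: borel_measurable_times\<close>)
    finally show ?thesis .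
  qed
  have cov: "?c j k - ?l j * ?m k = (if j = k then covariance M (L k (s $ k)) (L k (t $ k)) else 0)" for j k
  proof (cases "j = k")
    case True
    then show ?thesis using covariance_eq[OF L_sq[OF sk(1)] L_sq[OF sk(3)], of k k k k] by simp
  next
    case False
    have "?c j k = ?l j * ?m k"
      by (rule indep_var_lebesgue_integral[OF independent_processes_time_indep_var[OF \<open>prob_space M\<close> ind False sk(1) sk(3)]])
        (rule square_integrable_integrable[OF L_sq[OF sk(1)]] square_integrable_integrable[OF L_sq[OF sk(3)]])+
    then show ?thesis using False by simp
  qed
  have "(LINT w|M. time_change X L s w * time_change X L t w) = (LINT w|M. X (A w) w * X (B w) w)"
  proof (rule integral_cong_AE)
    show "AE w in M. time_change X L s w * time_change X L t w = X (A w) w * X (B w) w"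
      using tcA tcB by eventually_elim simp
  qed (use tA_meas tB_meas XA XB in simp_all)
  moreover have "(LINT w|M. time_change X L s w) = (LINT w|M. X (A w) w)"
    using tcA tA_meas XA by (intro integral_cong_AE) auto
  moreover have "(LINT w|M. time_change X L t w) = (LINT w|M. X (B w) w)"
    using tcB tB_meas XB by (intro integral_cong_AE) auto
  ultimately have "covariance M (time_change X L s) (time_change X L t) =
      (\<Sum>k\<in>UNIV. \<sigma> $ k * ?l k) + ((\<Sum>j\<in>UNIV. \<Sum>k\<in>UNIV. \<mu> $ j * \<mu> $ k * ?c j k) - (\<Sum>k\<in>UNIV. \<mu> $ k * ?l k) * (\<Sum>k\<in>UNIV. \<mu> $ k * ?m k))"
    unfolding covariance_eq[OF sqs sqt] mA(2,3) mB(2) intA intB intAB by simp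
  also have "(\<Sum>j\<in>UNIV. \<Sum>k\<in>UNIV. \<mu> $ j * \<mu> $ k * ?c j k) - (\<Sum>k\<in>UNIV. \<mu> $ k * ?l k) * (\<Sum>k\<in>UNIV. \<mu> $ k * ?m k)
      = (\<Sum>j\<in>UNIV. \<Sum>k\<in>UNIV. \<mu> $ j * \<mu> $ k * (?c j k - ?l j * ?m k))"
    by (simp add: sum_product sum_subtractf right_diff_distrib mult_ac)
  also have "\<dots> = (\<Sum>j\<in>UNIV. \<Sum>k\<in>UNIV. if j = k then (\<mu> $ k)\<^sup>2 * covariance M (L k (s $ k)) (L k (t $ k)) else 0)"
    unfolding cov by (intro sum.cong refl) (simp add: power2_eq_square)
  also have "\<dots> = (\<Sum>k\<in>UNIV. (\<mu> $ k)\<^sup>2 * covariance M (L k (s $ k)) (L k (t $ k)))"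
    by simp
  finally show ?thesis .
qed

section \<open>Asymptotic comparison\<close>

lemma behaves_like_onI:
  assumes "0 < c" "0 < C" "\<And>t. t \<in> D \<Longrightarrow> R \<le> norm t \<Longrightarrow> c \<le> f t / g t \<and> f t / g t \<le> C"
  shows "behaves_like_on D f g"
  unfolding behaves_like_on_def eventually_inf_principal eventually_at_infinity using assms by blast

text \<open>With the numerator between constants and \<open>Vs\<close> fixed, the rate is that of
  \<open>Vt\<close>: the quotient equals \<open>N / sqrt Vs * sqrt (nv / Vt)\<close>, and
  \<open>nv / Vt\<close> lies between \<open>1 / v2\<close> and \<open>1 / v1\<close>.\<close>

lemma correlation_ratio_bounds:
  assumes N: "0 < n1" "n1 \<le> N" "N \<le> n2" and Vs: "0 < Vs" and v1: "0 < v1" and nv: "0 < nv"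
    and Vt: "v1 * nv \<le> Vt" "Vt \<le> v2 * nv"
  shows "n1 / (sqrt Vs * sqrt v2) \<le> N / (sqrt Vs * sqrt Vt) / (1 / sqrt nv)"
    and "N / (sqrt Vs * sqrt Vt) / (1 / sqrt nv) \<le> n2 / (sqrt Vs * sqrt v1)"
proof -
  have Vt0: "0 < Vt" using mult_pos_pos[OF v1 nv] Vt(1) by linarith
  then have v2: "0 < v2" using Vt(2) nv by (metis less_le_trans zero_less_mult_pos2)
  have eq: "N / (sqrt Vs * sqrt Vt) / (1 / sqrt nv) = N / sqrt Vs * sqrt (nv / Vt)"
    by (simp add: real_sqrt_divide)
  have "sqrt (1 / v2) \<le> sqrt (nv / Vt)"
    using Vt(2) Vt0 v2 by (intro real_sqrt_le_mono) (simp add: field_simps)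
  then have "n1 / sqrt Vs * sqrt (1 / v2) \<le> N / sqrt Vs * sqrt (nv / Vt)"
    using N Vs v2 nv Vt0 by (intro mult_mono divide_right_mono) auto
  then show "n1 / (sqrt Vs * sqrt v2) \<le> N / (sqrt Vs * sqrt Vt) / (1 / sqrt nv)"
    unfolding eq by (simp add: real_sqrt_divide)
  have "sqrt (nv / Vt) \<le> sqrt (1 / v1)"
    using Vt(1) Vt0 v1 by (intro real_sqrt_le_mono) (simp add: field_simps)
  then have "N / sqrt Vs * sqrt (nv / Vt) \<le> n2 / sqrt Vs * sqrt (1 / v1)"
    using N Vs v1 nv Vt0 by (intro mult_mono divide_right_mono) auto
  then show "N / (sqrt Vs * sqrt Vt) / (1 / sqrt nv) \<le> n2 / (sqrt Vs * sqrt v1)"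
    unfolding eq by (simp add: real_sqrt_divide)
qed

lemma weighted_sum_ge:
  fixes w :: "'n::finite \<Rightarrow> real"
  assumes w: "\<And>k. 0 < w k"
  obtains c where "0 < c" "\<And>x. (\<And>k. 0 \<le> x k) \<Longrightarrow> c * (\<Sum>k\<in>UNIV. x k) \<le> (\<Sum>k\<in>UNIV. w k * x k)"
proof
  show "0 < Min (range w)" using w by (subst Min_gr_iff) auto
  fix x :: "'n \<Rightarrow> real" assume x: "\<And>k. 0 \<le> x k"
  show "Min (range w) * (\<Sum>k\<in>UNIV. x k) \<le> (\<Sum>k\<in>UNIV. w k * x k)"
    unfolding sum_distrib_left using x by (intro sum_mono mult_right_mono) auto
qed

lemma weighted_sum_le:
  fixes w x :: "'n::finite \<Rightarrow> real"
  assumes w: "\<And>k. 0 \<le> w k" and x: "\<And>k. 0 \<le> x k"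
  shows "(\<Sum>k\<in>UNIV. w k * x k) \<le> (\<Sum>k\<in>UNIV. w k) * (\<Sum>k\<in>UNIV. x k)"
  unfolding sum_distrib_right
  using w x by (intro sum_mono mult_left_mono member_le_sum) auto

lemma norm_vec_powr_bounds:
  fixes t :: "real ^ 'n"
  shows "norm (vec_powr t \<beta>) \<le> (\<Sum>k\<in>UNIV. t $ k powr \<beta>)"
    and "(\<Sum>k\<in>UNIV. t $ k powr \<beta>) \<le> real CARD('n) * norm (vec_powr t \<beta>)"
proof -
  show "norm (vec_powr t \<beta>) \<le> (\<Sum>k\<in>UNIV. t $ k powr \<beta>)"
    using norm_le_l1_cart[of "vec_powr t \<beta>"] by (simp add: vec_powr_def)
  have "t $ k powr \<beta> \<le> norm (vec_powr t \<beta>)" for k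
    using component_le_norm_cart[of "vec_powr t \<beta>" k] by (simp add: vec_powr_def)
  then have "(\<Sum>k\<in>UNIV. t $ k powr \<beta>) \<le> (\<Sum>k\<in>(UNIV :: 'n set). norm (vec_powr t \<beta>))"
    by (intro sum_mono)
  then show "(\<Sum>k\<in>UNIV. t $ k powr \<beta>) \<le> real CARD('n) * norm (vec_powr t \<beta>)"
    by simp
qed

lemma norm_vec_powr_pos:
  fixes t :: "real ^ 'n"
  assumes "t \<noteq> 0"
  shows "0 < norm (vec_powr t \<beta>)"
proof -
  obtain k where "t $ k \<noteq> 0" using assms by (auto simp: vec_eq_iff)
  then have "vec_powr t \<beta> $ k \<noteq> 0" by (simp add: vec_powr_def)
  then show ?thesis by auto
qed

text \<open>Otherwise the Euclidean norm would exceed the sum of the coordinates.\<close>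

lemma ex_component_ge:
  fixes t :: "real ^ 'n"
  assumes "0 \<le> t"
  shows "\<exists>k. norm t \<le> real CARD('n) * t $ k"
proof (rule ccontr)
  assume "\<nexists>k. norm t \<le> real CARD('n) * t $ k"
  then have lt: "real CARD('n) * t $ k < norm t" for k by (simp add: not_le)
  have "real CARD('n) * norm t \<le> real CARD('n) * (\<Sum>k\<in>UNIV. \<bar>t $ k\<bar>)"
    by (intro mult_left_mono norm_le_l1_cart) simp
  also have "\<dots> = (\<Sum>k\<in>UNIV. real CARD('n) * t $ k)"
    using assms by (simp add: sum_distrib_left less_eq_vec_def)
  also have "\<dots> < (\<Sum>k\<in>(UNIV :: 'n set). norm t)"
    using lt by (intro sum_strict_mono) auto
  finally show False by simp
qed

text \<open>With drift the variance contains terms of both orders, and here the lower one is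
  absorbed. The bound on the norm forces some coordinate to be at least 1, so the sum on the right
  is at least 1 and also absorbs the constants from \<open>y \<le> 1 + y^2\<close>.\<close>

lemma powr_sum_le_double:
  fixes t :: "real ^ 'n"
  assumes t: "0 \<le> t" "real CARD('n) \<le> norm t" and \<alpha>: "0 < \<alpha>"
  shows "(\<Sum>k\<in>UNIV. t $ k powr \<alpha>) \<le> (real CARD('n) + 1) * (\<Sum>k\<in>UNIV. t $ k powr (2 * \<alpha>))"
proof -
  let ?S = "\<Sum>k\<in>UNIV. t $ k powr (2 * \<alpha>)"
  have tk: "0 \<le> t $ k" for k using t by (simp add: less_eq_vec_def)
  have 1: "t $ k powr \<alpha> \<le> 1 + t $ k powr (2 * \<alpha>)" for k
  proof -
    define y where "y = t $ k powr \<alpha>"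
    have "t $ k powr (2 * \<alpha>) = y\<^sup>2" by (simp add: y_def power2_eq_square flip: powr_add)
    moreover have "y \<le> 1 + y\<^sup>2" using zero_le_power2[of "y - 1 / 2"] by (simp add: power2_diff power2_eq_square field_simps)
    ultimately show ?thesis by (simp add: y_def)
  qed
  obtain k where "norm t \<le> real CARD('n) * t $ k" using ex_component_ge[OF t(1)] by blast
  with t(2) have "real CARD('n) * 1 \<le> real CARD('n) * t $ k" by linarith
  then have "1 \<le> t $ k" by (rule mult_left_le_imp_le) simp
  then have "1 \<le> t $ k powr (2 * \<alpha>)" using \<alpha> by (simp add: ge_one_powr_ge_zero)
  also have "\<dots> \<le> ?S" by (intro member_le_sum) auto
  finally have S: "1 \<le> ?S" .
  have "(\<Sum>k\<in>UNIV. t $ k powr \<alpha>) \<le> (\<Sum>k\<in>UNIV. 1 + t $ k powr (2 * \<alpha>))" by (intro sum_mono 1)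
  also have "\<dots> = real CARD('n) * 1 + ?S" by (simp add: sum.distrib)
  also have "\<dots> \<le> real CARD('n) * ?S + ?S" using S by (intro add_right_mono mult_left_mono) auto
  finally show ?thesis by (simp add: algebra_simps)
qed

text \<open>Let \<open>u\<close> be the part of \<open>t\<close> along the nonzero drifts. Some
  coordinate of \<open>u\<close> is at least \<open>norm t\<close> up to a constant factor and so
  dominates every coordinate of \<open>t\<close>. \<open>max K 1\<close> keeps that factor positive
  for any real \<open>K\<close>.\<close>

lemma drift_dominated_powr_sum_le:
  fixes t \<mu> s :: "real ^ 'n"
  assumes t: "0 \<le> t" "t \<in> drift_dominated \<mu> s K" and \<beta>: "0 \<le> \<beta>"
  shows "(\<Sum>k\<in>UNIV. t $ k powr \<beta>) \<le> real CARD('n) * (max K 1 * real CARD('n)) powr \<beta> *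
    (\<Sum>k\<in>UNIV. if \<mu> $ k = 0 then 0 else t $ k powr \<beta>)"
proof -
  define u :: "real ^ 'n" where "u = (\<chi> j. if \<mu> $ j = 0 then 0 else t $ j)"
  let ?C = "max K 1 * real CARD('n)"
  have tk: "0 \<le> t $ k" for k using t by (simp add: less_eq_vec_def)
  have u0: "0 \<le> u" using tk by (simp add: u_def less_eq_vec_def)
  have "norm t \<le> K * norm u" using t(2) by (simp add: drift_dominated_def u_def)
  also have "\<dots> \<le> max K 1 * norm u" by (intro mult_right_mono) auto
  finally have tu: "norm t \<le> max K 1 * norm u" .
  obtain j where "norm u \<le> real CARD('n) * u $ j" using ex_component_ge[OF u0] by blast
  then have "max K 1 * norm u \<le> max K 1 * (real CARD('n) * u $ j)" by (intro mult_left_mono) auto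
  with tu have tj: "norm t \<le> ?C * u $ j" by (simp add: mult.assoc)
  have uj: "0 \<le> u $ j" using u0 by (simp add: less_eq_vec_def)
  have C: "0 < ?C" by (intro mult_pos_pos) (auto simp: max_def)
  have le: "t $ k powr \<beta> \<le> ?C powr \<beta> * u $ j powr \<beta>" for k
  proof -
    have "t $ k \<le> ?C * u $ j" using component_le_norm_cart[of t k] tj by simp
    then have "t $ k powr \<beta> \<le> (?C * u $ j) powr \<beta>" using tk \<beta> by (intro powr_mono2) auto
    then show ?thesis using C uj by (simp add: powr_mult)
  qed
  have "u $ j powr \<beta> \<le> (\<Sum>k\<in>UNIV. u $ k powr \<beta>)" by (intro member_le_sum) auto
  also have "\<dots> = (\<Sum>k\<in>UNIV. if \<mu> $ k = 0 then 0 else t $ k powr \<beta>)"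
    by (intro sum.cong) (auto simp: u_def)
  finally have uS: "u $ j powr \<beta> \<le> (\<Sum>k\<in>UNIV. if \<mu> $ k = 0 then 0 else t $ k powr \<beta>)" .
  have "(\<Sum>k\<in>UNIV. t $ k powr \<beta>) \<le> (\<Sum>k\<in>(UNIV :: 'n set). ?C powr \<beta> * u $ j powr \<beta>)"
    by (intro sum_mono le)
  also have "\<dots> = real CARD('n) * ?C powr \<beta> * u $ j powr \<beta>" by simp
  also have "\<dots> \<le> real CARD('n) * ?C powr \<beta> * (\<Sum>k\<in>UNIV. if \<mu> $ k = 0 then 0 else t $ k powr \<beta>)"
    by (intro mult_left_mono uS) simp
  finally show ?thesis .
qed

section \<open>The autocorrelation of the time-changed process\<close>

lemma stable_subordinatorE:
  assumes "prob_space M" "stable_subordinator M \<alpha> H" "0 < \<alpha>" "\<alpha> < 1"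
    and "\<And>t. 0 \<le> t \<Longrightarrow> inverse_process H t \<in> borel_measurable (completion M)"
  obtains c where "stable_subordinator_inverse M \<alpha> c H"
proof -
  obtain c where "c > 0" "\<forall>t\<ge>0. \<forall>r\<ge>0. (LINT w|M. exp (- r * H t w)) = exp (- c * t * r powr \<alpha>)"
    using assms(2) unfolding stable_subordinator_def by blast
  with assms have "stable_subordinator_inverse M \<alpha> c H"
    unfolding stable_subordinator_inverse_def stable_subordinator_def by blast
  then show thesis by (rule that)
qed

context stable_subordinator_inverse
begin

lemma L_covariance_nonneg: "0 \<le> s \<Longrightarrow> s \<le> t \<Longrightarrow> 0 \<le> covariance (completion M) (L s) (L t)"
  using L_covariance_bounds(1)[of s t] C.covariance_eq[OF L_square_integrable L_square_integrable, of s t] by simp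

lemma L_covariance_le:
  "0 \<le> s \<Longrightarrow> s \<le> t \<Longrightarrow> covariance (completion M) (L s) (L t) \<le> (LINT w|completion M. (L s w)\<^sup>2)"
  using L_covariance_bounds(2)[of s t] C.covariance_eq[OF L_square_integrable L_square_integrable, of s t] by simp

lemma L_covariance_self_le:
  assumes "0 \<le> t"
  shows "covariance (completion M) (L t) (L t) \<le> 4 * exp 1 / c\<^sup>2 * t powr (2 * \<alpha>)"
  using L_covariance_le[OF assms order_refl] L_second_moment_le[OF assms] by simp

lemma L_covariance_self_ge:
  assumes "0 \<le> t"
  shows "(1 / 32) powr (1 / (1 - \<alpha>)) / (256 * c\<^sup>2) * t powr (2 * \<alpha>) \<le> covariance (completion M) (L t) (L t)"
  using L_variance_ge[OF assms] unfolding C.covariance_self .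

lemma L_expectation_nonneg: "0 \<le> (LINT w|completion M. L t w)"
  using L_nonneg_AE by (rule integral_nonneg_AE)

text \<open>Jensen's inequality for the square, read off from \<open>L_covariance_bounds\<close> at
  equal times, followed by the second moment bound.\<close>

lemma L_expectation_le:
  assumes t: "0 \<le> t"
  shows "(LINT w|completion M. L t w) \<le> sqrt (4 * exp 1 / c\<^sup>2) * t powr \<alpha>"
proof (rule power2_le_imp_le)
  have "(LINT w|completion M. L t w)\<^sup>2 \<le> (LINT w|completion M. (L t w)\<^sup>2)"
    using L_covariance_bounds(1)[OF t order_refl] by (simp add: power2_eq_square)
  also have "\<dots> \<le> 4 * exp 1 / c\<^sup>2 * t powr (2 * \<alpha>)" by (rule L_second_moment_le[OF t])
  also have "\<dots> = (sqrt (4 * exp 1 / c\<^sup>2))\<^sup>2 * (t powr \<alpha>)\<^sup>2"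
    by (subst real_sqrt_pow2) (simp_all add: power2_eq_square flip: powr_add)
  finally show "(LINT w|completion M. L t w)\<^sup>2 \<le> (sqrt (4 * exp 1 / c\<^sup>2) * t powr \<alpha>)\<^sup>2"
    by (simp only: power_mult_distrib)
  show "0 \<le> sqrt (4 * exp 1 / c\<^sup>2) * t powr \<alpha>" by simp
qed

end

theorem mainTheorem5:
  fixes M :: "'w measure"
    and X :: "real ^ 'n \<Rightarrow> 'w \<Rightarrow> real"
    and \<psi> :: "'n \<Rightarrow> real \<Rightarrow> complex"
    and H L :: "'n \<Rightarrow> real \<Rightarrow> 'w \<Rightarrow> real"
    and \<alpha> :: real
    and \<mu> s :: "real ^ 'n"
    and \<rho> :: "real ^ 'n \<Rightarrow> real"
  assumes "prob_space M"
    and "levy_process M X"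
    and "levy_exponent M X \<psi>"
    and "\<And>j. twice_differentiable_near (\<psi> j) 0"
    and "\<And>j. deriv2 (\<psi> j) 0 \<noteq> 0"
    and "\<And>j. \<mu> $ j = prob_space.expectation M (X (axis j 1))"
    and "0 < \<alpha>" and "\<alpha> < 1"
    and "\<And>k. stable_subordinator M \<alpha> (H k)"
    and "\<And>k. L k = inverse_process (H k)"
    and "independent_processes (completion M) X L"
    and "0 \<le> s" and "s \<noteq> 0"
    and "\<And>t. \<rho> t = correlation (completion M) (time_change X L s) (time_change X L t)"
  shows "(\<mu> = 0 \<longrightarrow>
            behaves_like_on {s..} \<rho> (\<lambda>t. 1 / sqrt (norm (vec_powr t \<alpha>)))) \<and>
         ((\<forall>j. \<mu> $ j \<noteq> 0) \<longrightarrow>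
            behaves_like_on {s..} \<rho> (\<lambda>t. 1 / sqrt (norm (vec_powr t (2 * \<alpha>))))) \<and>
         (\<mu> \<noteq> 0 \<longrightarrow>
            (\<forall>K. behaves_like_on (drift_dominated \<mu> s K) \<rho>
                   (\<lambda>t. 1 / sqrt (norm (vec_powr t (2 * \<alpha>))))))"
proof -
  note P = assms(1) and X = assms(2) and alpha = assms(7,8) and H = assms(9) and L = assms(10)
    and ind = assms(11) and s0 = assms(12) and s_nz = assms(13) and rho = assms(14)
  let ?P = "completion M"
  have C: "prob_space ?P" by (rule prob_space.prob_space_completion[OF P])
  interpret C: prob_space ?P by (rule C)
  define \<sigma> where "\<sigma> = axis_variances M X"
  have \<sigma>: "0 < \<sigma> $ j" for j
    unfolding \<sigma>_def by (rule axis_variances_pos[OF assms(1-6)])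
  have X_meas: "X t \<in> borel_measurable M" if "0 \<le> t" for t
    by (rule levy_process_measurable[OF X that])
  have X_sq: "square_integrable ?P (X t)" if t: "0 \<le> t" for t
    using levy_process_moments(1)[OF assms(1-6) t] X_meas[OF t]
    by (simp add: square_integrable_def measurable_completion integrable_completion)
  have X_mean: "(LINT w|?P. X t w) = \<mu> \<bullet> t" if t: "0 \<le> t" for t
    using levy_process_moments(2)[OF assms(1-6) t] integral_completion[OF X_meas[OF t]] by simp
  have X_mixed: "(LINT w|?P. X a w * X b w) = \<sigma> \<bullet> a + (\<mu> \<bullet> a) * (\<mu> \<bullet> b)" if ab: "0 \<le> a" "a \<le> b" for a b
  proof -
    have "(\<lambda>w. X a w * X b w) \<in> borel_measurable M"
      using X_meas[OF ab(1)] X_meas[OF order_trans[OF ab]] by simp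
    then show ?thesis
      unfolding \<sigma>_def using levy_process_mixed_moment[OF assms(1-6) ab] by (simp add: integral_completion)
  qed
  have X_cadlag: "AE w in ?P. cadlag_path (\<lambda>t. X t w)"
    by (rule AE_completion[OF levy_process_cadlag_AE[OF X]])
  have "\<exists>c. stable_subordinator_inverse M \<alpha> c (H k)" for k
  proof -
    have "inverse_process (H k) t \<in> borel_measurable ?P" if "0 \<le> t" for t
      using independent_processes_time_measurable[OF C ind that, of k] by (simp add: L)
    then show ?thesis
      using stable_subordinatorE[OF P H[of k] alpha] by metis
  qed
  then obtain c where S: "\<And>k. stable_subordinator_inverse M \<alpha> (c k) (H k)" by metis
  have c: "0 < c k" for k by (rule stable_subordinator_inverse.c[OF S])
  note L_nonneg = stable_subordinator_inverse.L_expectation_nonneg[OF S, folded L]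
  let ?l = "\<lambda>k u. \<integral>w. L k u w \<partial>?P"
  let ?cv = "\<lambda>k u v. covariance ?P (L k u) (L k v)"
  let ?N = "\<lambda>t. covariance ?P (time_change X L s) (time_change X L t)"
  let ?V = "\<lambda>t. C.variance (time_change X L t)"
  have tk: "0 \<le> t $ k" if "0 \<le> t" for t :: "real ^ 'n" and k
    using that by (simp add: less_eq_vec_def)
  have cov: "covariance ?P (time_change X L a) (time_change X L b) =
      (\<Sum>k\<in>UNIV. \<sigma> $ k * ?l k (a $ k)) + (\<Sum>k\<in>UNIV. (\<mu> $ k)\<^sup>2 * ?cv k (a $ k) (b $ k))"
    if "0 \<le> a" "a \<le> b" for a b
  proof (rule time_change_covariance[OF C _ ind X_sq X_mean X_mixed X_cadlag])
    show "complete_measure ?P" by (rule completion.complete_measure_axioms)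
    show "square_integrable ?P (L k u)" if "0 \<le> u" for k u
      unfolding L by (rule stable_subordinator_inverse.L_square_integrable[OF S that])
    show "AE w in ?P. 0 \<le> L k u w" for k u
      unfolding L by (rule stable_subordinator_inverse.L_nonneg_AE[OF S])
    show "AE w in ?P. L k u w \<le> L k v w" if "u \<le> v" for k u v
      unfolding L by (rule stable_subordinator_inverse.L_mono_AE[OF S that])
  qed (use that in auto)
  have V: "?V t = (\<Sum>k\<in>UNIV. \<sigma> $ k * ?l k (t $ k)) + (\<Sum>k\<in>UNIV. (\<mu> $ k)\<^sup>2 * ?cv k (t $ k) (t $ k))"
    if "0 \<le> t" for t
    using cov[OF that order_refl] unfolding C.covariance_self .
  have rho_eq: "\<rho> t = ?N t / (sqrt (?V s) * sqrt (?V t))" for t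
    unfolding rho correlation_def ..

  \<comment> \<open>\<open>n1\<close> is the \<sigma> part of the covariance, which depends on
    \<open>s\<close> alone; \<open>n2\<close> adds for every clock the largest covariance allowed by
    \<open>L_covariance_le\<close>. Together they enclose the numerator uniformly in
    \<open>t\<close>.\<close>
  define n1 where "n1 = (\<Sum>k\<in>UNIV. \<sigma> $ k * ?l k (s $ k))"
  define n2 where "n2 = n1 + (\<Sum>k\<in>UNIV. (\<mu> $ k)\<^sup>2 * (LINT w|?P. (L k (s $ k) w)\<^sup>2))"
  have l_term_nonneg: "0 \<le> \<sigma> $ k * ?l k u" for k u
    using \<sigma>[of k] L_nonneg[of k u] by simp
  have n1: "0 < n1"
  proof -
    \<comment> \<open>A nonzero coordinate of \<open>s\<close> supplies a clock with positive mean;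
      it makes the numerator positive and, through \<open>t = s\<close>, also the variance at
      \<open>s\<close>.\<close>
    obtain k where "s $ k \<noteq> 0" using s_nz by (auto simp: vec_eq_iff)
    then have "0 < s $ k powr \<alpha> / (8 * c k)" using c by simp
    also have "\<dots> \<le> ?l k (s $ k)"
      unfolding L by (rule stable_subordinator_inverse.L_expectation_ge[OF S tk[OF s0]])
    finally have "0 < \<sigma> $ k * ?l k (s $ k)" using \<sigma> by simp
    also have "\<dots> \<le> n1" unfolding n1_def by (intro member_le_sum l_term_nonneg) auto
    finally show ?thesis .
  qed
  have cv_nonneg: "0 \<le> ?cv k u v" if "0 \<le> u" "u \<le> v" for k u v
    unfolding L by (rule stable_subordinator_inverse.L_covariance_nonneg[OF S that])
  have N: "n1 \<le> ?N t" "?N t \<le> n2" if t: "s \<le> t" for t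
  proof -
    have st: "s $ k \<le> t $ k" for k using t by (simp add: less_eq_vec_def)
    show "n1 \<le> ?N t"
      unfolding cov[OF s0 t] n1_def using cv_nonneg[OF tk[OF s0] st] by (simp add: sum_nonneg)
    have "?cv k (s $ k) (t $ k) \<le> (LINT w|?P. (L k (s $ k) w)\<^sup>2)" for k
      unfolding L by (rule stable_subordinator_inverse.L_covariance_le[OF S tk[OF s0] st])
    then show "?N t \<le> n2"
      unfolding cov[OF s0 t] n1_def n2_def by (intro add_left_mono sum_mono mult_left_mono) auto
  qed
  have n2: "0 < n2" using n1 N[OF order_refl] by linarith
  have Vs: "0 < ?V s" using n1 N(1)[OF order_refl] unfolding C.covariance_self by linarith

  \<comment> \<open>Constants of the clock estimates: \<open>b k\<close> belongs to the second
    moment, \<open>d k\<close> to the gap argument for the variance.\<close>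
  define b where "b k = 4 * exp 1 / (c k)\<^sup>2" for k
  define d where "d k = (1 / 32) powr (1 / (1 - \<alpha>)) / (256 * (c k)\<^sup>2)" for k
  have b: "0 < b k" and d: "0 < d k" for k using c[of k] by (simp_all add: b_def d_def)
  have l_ge: "u powr \<alpha> / (8 * c k) \<le> ?l k u" and l_le: "?l k u \<le> sqrt (b k) * u powr \<alpha>"
    and cv_ge: "d k * u powr (2 * \<alpha>) \<le> ?cv k u u" and cv_le: "?cv k u u \<le> b k * u powr (2 * \<alpha>)"
    if "0 \<le> u" for k u
    unfolding L b_def d_def
    using stable_subordinator_inverse.L_expectation_ge[OF S that] stable_subordinator_inverse.L_expectation_le[OF S that]
      stable_subordinator_inverse.L_covariance_self_ge[OF S that] stable_subordinator_inverse.L_covariance_self_le[OF S that]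
    by blast+
  define B1 where "B1 = (\<Sum>k\<in>UNIV. \<sigma> $ k * sqrt (b k))"
  have B1: "0 < B1" unfolding B1_def using \<sigma> b by (intro sum_pos) auto
  have drift_free_le: "(\<Sum>k\<in>UNIV. \<sigma> $ k * ?l k (t $ k)) \<le> B1 * (\<Sum>k\<in>UNIV. t $ k powr \<alpha>)" if t: "0 \<le> t" for t
  proof -
    have "(\<Sum>k\<in>UNIV. \<sigma> $ k * ?l k (t $ k)) \<le> (\<Sum>k\<in>UNIV. (\<sigma> $ k * sqrt (b k)) * t $ k powr \<alpha>)"
      unfolding mult.assoc using \<sigma> l_le[OF tk[OF t]] by (intro sum_mono mult_left_mono) (auto intro: less_imp_le)
    also have "\<dots> \<le> B1 * (\<Sum>k\<in>UNIV. t $ k powr \<alpha>)"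
      unfolding B1_def using \<sigma> b by (intro weighted_sum_le) (auto intro: less_imp_le)
    finally show ?thesis .
  qed
  have nonneg_of: "0 \<le> t" if "s \<le> t" for t using order_trans[OF s0 that] .

  have case_zero: "behaves_like_on {s..} \<rho> (\<lambda>t. 1 / sqrt (norm (vec_powr t \<alpha>)))" if mu: "\<mu> = 0"
  proof -
    \<comment> \<open>Without drift the variance is the \<sigma> part alone, a weighted sum of clock
      means; the lower bound \<open>u powr \<alpha> / (8 * c k)\<close> of each mean explains these
      weights.\<close>
    obtain a where a: "0 < a" "\<And>x. (\<And>k. 0 \<le> x k) \<Longrightarrow> a * (\<Sum>k\<in>UNIV. x k) \<le> (\<Sum>k\<in>UNIV. (\<sigma> $ k / (8 * c k)) * x k)"
      using weighted_sum_ge[of "\<lambda>k. \<sigma> $ k / (8 * c k)"] \<sigma> c by auto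
    let ?v2 = "B1 * real CARD('n)"
    have v2: "0 < ?v2" using B1 by simp
    show ?thesis
    proof (rule behaves_like_onI)
      show "0 < n1 / (sqrt (?V s) * sqrt ?v2)" "0 < n2 / (sqrt (?V s) * sqrt a)"
        using n1 n2 Vs v2 a(1) by simp_all
      fix t :: "real ^ 'n" assume "t \<in> {s..}" and R: "1 \<le> norm t"
      then have st: "s \<le> t" by simp
      have t: "0 \<le> t" by (rule nonneg_of[OF st])
      have nv: "0 < norm (vec_powr t \<alpha>)" using R by (intro norm_vec_powr_pos) auto
      have Vt: "?V t = (\<Sum>k\<in>UNIV. \<sigma> $ k * ?l k (t $ k))" using V[OF t] mu by simp
      have "a * norm (vec_powr t \<alpha>) \<le> a * (\<Sum>k\<in>UNIV. t $ k powr \<alpha>)"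
        using a(1) norm_vec_powr_bounds(1) by (intro mult_left_mono) auto
      also have "\<dots> \<le> (\<Sum>k\<in>UNIV. (\<sigma> $ k / (8 * c k)) * t $ k powr \<alpha>)" by (rule a(2)) simp
      also have "\<dots> = (\<Sum>k\<in>UNIV. \<sigma> $ k * (t $ k powr \<alpha> / (8 * c k)))" by simp
      also have "\<dots> \<le> ?V t"
        unfolding Vt using \<sigma> l_ge[OF tk[OF t]] by (intro sum_mono mult_left_mono) (auto intro: less_imp_le)
      finally have lo: "a * norm (vec_powr t \<alpha>) \<le> ?V t" .
      have "?V t \<le> B1 * (\<Sum>k\<in>UNIV. t $ k powr \<alpha>)" unfolding Vt by (rule drift_free_le[OF t])
      also have "\<dots> \<le> B1 * (real CARD('n) * norm (vec_powr t \<alpha>))"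
        using B1 norm_vec_powr_bounds(2) by (intro mult_left_mono) auto
      finally have up: "?V t \<le> ?v2 * norm (vec_powr t \<alpha>)" by (simp add: mult.assoc)
      show "n1 / (sqrt (?V s) * sqrt ?v2) \<le> \<rho> t / (1 / sqrt (norm (vec_powr t \<alpha>))) \<and>
        \<rho> t / (1 / sqrt (norm (vec_powr t \<alpha>))) \<le> n2 / (sqrt (?V s) * sqrt a)"
        unfolding rho_eq
        using correlation_ratio_bounds[OF n1 N[OF st] Vs a(1) nv lo up] by (rule conjI)
    qed
  qed

  have case_drift: "behaves_like_on (drift_dominated \<mu> s K) \<rho> (\<lambda>t. 1 / sqrt (norm (vec_powr t (2 * \<alpha>))))" for K
  proof -
    \<comment> \<open>The weight 1 at coordinates without drift is a placeholder: it keeps all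
      weights positive for \<open>weighted_sum_ge\<close> and is only ever multiplied by 0.\<close>
    let ?w = "\<lambda>k. if \<mu> $ k = 0 then 1 else (\<mu> $ k)\<^sup>2 * d k"
    have "0 < ?w k" for k using d by simp
    from weighted_sum_ge[of ?w, OF this]
    obtain a where a: "0 < a" "\<And>x. (\<And>k. 0 \<le> x k) \<Longrightarrow> a * (\<Sum>k\<in>UNIV. x k) \<le> (\<Sum>k\<in>UNIV. ?w k * x k)"
      by blast
    define Q where "Q = real CARD('n) * (max K 1 * real CARD('n)) powr (2 * \<alpha>)"
    have Q: "0 < Q"
    proof -
      have "0 < max K 1 * real CARD('n)" by (intro mult_pos_pos) (auto simp: max_def)
      then show ?thesis by (simp add: Q_def)
    qed
    define B2 where "B2 = (\<Sum>k\<in>UNIV. (\<mu> $ k)\<^sup>2 * b k)"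
    have B2: "0 \<le> B2" unfolding B2_def by (intro sum_nonneg mult_nonneg_nonneg less_imp_le[OF b] zero_le_power2)
    \<comment> \<open>The lower constant comes from the drift part of the variance alone, where
      \<open>Q\<close> is the price for replacing the full sum of powers by the sum over nonzero
      drifts. The upper one adds the \<sigma> part, raised to the higher order; the last factor
      \<open>CARD('n)\<close> passes from the sum to the norm.\<close>
    let ?v1 = "a / Q" and ?v2 = "(B1 * (real CARD('n) + 1) + B2) * real CARD('n)"
    have v1: "0 < ?v1" using a Q by simp
    have v2: "0 < ?v2" using B1 B2 by (intro mult_pos_pos add_pos_nonneg) auto
    show ?thesis
    proof (rule behaves_like_onI)
      show "0 < n1 / (sqrt (?V s) * sqrt ?v2)" "0 < n2 / (sqrt (?V s) * sqrt ?v1)"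
        using n1 n2 Vs v2 v1 by simp_all
      \<comment> \<open>This threshold on the norm is the one that \<open>powr_sum_le_double\<close>
        requires.\<close>
      fix t :: "real ^ 'n" assume tD: "t \<in> drift_dominated \<mu> s K" and R: "real CARD('n) \<le> norm t"
      then have st: "s \<le> t" by (simp add: drift_dominated_def)
      have t: "0 \<le> t" by (rule nonneg_of[OF st])
      have "0 < real CARD('n)" by simp
      then have "t \<noteq> 0" using R by auto
      then have nv: "0 < norm (vec_powr t (2 * \<alpha>))" by (rule norm_vec_powr_pos)
      let ?S = "\<Sum>k\<in>UNIV. t $ k powr (2 * \<alpha>)"
      let ?J = "\<Sum>k\<in>UNIV. if \<mu> $ k = 0 then 0 else t $ k powr (2 * \<alpha>)"
      have drift_part: "(\<Sum>k\<in>UNIV. (\<mu> $ k)\<^sup>2 * ?cv k (t $ k) (t $ k)) \<le> ?V t"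
        unfolding V[OF t] using l_term_nonneg by (simp add: sum_nonneg)
      have "?v1 * norm (vec_powr t (2 * \<alpha>)) \<le> ?v1 * ?S"
        using v1 norm_vec_powr_bounds(1) by (intro mult_left_mono) auto
      also have "\<dots> \<le> ?v1 * (Q * ?J)"
        using v1 drift_dominated_powr_sum_le[OF t tD, of "2 * \<alpha>"] alpha unfolding Q_def by (intro mult_left_mono) auto
      also have "\<dots> = a * ?J" using Q by simp
      also have "\<dots> \<le> (\<Sum>k\<in>UNIV. ?w k * (if \<mu> $ k = 0 then 0 else t $ k powr (2 * \<alpha>)))" by (rule a(2)) simp
      also have "\<dots> \<le> (\<Sum>k\<in>UNIV. (\<mu> $ k)\<^sup>2 * ?cv k (t $ k) (t $ k))"
      proof (rule sum_mono)
        fix k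
        have "(\<mu> $ k)\<^sup>2 * (d k * t $ k powr (2 * \<alpha>)) \<le> (\<mu> $ k)\<^sup>2 * ?cv k (t $ k) (t $ k)"
          by (intro mult_left_mono cv_ge[OF tk[OF t]]) simp
        then show "?w k * (if \<mu> $ k = 0 then 0 else t $ k powr (2 * \<alpha>)) \<le> (\<mu> $ k)\<^sup>2 * ?cv k (t $ k) (t $ k)"
          by (simp add: mult.assoc)
      qed
      also note drift_part
      finally have lo: "?v1 * norm (vec_powr t (2 * \<alpha>)) \<le> ?V t" .
      have "(\<Sum>k\<in>UNIV. \<sigma> $ k * ?l k (t $ k)) \<le> B1 * (\<Sum>k\<in>UNIV. t $ k powr \<alpha>)"
        by (rule drift_free_le[OF t])
      also have "\<dots> \<le> B1 * ((real CARD('n) + 1) * ?S)"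
        using B1 powr_sum_le_double[OF t R alpha(1)] by (intro mult_left_mono) auto
      finally have up1: "(\<Sum>k\<in>UNIV. \<sigma> $ k * ?l k (t $ k)) \<le> B1 * ((real CARD('n) + 1) * ?S)" .
      have "(\<Sum>k\<in>UNIV. (\<mu> $ k)\<^sup>2 * ?cv k (t $ k) (t $ k)) \<le> (\<Sum>k\<in>UNIV. ((\<mu> $ k)\<^sup>2 * b k) * t $ k powr (2 * \<alpha>))"
        unfolding mult.assoc using cv_le[OF tk[OF t]] by (intro sum_mono mult_left_mono) auto
      also have "\<dots> \<le> B2 * ?S"
        unfolding B2_def by (intro weighted_sum_le mult_nonneg_nonneg less_imp_le[OF b] zero_le_power2 powr_ge_zero)
      finally have "?V t \<le> (B1 * (real CARD('n) + 1) + B2) * ?S"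
        using up1 unfolding V[OF t] by (simp add: algebra_simps)
      also have "\<dots> \<le> (B1 * (real CARD('n) + 1) + B2) * (real CARD('n) * norm (vec_powr t (2 * \<alpha>)))"
        using B1 B2 norm_vec_powr_bounds(2) by (intro mult_left_mono) auto
      finally have up: "?V t \<le> ?v2 * norm (vec_powr t (2 * \<alpha>))" by (simp only: mult.assoc)
      show "n1 / (sqrt (?V s) * sqrt ?v2) \<le> \<rho> t / (1 / sqrt (norm (vec_powr t (2 * \<alpha>)))) \<and>
        \<rho> t / (1 / sqrt (norm (vec_powr t (2 * \<alpha>)))) \<le> n2 / (sqrt (?V s) * sqrt ?v1)"
        unfolding rho_eq
        using correlation_ratio_bounds[OF n1 N[OF st] Vs v1 nv lo up] by (rule conjI)
    qed
  qed

  have case_all: "behaves_like_on {s..} \<rho> (\<lambda>t. 1 / sqrt (norm (vec_powr t (2 * \<alpha>))))" if mu: "\<forall>j. \<mu> $ j \<noteq> 0"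
  proof -
    \<comment> \<open>When every drift is nonzero the restricted vector is \<open>t\<close> itself,
      so \<open>K = 1\<close> leaves only the condition \<open>s \<le> t\<close>.\<close>
    have "drift_dominated \<mu> s 1 = {s..}"
      using mu by (auto simp: drift_dominated_def)
    then show ?thesis using case_drift[of 1] by simp
  qed
  show ?thesis using case_zero case_all case_drift by blast
qed

end
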